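(* Let $G$ be a group with neutral element $e$ and let $S$ be a nonzero $s$-unital strongly $G$-graded ring. Then $S$ is not prime if and only if $S$ has an NP-datum $(H,N,I,\tilde{A},\tilde{B})$ for which $\tilde{A}$ and $\tilde{B}$ are both $H$-invariant.
   Context: Rings are associative but not necessarily unital; ideals are two-sided. For subsets $U,V$ of a ring, $UV$ denotes the set of finite sums of elements $uv$ with $u\in U$, $v\in V$. A ring $S$ is $s$-unital if $s\in sS\cap Ss$ for every $s\in S$. A ring $S$ is prime if $\{0\}$ is a proper ideal and for all ideals $A,B$ of $S$, $AB=\{0\}$ implies $A=\{0\}$ or $B=\{0\}$. $S$ is $G$-graded if $S=\bigoplus_{x\in G}S_x$ as additive groups for given additive subgroups $S_x$, with $S_xS_y\subseteq S_{xy}$ for all $x,y\in G$; it is strongly $G$-graded if moreover $S_xS_y=S_{xy}$ for all $x,y\in G$. For a subgroup $N$ of $G$ put $S_N:=\bigoplus_{x\in N}S_x$. For $I\subseteq S$ and $x\in G$ put $I^x:=S_{x^{-1}}IS_x$. For a subgroup $H$ of $G$, a subset $I\subseteq S$ is $H$-invariant if $I^x\subseteq I$ for every $x\in H$. An NP-datum for $S$ is a quintuple $(H,N,I,\tilde A,\tilde B)$ such that: (NP1) $H$ is a subgroup of $G$ and $N$ is a finite normal subgroup of $H$; (NP2) $I$ is a nonzero $H$-invariant ideal of $S_e$ such that $I^xI=\{0\}$ for every $x\in G\setminus H$; (NP3) $\tilde A,\tilde B$ are nonzero ideals of $S_N$ such that $\tilde A,\tilde B\subseteq IS_N$ and $\tilde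 A\tilde B=\{0\}$. *)

theory Defs
  imports "HOL-Algebra.Coset"
begin

text \<open>
  The type class \<open>ring\<close> is used for associative rings that need not be unital. The graded ring is
  the whole type; its subrings (such as the components \<open>S e\<close> and \<open>S_N\<close>) are subsets of that type,
  and notions such as ideals are taken relative to such a subset.
\<close>

text \<open>The empty sum is allowed, so \<open>0\<close> always belongs to the product.\<close>
definition set_prod :: "'a::ring set \<Rightarrow> 'a set \<Rightarrow> 'a set"  (infixl \<open>\<star>\<close> 70) where
  "U \<star> V = {(\<Sum>i<n. u i * v i) | (n::nat) u v. \<forall>i<n. u i \<in> U \<and> v i \<in> V}"

definition add_subgroup :: "'a::ring set \<Rightarrow> bool" where
  "add_subgroup A \<longleftrightarrow> 0 \<in> A \<and> (\<forall>a\<in>A. \<forall>b\<in>A. a - b \<in> A)"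

definition ideal_of :: "'a::ring set \<Rightarrow> 'a set \<Rightarrow> bool" where
  "ideal_of A R \<longleftrightarrow> A \<subseteq> R \<and> add_subgroup A \<and> (\<forall>r\<in>R. \<forall>a\<in>A. r * a \<in> A \<and> a * r \<in> A)"

definition s_unital :: "'a::ring set \<Rightarrow> bool" where
  "s_unital R \<longleftrightarrow> (\<forall>s\<in>R. s \<in> ({s} \<star> R) \<inter> (R \<star> {s}))"

definition prime_ring :: "'a::ring set \<Rightarrow> bool" where
  "prime_ring R \<longleftrightarrow> ideal_of {0} R \<and> {0} \<noteq> R \<and>
     (\<forall>A B. ideal_of A R \<and> ideal_of B R \<and> A \<star> B = {0} \<longrightarrow> A = {0} \<or> B = {0})"

text \<open>
  The direct sum condition says that every ring element is the sum of exactly one finitely supported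
  family of components; families are extended by \<open>0\<close> outside \<open>carrier G\<close>. The values of \<open>S\<close>
  outside \<open>carrier G\<close> are irrelevant.
\<close>
definition graded :: "('g, 'm) monoid_scheme \<Rightarrow> ('g \<Rightarrow> 'a::ring set) \<Rightarrow> bool" where
  "graded G S \<longleftrightarrow>
     (\<forall>x\<in>carrier G. add_subgroup (S x)) \<and>
     (\<forall>s. \<exists>!f. (\<forall>x\<in>carrier G. f x \<in> S x) \<and> (\<forall>x. x \<notin> carrier G \<longrightarrow> f x = 0) \<and>
               finite {x. f x \<noteq> 0} \<and> s = (\<Sum>x | f x \<noteq> 0. f x)) \<and>
     (\<forall>x\<in>carrier G. \<forall>y\<in>carrier G. S x \<star> S y \<subseteq> S (x \<otimes>\<^bsub>G\<^esub> y))"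

definition strongly_graded :: "('g, 'm) monoid_scheme \<Rightarrow> ('g \<Rightarrow> 'a::ring set) \<Rightarrow> bool" where
  "strongly_graded G S \<longleftrightarrow> graded G S \<and>
     (\<forall>x\<in>carrier G. \<forall>y\<in>carrier G. S x \<star> S y = S (x \<otimes>\<^bsub>G\<^esub> y))"

definition grade_sum :: "('g \<Rightarrow> 'a::ring set) \<Rightarrow> 'g set \<Rightarrow> 'a set" where
  "grade_sum S N = {(\<Sum>x\<in>F. f x) | F f. finite F \<and> F \<subseteq> N \<and> (\<forall>x\<in>F. f x \<in> S x)}"

definition conj_set ::
  "('g, 'm) monoid_scheme \<Rightarrow> ('g \<Rightarrow> 'a::ring set) \<Rightarrow> 'a set \<Rightarrow> 'g \<Rightarrow> 'a set" where
  "conj_set G S I x = S (inv\<^bsub>G\<^esub> x) \<star> I \<star> S x"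

definition invariant ::
  "('g, 'm) monoid_scheme \<Rightarrow> ('g \<Rightarrow> 'a::ring set) \<Rightarrow> 'g set \<Rightarrow> 'a set \<Rightarrow> bool" where
  "invariant G S H I \<longleftrightarrow> (\<forall>x\<in>H. conj_set G S I x \<subseteq> I)"

definition NP_datum ::
  "('g, 'm) monoid_scheme \<Rightarrow> ('g \<Rightarrow> 'a::ring set) \<Rightarrow>
    'g set \<Rightarrow> 'g set \<Rightarrow> 'a set \<Rightarrow> 'a set \<Rightarrow> 'a set \<Rightarrow> bool" where
  "NP_datum G S H N I A B \<longleftrightarrow>
     subgroup H G \<and> N \<lhd> G\<lparr>carrier := H\<rparr> \<and> finite N \<and>
     ideal_of I (S \<one>\<^bsub>G\<^esub>) \<and> I \<noteq> {0} \<and> invariant G S H I \<and>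
     (\<forall>x \<in> carrier G - H. conj_set G S I x \<star> I = {0}) \<and>
     ideal_of A (grade_sum S N) \<and> A \<noteq> {0} \<and> ideal_of B (grade_sum S N) \<and> B \<noteq> {0} \<and>
     A \<subseteq> I \<star> grade_sum S N \<and> B \<subseteq> I \<star> grade_sum S N \<and> A \<star> B = {0}"

end

theory Submission
  imports Defs
begin

text \<open>
  If \<open>S\<close> has an invariant datum \<open>(H, N, I, A, B)\<close>, then the nonzero ideals \<open>S A S\<close> and \<open>S B S\<close> have
  product zero. For the converse let \<open>A\<close>, \<open>B\<close> be nonzero ideals with \<open>A B = 0\<close> and assume there is no
  invariant datum. Call \<open>(H, I)\<close> good if it satisfies (NP2), and let \<open>D\<close> be the set of elements with
  finitely many \<open>H\<close>-conjugates. Among all good pairs and all \<open>b\<close> in \<open>B\<close> with \<open>I b \<noteq> 0\<close> choose one for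
  which the support of \<open>b\<close> meets as few right cosets of \<open>D\<close> as possible. Then the \<open>D\<close>-part of \<open>b\<close> is
  annihilated from the left by \<open>a S\<^sub>h\<close> for every \<open>h\<close> in \<open>H\<close> and every \<open>D\<close>-part \<open>a\<close> of an element of \<open>A\<close>
  lying in \<open>I S\<close>: otherwise the elements \<open>w\<close> of \<open>H\<close> with \<open>a S\<^sub>w b \<noteq> 0\<close> lie in finitely many cosets of
  centralizers of support elements of \<open>b\<close> outside \<open>D\<close>, which yields a good pair \<open>(K, J)\<close> with \<open>K\<close> a
  subgroup of \<open>H\<close> for which two of these cosets merge.

  It remains to pass from the FC centre of \<open>H\<close> to a finite normal subgroup. Modulo its torsion elements
  the FC centre is orderable, and McCoy's argument for zero divisors in polynomial rings gives nonzero
  elements \<open>e\<close>, \<open>c\<close> of \<open>I S\<close> with torsion support and \<open>e S\<^sub>h c = 0\<close> for all \<open>h\<close> in \<open>H\<close>. By Dietzmann's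
  lemma both supports lie in a finite normal subgroup \<open>N\<close> of \<open>H\<close>, and the \<open>H\<close>-invariant ideals of \<open>S\<^sub>N\<close>
  generated by \<open>e\<close> and \<open>c\<close> form a datum.
\<close>

section \<open>FC groups\<close>

text \<open>The obstacle is that the degrees \<open>x\<close> in \<open>H\<close> with
  \<open>m * s * m \<noteq> 0\<close> for some \<open>s\<close> in \<open>S x\<close> need not form
  a subgroup, so the usual facts on coverings of a group by cosets say nothing about a finite cover
  of this set \<open>R\<close>. The substitute: for \<open>x\<close> in \<open>R\<close> some
  nonzero multiple \<open>q * m\<close> has its own set inside the intersection of \<open>R\<close>
  with its translate by \<open>inv x\<close>. An extremal cover is therefore stable under left
  translation by \<open>R\<close>, and its stabilizer in \<open>H\<close> is the new subgroup
  \<open>K\<close>. Two cosets merge because a support element outside \<open>D\<close> acquires a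
  conjugate with finite class under \<open>K\<close>.

  Invertible homogeneous elements are replaced by one fact: a nonzero element stays nonzero under
  multiplication by a suitable homogeneous element of any prescribed degree, on either side. This
  moves supports and conjugates degrees at will.

  \<open>D\<close> is a subgroup of the whole group and not of \<open>H\<close>, since supports of
  elements of the given ideals spread beyond \<open>H\<close>. They are cut down to \<open>H\<close>
  only at the end, by elements of \<open>I\<close> on both sides: \<open>i * v * j = 0\<close> for
  \<open>v\<close> of degree outside \<open>H\<close>.\<close>

context group
begin

lemma inv_mult_cancel_left [simp]:
  "x \<in> carrier G \<Longrightarrow> y \<in> carrier G \<Longrightarrow> inv x \<otimes> (x \<otimes> y) = y"
  "x \<in> carrier G \<Longrightarrow> y \<in> carrier G \<Longrightarrow> x \<otimes> (inv x \<otimes> y) = y"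
  by (simp_all add: m_assoc[symmetric])

lemmas group_simps = m_assoc inv_mult_group

section \<open>Conjugation in a group\<close>

definition conjg :: "'a \<Rightarrow> 'a \<Rightarrow> 'a" where
  "conjg h x = h \<otimes> x \<otimes> inv h"

definition conj_class :: "'a set \<Rightarrow> 'a \<Rightarrow> 'a set" where
  "conj_class H x = (\<lambda>h. conjg h x) ` H"

lemma conjg_closed [simp, intro]: "h \<in> carrier G \<Longrightarrow> x \<in> carrier G \<Longrightarrow> conjg h x \<in> carrier G"
  by (simp add: conjg_def)

lemma conjg_conjg: "h \<in> carrier G \<Longrightarrow> k \<in> carrier G \<Longrightarrow> x \<in> carrier G \<Longrightarrow>
    conjg h (conjg k x) = conjg (h \<otimes> k) x"
  by (simp add: conjg_def group_simps)

lemma conjg_one [simp]: "x \<in> carrier G \<Longrightarrow> conjg \<one> x = x"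
  by (simp add: conjg_def)

lemma conjg_of_one [simp]: "h \<in> carrier G \<Longrightarrow> conjg h \<one> = \<one>"
  by (simp add: conjg_def)

lemma conjg_mult: "h \<in> carrier G \<Longrightarrow> x \<in> carrier G \<Longrightarrow> y \<in> carrier G \<Longrightarrow>
    conjg h (x \<otimes> y) = conjg h x \<otimes> conjg h y"
  by (simp add: conjg_def group_simps)

lemma conjg_inv: "h \<in> carrier G \<Longrightarrow> x \<in> carrier G \<Longrightarrow> conjg h (inv x) = inv (conjg h x)"
  by (simp add: conjg_def group_simps)

lemma conjg_pow: "h \<in> carrier G \<Longrightarrow> x \<in> carrier G \<Longrightarrow> conjg h (x [^] (n::nat)) = conjg h x [^] n"
  by (induction n) (simp_all add: conjg_mult)

lemma conjg_inject: "h \<in> carrier G \<Longrightarrow> x \<in> carrier G \<Longrightarrow> y \<in> carrier G \<Longrightarrow>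
    conjg h x = conjg h y \<longleftrightarrow> x = y"
  by (metis conjg_conjg conjg_one inv_closed l_inv)

lemma conjg_inv_cancel [simp]:
  "h \<in> carrier G \<Longrightarrow> x \<in> carrier G \<Longrightarrow> conjg h (conjg (inv h) x) = x"
  "h \<in> carrier G \<Longrightarrow> x \<in> carrier G \<Longrightarrow> conjg (inv h) (conjg h x) = x"
  by (simp_all add: conjg_conjg)

lemma conjg_eq_iff_commute: "h \<in> carrier G \<Longrightarrow> x \<in> carrier G \<Longrightarrow> conjg h x = x \<longleftrightarrow> h \<otimes> x = x \<otimes> h"
  unfolding conjg_def by (metis inv_closed inv_solve_right' m_closed)

section \<open>Collecting letters in words\<close>

definition wprod :: "'a list \<Rightarrow> 'a" where
  "wprod ws = foldr (\<otimes>) ws \<one>"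

lemma wprod_simps [simp]: "wprod [] = \<one>" "wprod (w # ws) = w \<otimes> wprod ws"
  by (simp_all add: wprod_def)

lemma wprod_closed [simp]: "set ws \<subseteq> carrier G \<Longrightarrow> wprod ws \<in> carrier G"
  by (induction ws) auto

lemma wprod_append: "set us \<subseteq> carrier G \<Longrightarrow> set ws \<subseteq> carrier G \<Longrightarrow>
    wprod (us @ ws) = wprod us \<otimes> wprod ws"
  by (induction us) (auto simp: m_assoc)

lemma wprod_conjg: "h \<in> carrier G \<Longrightarrow> set ws \<subseteq> carrier G \<Longrightarrow>
    wprod (map (conjg h) ws) = conjg h (wprod ws)"
  by (induction ws) (auto simp: conjg_mult)

lemma wprod_inv: "set ws \<subseteq> carrier G \<Longrightarrow> wprod (rev (map (m_inv G) ws)) = inv (wprod ws)"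
proof (induction ws)
  case (Cons w ws)
  moreover have "set (map (m_inv G) ws) \<subseteq> carrier G" using Cons.prems by auto
  ultimately show ?case by (simp add: wprod_append inv_mult_group)
qed simp

lemma wprod_replicate:
  assumes "set ws \<subseteq> carrier G"
  shows "wprod (concat (replicate n ws)) = wprod ws [^] n"
proof (induction n)
  case (Suc n)
  have "set (concat (replicate n ws)) \<subseteq> carrier G" using assms by auto
  then show ?case
    using assms Suc by (simp add: wprod_append nat_pow_Suc2[symmetric] del: nat_pow_Suc)
qed simp

text \<open>Moving \<open>t\<close> to the front conjugates the letters before it by
  \<open>inv t\<close>. This map is injective and fixes \<open>t\<close>, so no further occurrence
  of \<open>t\<close> is gained or lost and the step can be repeated.\<close>

lemma pull_letter:
  assumes "T \<subseteq> carrier G" "\<And>t u. t \<in> T \<Longrightarrow> u \<in> T \<Longrightarrow> conjg (inv t) u \<in> T"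
    and "set ws \<subseteq> T" "t \<in> set ws"
  shows "\<exists>ws'. set ws' \<subseteq> T \<and> length ws = Suc (length ws') \<and>
      count_list ws t = Suc (count_list ws' t) \<and> wprod ws = t \<otimes> wprod ws'"
proof -
  obtain us vs where ws: "ws = us @ t # vs" using assms(4) by (meson split_list)
  have t: "t \<in> carrier G" and c: "set us \<subseteq> carrier G" "set vs \<subseteq> carrier G" and tT: "t \<in> T"
    using assms ws by auto
  have fix_t: "conjg (inv t) t = t" using t by (simp add: conjg_def)
  have count: "count_list (map (conjg (inv t)) us) t = count_list us t"
    using c(1)
  proof (induction us)
    case (Cons u us)
    then show ?case using conjg_inject[of "inv t" u t] t fix_t by auto
  qed simp
  have sub: "set (map (conjg (inv t)) us) \<subseteq> carrier G" using c t by auto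
  have "wprod ws = wprod us \<otimes> (t \<otimes> wprod vs)" using ws c t by (simp add: wprod_append)
  also have "\<dots> = t \<otimes> (conjg (inv t) (wprod us) \<otimes> wprod vs)"
    using c t by (simp add: conjg_def m_assoc)
  also have "\<dots> = t \<otimes> wprod (map (conjg (inv t)) us @ vs)"
    using c t sub by (simp add: wprod_append wprod_conjg)
  finally show ?thesis
    using assms ws tT count
    by (intro exI[of _ "map (conjg (inv t)) us @ vs"]) auto
qed

lemma pull_letters:
  assumes "T \<subseteq> carrier G" "\<And>t u. t \<in> T \<Longrightarrow> u \<in> T \<Longrightarrow> conjg (inv t) u \<in> T"
    and "set ws \<subseteq> T" "t \<in> T" "k \<le> count_list ws t"
  shows "\<exists>ws'. set ws' \<subseteq> T \<and> length ws = k + length ws' \<and> wprod ws = t [^] k \<otimes> wprod ws'"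
  using assms(3,5)
proof (induction k arbitrary: ws)
  case 0
  then have "set ws \<subseteq> carrier G" using assms(1) by blast
  then show ?case using 0 by (intro exI[of _ ws]) auto
next
  case (Suc k)
  then have "t \<in> set ws" using count_notin by fastforce
  from pull_letter[OF assms(1,2) Suc.prems(1) this] obtain us where
    us: "set us \<subseteq> T" "length ws = Suc (length us)" "count_list ws t = Suc (count_list us t)"
      "wprod ws = t \<otimes> wprod us" by blast
  with Suc.IH[of us] Suc.prems obtain vs where
    vs: "set vs \<subseteq> T" "length us = k + length vs" "wprod us = t [^] k \<otimes> wprod vs" by auto
  have "t \<in> carrier G" "wprod vs \<in> carrier G" using assms vs(1) by auto
  then have "wprod ws = t [^] Suc k \<otimes> wprod vs"
    by (simp only: us vs nat_pow_Suc2 nat_pow_closed m_assoc)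
  then show ?case using us vs by (intro exI[of _ vs]) auto
qed

text \<open>In a word longer than \<open>card T * M\<close> some letter occurs \<open>M\<close>
  times by the pigeonhole principle, and these occurrences are collected into one factor
  \<open>z\<close>. The case \<open>z = \<one>\<close> serves Dietzmann's lemma. For the ordering,
  \<open>z\<close> is a power of a fixed element, and the length equation counts how many factors
  \<open>z\<close> were extracted.\<close>

lemma shorten_word:
  assumes "T \<subseteq> carrier G" "\<And>t u. t \<in> T \<Longrightarrow> u \<in> T \<Longrightarrow> conjg (inv t) u \<in> T"
    and "finite T" "0 < M" "\<And>t. t \<in> T \<Longrightarrow> t [^] M = z" "z \<in> carrier G" "set ws \<subseteq> T"
  shows "\<exists>a vs. set vs \<subseteq> T \<and> length vs \<le> card T * M \<and> length ws = M * a + length vs \<and>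
      wprod ws = z [^] (a::nat) \<otimes> wprod vs"
  using assms(7)
proof (induction "length ws" arbitrary: ws rule: less_induct)
  case less
  have car: "set vs \<subseteq> T \<Longrightarrow> wprod vs \<in> carrier G" for vs using assms(1) by auto
  show ?case
  proof (cases "length ws \<le> card T * M")
    case True
    then show ?thesis using less.prems car
      by (intro exI[of _ 0] exI[of _ ws]) auto
  next
    case False
    have "\<exists>t\<in>T. M \<le> count_list ws t"
    proof (rule ccontr)
      assume "\<not> ?thesis"
      then have "sum (count_list ws) T \<le> card T * M"
        using sum_bounded_above[of T "count_list ws" M] by fastforce
      then show False using False sum_count_set[OF less.prems assms(3)] by simp
    qed
    then obtain t where t: "t \<in> T" "M \<le> count_list ws t" by blast
    from pull_letters[OF assms(1,2) less.prems t] obtain us where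
      us: "set us \<subseteq> T" "length ws = M + length us" "wprod ws = z \<otimes> wprod us"
      using assms(5)[OF t(1)] by auto
    from less.hyps[of us] us assms(4) obtain a vs where
      vs: "set vs \<subseteq> T" "length vs \<le> card T * M" "length us = M * a + length vs"
        "wprod us = z [^] (a::nat) \<otimes> wprod vs" by auto
    have "wprod ws = z [^] Suc a \<otimes> wprod vs"
      using us vs car[OF vs(1)] assms(6) by (simp only: us vs nat_pow_Suc2 nat_pow_closed m_assoc)
    then show ?thesis using us vs by (intro exI[of _ "Suc a"] exI[of _ vs]) auto
  qed
qed

lemma pow_eq_pow_imp:
  assumes "x \<in> carrier G" "x [^] (i::nat) = x [^] j" "i < j"
  shows "x [^] (j - i) = \<one>"
proof -
  have "x [^] (j - i) \<otimes> x [^] i = x [^] j" using assms(1,3) by (simp add: nat_pow_mult)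
  then have "x [^] (j - i) \<otimes> x [^] i = \<one> \<otimes> x [^] i" using assms by simp
  then show ?thesis using assms(1) by (metis nat_pow_closed one_closed right_cancel)
qed

lemma finite_powers_imp_torsion:
  assumes "x \<in> carrier G" "finite (range (\<lambda>n::nat. x [^] n))"
  shows "\<exists>n>0. x [^] (n::nat) = \<one>"
proof -
  have "\<not> inj (\<lambda>n::nat. x [^] n)" using assms(2) finite_imageD infinite_UNIV_nat by blast
  then obtain i j :: nat where "x [^] i = x [^] j" "i \<noteq> j" by (auto simp: inj_def)
  then have "\<exists>i j :: nat. x [^] i = x [^] j \<and> i < j" by (metis linorder_neqE_nat)
  then show ?thesis using pow_eq_pow_imp[OF assms(1)] by (metis zero_less_diff)
qed

section \<open>The FC centre and its torsion subgroup\<close>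

text \<open>Taken in the whole group and not in \<open>H\<close>, because it is intersected with
  supports that need not lie in \<open>H\<close>.\<close>

definition almost_centralizer :: "'a set \<Rightarrow> 'a set" where
  "almost_centralizer H = {g \<in> carrier G. finite (conj_class H g)}"

definition fc_center :: "'a set \<Rightarrow> 'a set" where
  "fc_center H = almost_centralizer H \<inter> H"

definition fc_torsion :: "'a set \<Rightarrow> 'a set" where
  "fc_torsion H = {g \<in> fc_center H. \<exists>n>0. g [^] (n::nat) = \<one>}"

lemma conj_class_mono: "H' \<subseteq> H \<Longrightarrow> conj_class H' x \<subseteq> conj_class H x"
  by (auto simp: conj_class_def)

lemma almost_centralizer_antimono: "H' \<subseteq> H \<Longrightarrow> almost_centralizer H \<subseteq> almost_centralizer H'"
  unfolding almost_centralizer_def using finite_subset[OF conj_class_mono] by auto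

lemma almost_centralizer_subset: "almost_centralizer H \<subseteq> carrier G"
  by (auto simp: almost_centralizer_def)

lemma conj_class_conjg:
  assumes "subgroup H G" "h \<in> H" "x \<in> carrier G"
  shows "conj_class H (conjg h x) \<subseteq> conj_class H x"
  using assms subgroup.mem_carrier[OF assms(1)] subgroup.m_closed[OF assms(1)]
  by (auto simp: conj_class_def conjg_conjg)

lemma conj_class_closed:
  assumes H: "subgroup H G" and "x \<in> carrier G" "h \<in> H" "y \<in> conj_class H x"
  shows "conjg h y \<in> conj_class H x"
proof -
  obtain k where k: "k \<in> H" "y = conjg k x" using assms(4) by (auto simp: conj_class_def)
  then have "conjg h y = conjg (h \<otimes> k) x" using assms subgroup.mem_carrier[OF H] by (simp add: conjg_conjg)
  then show ?thesis using k assms(3) subgroup.m_closed[OF H] by (auto simp: conj_class_def)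
qed

lemma almost_centralizer_conjg:
  assumes "subgroup H G" "h \<in> H" "x \<in> almost_centralizer H"
  shows "conjg h x \<in> almost_centralizer H"
  using assms conj_class_conjg[OF assms(1,2), of x] subgroup.mem_carrier[OF assms(1,2)]
  unfolding almost_centralizer_def by (auto intro: finite_subset)

lemma almost_centralizer_subgroup:
  assumes "subgroup H G"
  shows "subgroup (almost_centralizer H) G"
proof (rule subgroupI)
  have H: "\<And>h. h \<in> H \<Longrightarrow> h \<in> carrier G" using subgroup.mem_carrier[OF assms] .
  show "almost_centralizer H \<subseteq> carrier G" by (rule almost_centralizer_subset)
  have "conj_class H \<one> \<subseteq> {\<one>}" using H by (auto simp: conj_class_def)
  then have "finite (conj_class H \<one>)" by (rule finite_subset) simp
  then show "almost_centralizer H \<noteq> {}" by (auto simp: almost_centralizer_def)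
  fix a assume a: "a \<in> almost_centralizer H"
  then have "conj_class H (inv a) \<subseteq> m_inv G ` conj_class H a"
    using H by (auto simp: conj_class_def almost_centralizer_def conjg_inv)
  then show "inv a \<in> almost_centralizer H"
    using a by (auto simp: almost_centralizer_def intro: finite_subset)
  fix b assume b: "b \<in> almost_centralizer H"
  have "conj_class H (a \<otimes> b) \<subseteq> (\<lambda>(x, y). x \<otimes> y) ` (conj_class H a \<times> conj_class H b)"
  proof
    fix z assume "z \<in> conj_class H (a \<otimes> b)"
    then obtain h where h: "h \<in> H" "z = conjg h (a \<otimes> b)" by (auto simp: conj_class_def)
    then have "z = conjg h a \<otimes> conjg h b" using H a b by (simp add: almost_centralizer_def conjg_mult)
    then show "z \<in> (\<lambda>(x, y). x \<otimes> y) ` (conj_class H a \<times> conj_class H b)"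
      using h by (auto simp: conj_class_def)
  qed
  then show "a \<otimes> b \<in> almost_centralizer H"
    using a b by (auto simp: almost_centralizer_def intro: finite_subset)
qed

lemma fc_center_subgroup: "subgroup H G \<Longrightarrow> subgroup (fc_center H) G"
  unfolding fc_center_def by (intro subgroups_Inter_pair almost_centralizer_subgroup)

lemma subgroup_conjg: "subgroup H G \<Longrightarrow> h \<in> H \<Longrightarrow> x \<in> H \<Longrightarrow> conjg h x \<in> H"
  unfolding conjg_def by (simp add: subgroup.m_closed subgroup.m_inv_closed)

lemma fc_center_conjg: "subgroup H G \<Longrightarrow> h \<in> H \<Longrightarrow> x \<in> fc_center H \<Longrightarrow> conjg h x \<in> fc_center H"
  using almost_centralizer_conjg subgroup_conjg unfolding fc_center_def by blast

text \<open>The conjugates of the elements of \<open>F\<close> and of their inverses form a finite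
  set \<open>T\<close> with a common exponent \<open>M\<close>. Every product of elements of
  \<open>T\<close> equals one of length at most \<open>card T * M\<close>, so the subgroup generated
  by \<open>T\<close> is finite.\<close>

lemma dietzmann:
  assumes H: "subgroup H G" and F: "finite F" "F \<subseteq> fc_torsion H"
  shows "\<exists>N. finite N \<and> N \<lhd> G\<lparr>carrier := H\<rparr> \<and> F \<subseteq> N"
proof -
  have Hc: "H \<subseteq> carrier G" using subgroup.subset[OF H] .
  \<comment> \<open>The inverses make \<open>T\<close> closed under inversion, so that the products
    of words in \<open>T\<close> form a subgroup.\<close>
  define F' where "F' = F \<union> m_inv G ` F"
  define T where "T = (\<Union>f\<in>F'. conj_class H f)"
  have Fc: "F \<subseteq> fc_center H" using F by (auto simp: fc_torsion_def)
  have F'c: "F' \<subseteq> fc_center H"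
    using Fc subgroup.m_inv_closed[OF fc_center_subgroup[OF H]] by (auto simp: F'_def)
  have FG: "F' \<subseteq> carrier G" using F'c Hc by (auto simp: fc_center_def)
  have finT: "finite T" using F(1) F'c
    by (auto simp: T_def F'_def fc_center_def almost_centralizer_def)
  have TH: "T \<subseteq> H"
  proof
    fix t assume "t \<in> T"
    then obtain f h where "f \<in> F'" "h \<in> H" "t = conjg h f" by (auto simp: T_def conj_class_def)
    then show "t \<in> H" using F'c fc_center_conjg[OF H, of h f] by (auto simp: fc_center_def)
  qed
  then have TG: "T \<subseteq> carrier G" using Hc by blast
  have Tconj: "conjg h t \<in> T" if "h \<in> H" "t \<in> T" for h t
    using that FG conj_class_closed[OF H _ that(1)] unfolding T_def by blast
  have Tinv: "inv t \<in> T" if "t \<in> T" for t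
  proof -
    obtain f h where f: "f \<in> F'" "h \<in> H" "t = conjg h f" using \<open>t \<in> T\<close> by (auto simp: T_def conj_class_def)
    have "inv (inv g) = g" if "g \<in> F" for g using that FG by (auto simp: F'_def)
    then have "inv f \<in> F'" using f(1) by (force simp: F'_def)
    moreover have "inv t = conjg h (inv f)" using f FG Hc by (simp add: conjg_inv subsetD)
    ultimately show ?thesis using f by (auto simp: T_def conj_class_def)
  qed
  have tors: "\<exists>n>0. t [^] (n::nat) = \<one>" if "t \<in> T" for t
  proof -
    obtain f h where f: "f \<in> F'" "h \<in> H" "t = conjg h f" using \<open>t \<in> T\<close> by (auto simp: T_def conj_class_def)
    have "\<exists>n>0. g [^] (n::nat) = \<one> \<and> g \<in> carrier G" if "g \<in> F" for g
      using that F(2) Fc Hc unfolding fc_torsion_def fc_center_def by blast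
    then have "\<exists>n>0. f [^] (n::nat) = \<one>"
      using f(1) by (force simp: F'_def nat_pow_inv)
    then obtain n :: nat where "n > 0" "f [^] n = \<one>" by blast
    moreover from this have "t [^] n = \<one>"
      using f Hc FG conjg_pow[of h f n] by (simp add: subsetD)
    ultimately show ?thesis by blast
  qed
  then obtain e :: "'a \<Rightarrow> nat" where e: "\<And>t. t \<in> T \<Longrightarrow> e t > 0 \<and> t [^] e t = \<one>" by metis
  define M where "M = (\<Prod>t\<in>T. e t)"
  have M: "M > 0" using e finT by (auto simp: M_def intro: prod_pos)
  have TM: "t [^] M = \<one>" if "t \<in> T" for t
  proof -
    have "e t dvd M" using that finT unfolding M_def by (intro dvd_prodI)
    then obtain k where "M = e t * k" by blast
    then show ?thesis using e[OF that] TG that nat_pow_pow[of t "e t" k] by auto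
  qed
  define N where "N = wprod ` {ws. set ws \<subseteq> T}"
  have "N \<subseteq> wprod ` {ws. set ws \<subseteq> T \<and> length ws \<le> card T * M}"
  proof
    fix x assume "x \<in> N"
    then obtain ws where ws: "set ws \<subseteq> T" "x = wprod ws" by (auto simp: N_def)
    have "\<exists>a vs. set vs \<subseteq> T \<and> length vs \<le> card T * M \<and> length ws = M * a + length vs \<and>
      wprod ws = \<one> [^] (a::nat) \<otimes> wprod vs"
      using ws TG TH Tconj subgroup.m_inv_closed[OF H] finT M TM by (intro shorten_word) auto
    then obtain vs where "set vs \<subseteq> T" "length vs \<le> card T * M" "wprod ws = \<one> \<otimes> wprod vs"
      by auto
    moreover from this have "set vs \<subseteq> carrier G" using TG by blast
    ultimately show "x \<in> wprod ` {ws. set ws \<subseteq> T \<and> length ws \<le> card T * M}" using ws by auto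
  qed
  then have finN: "finite N" using finite_lists_length_le[OF finT] finite_subset by blast
  have NH: "N \<subseteq> H"
  proof -
    have "wprod ws \<in> H" if "set ws \<subseteq> T" for ws
      using that TH by (induction ws) (auto simp: subgroup.one_closed[OF H] subgroup.m_closed[OF H])
    then show ?thesis by (auto simp: N_def)
  qed
  have subN: "subgroup N G"
  proof (rule subgroupI)
    show "N \<subseteq> carrier G" using NH Hc by blast
    show "N \<noteq> {}" using N_def by (metis (mono_tags) empty_set empty_subsetI image_is_empty mem_Collect_eq empty_iff)
    fix a assume "a \<in> N"
    then obtain ws where ws: "set ws \<subseteq> T" "a = wprod ws" by (auto simp: N_def)
    then have "inv a = wprod (rev (map (m_inv G) ws))" using TG by (subst wprod_inv) auto
    moreover have "set (rev (map (m_inv G) ws)) \<subseteq> T" using ws Tinv by auto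
    ultimately show "inv a \<in> N" unfolding N_def by blast
    fix b assume "b \<in> N"
    then obtain vs where vs: "set vs \<subseteq> T" "b = wprod vs" by (auto simp: N_def)
    have "a \<otimes> b = wprod (ws @ vs)" using ws vs TG by (subst wprod_append) auto
    then show "a \<otimes> b \<in> N" unfolding N_def using ws vs by (intro image_eqI[of _ _ "ws @ vs"]) auto
  qed
  have conjN: "conjg h n \<in> N" if "h \<in> H" "n \<in> N" for h n
  proof -
    obtain ws where ws: "set ws \<subseteq> T" "n = wprod ws" using \<open>n \<in> N\<close> by (auto simp: N_def)
    have "conjg h n = wprod (map (conjg h) ws)" using ws TG Hc that by (subst wprod_conjg) auto
    moreover have "set (map (conjg h) ws) \<subseteq> T" using ws Tconj that by auto
    ultimately show ?thesis unfolding N_def by blast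
  qed
  interpret HG: group "G\<lparr>carrier := H\<rparr>" using subgroup_imp_group[OF H] .
  have "N \<lhd> G\<lparr>carrier := H\<rparr>"
    unfolding HG.normal_inv_iff
    using subgroup_incl[OF subN H NH] conjN m_inv_consistent[OF H] by (auto simp: conjg_def)
  moreover have "F \<subseteq> N"
  proof
    fix f assume "f \<in> F"
    then have "f \<in> F'" "f = conjg \<one> f" using FG by (auto simp: F'_def)
    then have "f \<in> T" using subgroup.one_closed[OF H] unfolding T_def conj_class_def by blast
    then have "f = wprod [f]" "set [f] \<subseteq> T" using TG by auto
    then show "f \<in> N" unfolding N_def by blast
  qed
  ultimately show ?thesis using finN by blast
qed

text \<open>Closure under products is the point: two torsion elements lie in a common finite normal
  subgroup of \<open>H\<close>, which contains all powers of their product.\<close>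

lemma fc_torsion_subgroup:
  assumes H: "subgroup H G"
  shows "subgroup (fc_torsion H) G"
proof (rule subgroupI)
  have K: "subgroup (fc_center H) G" by (rule fc_center_subgroup[OF H])
  have Kc: "\<And>g. g \<in> fc_center H \<Longrightarrow> g \<in> carrier G" using subgroup.mem_carrier[OF K] .
  show "fc_torsion H \<subseteq> carrier G" using Kc by (auto simp: fc_torsion_def)
  have "\<one> \<in> fc_torsion H" using subgroup.one_closed[OF K] by (auto simp: fc_torsion_def)
  then show "fc_torsion H \<noteq> {}" by blast
  fix a assume a: "a \<in> fc_torsion H"
  then obtain n :: nat where n: "a \<in> fc_center H" "n > 0" "a [^] n = \<one>" by (auto simp: fc_torsion_def)
  then have "inv a [^] n = \<one>" using Kc by (simp add: nat_pow_inv)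
  then show "inv a \<in> fc_torsion H"
    using n subgroup.m_inv_closed[OF K] by (auto simp: fc_torsion_def)
  fix b assume b: "b \<in> fc_torsion H"
  from a b have "finite {a, b}" "{a, b} \<subseteq> fc_torsion H" by auto
  from dietzmann[OF H this] obtain N where N: "finite N" "N \<lhd> G\<lparr>carrier := H\<rparr>" "a \<in> N" "b \<in> N" by auto
  interpret HG: group "G\<lparr>carrier := H\<rparr>" using subgroup_imp_group[OF H] .
  have sN: "subgroup N (G\<lparr>carrier := H\<rparr>)" using N(2) by (rule normal_imp_subgroup)
  have pows: "(a \<otimes> b) [^] (i::nat) \<in> N" for i
    using subgroup.m_closed[OF sN] subgroup.one_closed[OF sN] N by (induction i) auto
  have ab: "a \<otimes> b \<in> fc_center H" using a b subgroup.m_closed[OF K] by (auto simp: fc_torsion_def)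
  have "\<exists>n>0. (a \<otimes> b) [^] (n::nat) = \<one>"
    by (rule finite_powers_imp_torsion) (use Kc ab N pows in \<open>auto intro: finite_subset[of _ N]\<close>)
  then show "a \<otimes> b \<in> fc_torsion H" using ab by (auto simp: fc_torsion_def)
qed

lemma fc_torsion_conjg:
  assumes H: "subgroup H G" "h \<in> H" "x \<in> fc_torsion H"
  shows "conjg h x \<in> fc_torsion H"
proof -
  have "h \<in> carrier G" "x \<in> carrier G"
    using assms subgroup.mem_carrier[OF H(1)] by (auto simp: fc_torsion_def fc_center_def)
  moreover obtain n :: nat where "n > 0" "x [^] n = \<one>" using H(3) by (auto simp: fc_torsion_def)
  ultimately have "conjg h x [^] n = \<one>" by (simp add: conjg_pow[symmetric])
  with \<open>n > 0\<close> show ?thesis using assms fc_center_conjg[OF H(1,2)] by (auto simp: fc_torsion_def)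
qed

section \<open>Orderability of the FC centre modulo torsion\<close>

text \<open>The powers of \<open>x\<close> move \<open>k\<close> inside a finite class, so two of
  them conjugate \<open>k\<close> to the same element and their quotient commutes with
  \<open>k\<close>.\<close>

lemma power_commutes_with:
  assumes H: "subgroup H G" and x: "x \<in> H" and k: "k \<in> almost_centralizer H"
  shows "\<exists>m>0. conjg k (x [^] (m::nat)) = x [^] m"
proof -
  have c: "x \<in> carrier G" "k \<in> carrier G" using assms subgroup.mem_carrier[OF H] by (auto simp: almost_centralizer_def)
  have xi: "x [^] (i::nat) \<in> H" for i
    using x subgroup.one_closed[OF H] subgroup.m_closed[OF H] by (induction i) auto
  have "range (\<lambda>i::nat. conjg (x [^] i) k) \<subseteq> conj_class H k" using xi by (auto simp: conj_class_def)
  then have "finite (range (\<lambda>i::nat. conjg (x [^] i) k))"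
    using k by (auto simp: almost_centralizer_def intro: finite_subset)
  then have "\<not> inj (\<lambda>i::nat. conjg (x [^] i) k)" using finite_imageD infinite_UNIV_nat by blast
  then obtain i j :: nat where "conjg (x [^] i) k = conjg (x [^] j) k" "i \<noteq> j" by (auto simp: inj_def)
  then obtain i j :: nat where ij: "conjg (x [^] i) k = conjg (x [^] j) k" "i < j" by (metis linorder_neqE_nat)
  have "conjg (x [^] i) (conjg (x [^] (j - i)) k) = conjg (x [^] i) k"
    using ij c by (simp add: conjg_conjg nat_pow_mult)
  then have "conjg (x [^] (j - i)) k = k" using c by (simp add: conjg_inject)
  then have "conjg k (x [^] (j - i)) = x [^] (j - i)"
    using c by (simp add: conjg_eq_iff_commute)
  then show ?thesis using ij(2) by (intro exI[of _ "j - i"]) auto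
qed

text \<open>All conjugates of \<open>x\<close> share a power \<open>x [^] M\<close>, so the powers
  of \<open>wprod ws\<close> are powers of \<open>x [^] M\<close> times words of bounded length. Two
  of these short words coincide, and the quotient of the two powers is a power of \<open>x\<close>.
  That its exponent is positive is what later rules out a contradiction between cones.\<close>

lemma class_word_power:
  assumes H: "subgroup H G" and x: "x \<in> fc_center H"
    and ws: "ws \<noteq> []" "set ws \<subseteq> conj_class (fc_center H) x"
  shows "\<exists>j>0. \<exists>n>0. wprod ws [^] (j::nat) = x [^] (n::nat)"
proof -
  define K where "K = fc_center H"
  define T where "T = conj_class K x"
  have K: "subgroup K G" unfolding K_def by (rule fc_center_subgroup[OF H])
  have KG: "K \<subseteq> carrier G" and xK: "x \<in> K" using subgroup.subset[OF K] x by (auto simp: K_def)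
  have TK: "T \<subseteq> K" using subgroup_conjg[OF K] xK by (auto simp: T_def conj_class_def)
  have TG: "T \<subseteq> carrier G" using TK KG by blast
  have "T \<subseteq> conj_class H x" unfolding T_def K_def by (intro conj_class_mono) (auto simp: fc_center_def)
  then have finT: "finite T"
    using x by (auto simp: fc_center_def almost_centralizer_def intro: finite_subset)
  have Tconj: "conjg (inv t) u \<in> T" if "t \<in> T" "u \<in> T" for t u
    using that KG xK TK conj_class_closed[OF K] subgroup.m_inv_closed[OF K] unfolding T_def by blast
  have "\<forall>t\<in>T. \<exists>k m. k \<in> K \<and> t = conjg k x \<and> m > 0 \<and> conjg k (x [^] (m::nat)) = x [^] m"
  proof
    fix t assume "t \<in> T"
    then obtain k where k: "k \<in> K" "t = conjg k x" by (auto simp: T_def conj_class_def)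
    then show "\<exists>k m. k \<in> K \<and> t = conjg k x \<and> m > 0 \<and> conjg k (x [^] (m::nat)) = x [^] m"
      using power_commutes_with[OF H, of x k] x by (auto simp: K_def fc_center_def)
  qed
  then obtain k m where km: "\<And>t. t \<in> T \<Longrightarrow> k t \<in> K \<and> t = conjg (k t) x \<and> (m t :: nat) > 0 \<and>
      conjg (k t) (x [^] m t) = x [^] m t" by metis
  \<comment> \<open>A common multiple of the exponents \<open>m t\<close>: each conjugating element
    \<open>k t\<close> then fixes \<open>x [^] M\<close>.\<close>
  define M where "M = (\<Prod>t\<in>T. m t)"
  have M: "M > 0" using km by (auto simp: M_def intro!: prod_pos)
  have TM: "t [^] M = x [^] M" if "t \<in> T" for t
  proof -
    have "m t dvd M" unfolding M_def using that finT by (intro dvd_prodI)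
    then obtain c where c: "M = m t * c" by blast
    have kx: "k t \<in> carrier G" "x \<in> carrier G" using km[OF that] KG xK by auto
    have "t [^] M = conjg (k t) (x [^] m t) [^] c"
      using km[OF that] kx c by (metis conjg_closed conjg_pow nat_pow_pow)
    then show ?thesis using km[OF that] kx c by (simp add: nat_pow_pow)
  qed
  have xG: "x \<in> carrier G" using KG xK by auto
  have wsT: "set ws \<subseteq> T" and wsG: "set ws \<subseteq> carrier G" using ws(2) TG by (auto simp: T_def K_def)
  have "\<forall>j. \<exists>a vs. set vs \<subseteq> T \<and> length vs \<le> card T * M \<and>
      length (concat (replicate j ws)) = M * a + length vs \<and>
      wprod (concat (replicate j ws)) = (x [^] M) [^] (a::nat) \<otimes> wprod vs"
    by (intro allI shorten_word TG Tconj finT M TM) (use wsT xG in auto)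
  then obtain a vs where avs: "\<And>j. set (vs j) \<subseteq> T" "\<And>j. length (vs j) \<le> card T * M"
      "\<And>j. length (concat (replicate j ws)) = M * a j + length (vs j)"
      "\<And>j. wprod (concat (replicate j ws)) = (x [^] M) [^] (a j::nat) \<otimes> wprod (vs j)" by metis
  have "finite (range vs)"
    by (rule finite_subset[OF _ finite_lists_length_le[OF finT, of "card T * M"]]) (use avs in auto)
  then have "\<not> inj vs" using finite_imageD infinite_UNIV_nat by blast
  then obtain i j where "vs i = vs j" "i \<noteq> j" by (auto simp: inj_def)
  then obtain i j where ij: "vs i = vs j" "i < j" by (metis linorder_neqE_nat)
  have len: "length (concat (replicate n ws)) = n * length ws" for n by (induction n) auto
  \<comment> \<open>With equal remainders the length equations compare \<open>a i\<close> with
    \<open>a j\<close>; here the word must be nonempty.\<close>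
  have "i * length ws < j * length ws" using ij(2) ws(1) by simp
  then have "M * a i < M * a j" using avs(3)[of i] avs(3)[of j] unfolding len ij(1) by linarith
  then have aij: "a i < a j" by simp
  have vG: "wprod (vs j) \<in> carrier G" using avs(1)[of j] TG by auto
  have wG: "wprod ws \<in> carrier G" using wsG by simp
  have e: "wprod ws [^] n = (x [^] M) [^] a n \<otimes> wprod (vs n)" for n
    using avs(4)[of n] wprod_replicate[OF wsG] by simp
  have "wprod ws [^] (j - i) \<otimes> ((x [^] M) [^] a i \<otimes> wprod (vs j)) = wprod ws [^] j"
    using e[of i] ij wG by (metis less_or_eq_imp_le nat_pow_mult le_add_diff_inverse2)
  also have "\<dots> = (x [^] M) [^] (a j - a i) \<otimes> ((x [^] M) [^] a i \<otimes> wprod (vs j))"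
    using e[of j] aij xG vG by (simp add: m_assoc[symmetric] nat_pow_mult)
  finally have "wprod ws [^] (j - i) = (x [^] M) [^] (a j - a i)"
    using xG vG wG by simp
  also have "\<dots> = x [^] (M * (a j - a i))" using xG by (simp add: nat_pow_pow)
  finally show ?thesis using ij(2) aij M by (intro exI[of _ "j - i"] conjI exI[of _ "M * (a j - a i)"]) auto
qed

text \<open>The preimage of the nonnegative cone of a partial two-sided order on the FC centre
  modulo torsion; the last clause is antisymmetry. Totality is left out so that Zorn's lemma can be
  applied.\<close>

definition positive_cone :: "'a set \<Rightarrow> 'a set \<Rightarrow> bool" where
  "positive_cone H P \<longleftrightarrow> fc_torsion H \<subseteq> P \<and> P \<subseteq> fc_center H \<and> (\<forall>p\<in>P. \<forall>q\<in>P. p \<otimes> q \<in> P) \<and>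
     (\<forall>k\<in>fc_center H. \<forall>p\<in>P. conjg k p \<in> P) \<and> (\<forall>p\<in>P. inv p \<in> P \<longrightarrow> p \<in> fc_torsion H)"

lemma positive_cone_pow:
  assumes "positive_cone H P" "p \<in> P" "n > 0"
  shows "p [^] (n::nat) \<in> P"
  using assms(3)
proof (induction n rule: nat_induct_non_zero)
  case 1
  then show ?case using assms by (auto simp: positive_cone_def fc_center_def almost_centralizer_def)
next
  case (Suc n)
  then show ?case using assms by (auto simp: positive_cone_def)
qed

text \<open>Adjoining \<open>x\<close> and its conjugates to a maximal \<open>P\<close> must violate
  antisymmetry. The violation exhibits the inverse of a nonempty product of conjugates of
  \<open>x\<close> as an element of \<open>P\<close>, and a power of that product is a positive
  power of \<open>x\<close>.\<close>

lemma maximal_cone_inv_power: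
  assumes H: "subgroup H G" and P: "positive_cone H P"
    and max: "\<And>Q. positive_cone H Q \<Longrightarrow> P \<subseteq> Q \<Longrightarrow> Q = P"
    and x: "x \<in> fc_center H" "x \<notin> P"
  shows "\<exists>n>0. inv (x [^] (n::nat)) \<in> P"
proof -
  define K where "K = fc_center H"
  define T where "T = conj_class K x"
  have K: "subgroup K G" unfolding K_def by (rule fc_center_subgroup[OF H])
  have KG: "K \<subseteq> carrier G" and xK: "x \<in> K" using subgroup.subset[OF K] x by (auto simp: K_def)
  have xG: "x \<in> carrier G" using KG xK by auto
  have TK: "T \<subseteq> K" using subgroup_conjg[OF K] xK by (auto simp: T_def conj_class_def)
  have TG: "T \<subseteq> carrier G" using TK KG by blast
  have P1: "fc_torsion H \<subseteq> P" and PK: "P \<subseteq> K" and Pm: "\<And>p q. p \<in> P \<Longrightarrow> q \<in> P \<Longrightarrow> p \<otimes> q \<in> P"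
    and Pc: "\<And>k p. k \<in> K \<Longrightarrow> p \<in> P \<Longrightarrow> conjg k p \<in> P"
    and Pi: "\<And>p. p \<in> P \<Longrightarrow> inv p \<in> P \<Longrightarrow> p \<in> fc_torsion H"
    using P by (auto simp: positive_cone_def K_def)
  have PG: "P \<subseteq> carrier G" using PK KG by blast
  have oneP: "\<one> \<in> P" using P1 subgroup.one_closed[OF fc_torsion_subgroup[OF H]] by blast
  have wK: "wprod ws \<in> K" if "set ws \<subseteq> T" for ws
    using that TK by (induction ws) (auto simp: subgroup.one_closed[OF K] subgroup.m_closed[OF K])
  have Tconj: "conjg k u \<in> T" if "k \<in> K" "u \<in> T" for k u
    using that xG conj_class_closed[OF K] unfolding T_def by blast
  \<comment> \<open>The normal submonoid generated by \<open>P\<close> and \<open>x\<close>: factors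
    from \<open>P\<close> can be moved to the left past words in \<open>T\<close>, being conjugated
    on the way.\<close>
  define Q where "Q = {p \<otimes> wprod ws | p ws. p \<in> P \<and> set ws \<subseteq> T}"
  have QI: "p \<otimes> wprod ws \<in> Q" if "p \<in> P" "set ws \<subseteq> T" for p ws using that by (auto simp: Q_def)
  have PQ: "P \<subseteq> Q"
  proof
    fix p assume "p \<in> P"
    then show "p \<in> Q" using QI[of p "[]"] PG by auto
  qed
  have mult: "(p \<otimes> wprod us) \<otimes> (q \<otimes> wprod vs) = (p \<otimes> conjg (wprod us) q) \<otimes> wprod (us @ vs)"
    if "p \<in> P" "q \<in> P" "set us \<subseteq> T" "set vs \<subseteq> T" for p q us vs
  proof -
    have "p \<in> carrier G" "q \<in> carrier G" "wprod us \<in> carrier G" "wprod vs \<in> carrier G"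
      using that PG wK KG by auto
    moreover have "wprod (us @ vs) = wprod us \<otimes> wprod vs" using that TG by (intro wprod_append) auto
    ultimately show ?thesis by (simp add: conjg_def group_simps)
  qed
  have "x \<in> T" using xK xG subgroup.one_closed[OF K] by (force simp: T_def conj_class_def)
  then have "x \<in> Q" using QI[of \<one> "[x]"] oneP xG by auto
  then have "\<not> positive_cone H Q" using max[OF _ PQ] x(2) by blast
  moreover have "fc_torsion H \<subseteq> Q" using P1 PQ by blast
  moreover have "Q \<subseteq> fc_center H"
    using PK wK subgroup.m_closed[OF K] by (auto simp: Q_def K_def)
  moreover have "p \<otimes> q \<in> Q" if "p \<in> Q" "q \<in> Q" for p q
  proof -
    obtain p' q' us vs where pq: "p = p' \<otimes> wprod us" "q = q' \<otimes> wprod vs" "p' \<in> P" "q' \<in> P"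
      "set us \<subseteq> T" "set vs \<subseteq> T" using \<open>p \<in> Q\<close> \<open>q \<in> Q\<close> by (auto simp: Q_def)
    then show ?thesis using mult[of p' q' us vs] QI[of "p' \<otimes> conjg (wprod us) q'" "us @ vs"] Pm Pc wK
      by auto
  qed
  moreover have "conjg k p \<in> Q" if "k \<in> fc_center H" "p \<in> Q" for k p
  proof -
    obtain p' us where pq: "p = p' \<otimes> wprod us" "p' \<in> P" "set us \<subseteq> T" using \<open>p \<in> Q\<close> by (auto simp: Q_def)
    have kK: "k \<in> K" and kG: "k \<in> carrier G" using that KG by (auto simp: K_def)
    have s: "set (map (conjg k) us) \<subseteq> T" using pq Tconj kK by auto
    have "conjg k p = conjg k p' \<otimes> wprod (map (conjg k) us)"
      using pq kG PG TG wK KG by (subst wprod_conjg) (auto simp: conjg_mult)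
    then show ?thesis using QI[OF Pc[OF kK pq(2)] s] by simp
  qed
  \<comment> \<open>Every clause of \<open>positive_cone\<close> except antisymmetry has been
    verified for \<open>Q\<close>, so antisymmetry fails. Multiplying the representations of
    \<open>g\<close> and \<open>inv g\<close> then writes \<open>\<one>\<close> as
    \<open>r \<otimes> wprod w\<close> with \<open>r\<close> in \<open>P\<close>.\<close>
  ultimately obtain g where g: "g \<in> Q" "inv g \<in> Q" "g \<notin> fc_torsion H"
    unfolding positive_cone_def by blast
  then obtain p q us vs where pq: "g = p \<otimes> wprod us" "inv g = q \<otimes> wprod vs" "p \<in> P" "q \<in> P"
      "set us \<subseteq> T" "set vs \<subseteq> T" by (auto simp: Q_def)
  have gG: "g \<in> carrier G" using pq(1,3,5) PG wK KG by (meson m_closed subsetD)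
  define w where "w = us @ vs"
  define r where "r = p \<otimes> conjg (wprod us) q"
  have wT: "set w \<subseteq> T" using pq by (auto simp: w_def)
  have r: "r \<in> P" using pq Pm Pc wK by (auto simp: r_def)
  have "r \<otimes> wprod w = \<one>" using mult[OF pq(3,4,5,6)] gG r_inv[OF gG] unfolding pq(2) unfolding pq(1)
    by (simp add: r_def w_def)
  then have rw: "inv (wprod w) = r" using r PG wK[OF wT] KG by (metis inv_equality subsetD)
  have "w \<noteq> []"
  proof
    assume "w = []"
    then have "g = p" "inv g = q" using pq PG by (auto simp: w_def)
    then show False using Pi pq g by auto
  qed
  then obtain j n where jn: "j > 0" "n > 0" "wprod w [^] (j::nat) = x [^] (n::nat)"
    using class_word_power[OF H x(1), of w] wT by (auto simp: T_def K_def)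
  have "inv (x [^] n) = inv (wprod w) [^] j" using jn wK[OF wT] KG by (metis nat_pow_inv subsetD)
  then have "inv (x [^] n) \<in> P" using rw positive_cone_pow[OF P r jn(1)] by simp
  then show ?thesis using jn by blast
qed

text \<open>The torsion-free quotient of the FC centre is orderable; the order is encoded by the preimage of
  its positive cone.\<close>

lemma exists_total_cone:
  assumes H: "subgroup H G"
  shows "\<exists>P. positive_cone H P \<and> (\<forall>x\<in>fc_center H. x \<in> P \<or> inv x \<in> P)"
proof -
  have K: "subgroup (fc_center H) G" by (rule fc_center_subgroup[OF H])
  have T: "subgroup (fc_torsion H) G" by (rule fc_torsion_subgroup[OF H])
  have "positive_cone H (fc_torsion H)"
    using subgroup.m_closed[OF T] fc_torsion_conjg[OF H]
    by (auto simp: positive_cone_def) (auto simp: fc_torsion_def fc_center_def)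
  then have ne: "{P. positive_cone H P} \<noteq> {}" by blast
  have chain: "\<Union>\<C> \<in> {P. positive_cone H P}" if ch: "\<C> \<noteq> {}" "subset.chain {P. positive_cone H P} \<C>" for \<C>
  proof -
    have pc: "positive_cone H P" if "P \<in> \<C>" for P using ch(2) that by (auto simp: subset.chain_def)
    have common: "\<exists>P\<in>\<C>. p \<in> P \<and> q \<in> P" if "p \<in> \<Union>\<C>" "q \<in> \<Union>\<C>" for p q
      using ch(2) that unfolding subset.chain_def by blast
    show ?thesis
      unfolding mem_Collect_eq positive_cone_def
    proof (intro conjI ballI impI)
      show "fc_torsion H \<subseteq> \<Union>\<C>" using ch(1) pc unfolding positive_cone_def by blast
      show "\<Union>\<C> \<subseteq> fc_center H" using pc unfolding positive_cone_def by blast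
    next
      fix p q assume "p \<in> \<Union>\<C>" "q \<in> \<Union>\<C>"
      then obtain P where "P \<in> \<C>" "p \<in> P" "q \<in> P" using common by blast
      then show "p \<otimes> q \<in> \<Union>\<C>" using pc unfolding positive_cone_def by blast
    next
      fix k p assume "k \<in> fc_center H" "p \<in> \<Union>\<C>"
      then show "conjg k p \<in> \<Union>\<C>" using pc unfolding positive_cone_def by blast
    next
      fix p assume "p \<in> \<Union>\<C>" "inv p \<in> \<Union>\<C>"
      then obtain P where "P \<in> \<C>" "p \<in> P" "inv p \<in> P" using common by blast
      then show "p \<in> fc_torsion H" using pc unfolding positive_cone_def by blast
    qed
  qed
  obtain P where P: "positive_cone H P" "\<And>Q. positive_cone H Q \<Longrightarrow> P \<subseteq> Q \<Longrightarrow> Q = P"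
    using subset_Zorn_nonempty[OF ne chain] by auto
  have "x \<in> P \<or> inv x \<in> P" if xK: "x \<in> fc_center H" for x
  proof (rule ccontr)
    assume n: "\<not> ?thesis"
    have xG: "x \<in> carrier G" and iK: "inv x \<in> fc_center H"
      using xK subgroup.mem_carrier[OF K] subgroup.m_inv_closed[OF K] by auto
    \<comment> \<open>\<open>P\<close> contains a negative power of \<open>x\<close> and a negative
      power of \<open>inv x\<close>. Hence it contains a common power of \<open>x\<close> together
      with its inverse, and that power is torsion.\<close>
    obtain n m :: nat where nm: "n > 0" "inv (x [^] n) \<in> P" "m > 0" "inv (inv x [^] m) \<in> P"
      using maximal_cone_inv_power[OF H P xK] maximal_cone_inv_power[OF H P iK] n by blast
    have "inv (x [^] n) [^] m = inv (x [^] (n * m))" "inv (inv x [^] m) [^] n = x [^] (n * m)"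
      using xG by (simp_all add: nat_pow_inv[symmetric] nat_pow_pow mult.commute)
    then have "inv (x [^] (n * m)) \<in> P" "x [^] (n * m) \<in> P"
      using positive_cone_pow[OF P(1) nm(2,3)] positive_cone_pow[OF P(1) nm(4,1)] by auto
    then have "x [^] (n * m) \<in> fc_torsion H" using P(1) by (auto simp: positive_cone_def)
    then obtain l :: nat where "l > 0" "(x [^] (n * m)) [^] l = \<one>" by (auto simp: fc_torsion_def)
    then have "x \<in> fc_torsion H"
      using xK nm xG by (auto simp: fc_torsion_def nat_pow_pow intro!: exI[of _ "n * m * l"])
    then show False using n P(1) by (auto simp: positive_cone_def)
  qed
  then show ?thesis using P(1) by blast
qed

section \<open>Intersections of cosets of centralizers\<close>

text \<open>Left translation on the level of equations: within the group, \<open>z\<close> solves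
  \<open>f\<close> exactly when \<open>x \<otimes> z\<close> solves \<open>act x f\<close>.\<close>

definition act :: "'a \<Rightarrow> ('a \<times> 'a) set \<Rightarrow> ('a \<times> 'a) set" where
  "act x f = (\<lambda>(y, v). (y, conjg x v)) ` f"

definition solutions :: "('a \<times> 'a) set \<Rightarrow> 'a set" where
  "solutions f = {z. \<forall>(y, v)\<in>f. conjg z y = v}"

lemma act_act: "f \<subseteq> UNIV \<times> carrier G \<Longrightarrow> x \<in> carrier G \<Longrightarrow> y \<in> carrier G \<Longrightarrow>
    act x (act y f) = act (x \<otimes> y) f"
  unfolding act_def image_image by (intro image_cong) (auto simp: conjg_conjg)

lemma act_one: "f \<subseteq> UNIV \<times> carrier G \<Longrightarrow> act \<one> f = f"
  unfolding act_def by (subst image_cong[of f f _ id]) auto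

lemma act_carrier: "f \<subseteq> Y \<times> carrier G \<Longrightarrow> x \<in> carrier G \<Longrightarrow> act x f \<subseteq> Y \<times> carrier G"
  by (auto simp: act_def)

lemma card_act:
  assumes "f \<subseteq> UNIV \<times> carrier G" "x \<in> carrier G"
  shows "card (act x f) = card f"
proof -
  have "inj_on (\<lambda>(y, v). (y, conjg x v)) f"
  proof (rule inj_onI)
    fix p q assume pq: "p \<in> f" "q \<in> f" "(case p of (y, v) \<Rightarrow> (y, conjg x v)) = (case q of (y, v) \<Rightarrow> (y, conjg x v))"
    then have "snd p \<in> carrier G" "snd q \<in> carrier G" using assms(1) by auto
    then show "p = q" using pq(3) assms(2) by (auto simp: conjg_inject split: prod.splits)
  qed
  then show ?thesis unfolding act_def by (rule card_image)
qed

lemma solutions_union: "z \<in> solutions f \<Longrightarrow> z \<in> solutions g \<Longrightarrow> z \<in> solutions (f \<union> g)"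
  by (auto simp: solutions_def)

lemma solutions_act:
  assumes "f \<subseteq> carrier G \<times> carrier G" "x \<in> carrier G" "z \<in> carrier G" "x \<otimes> z \<in> solutions f"
  shows "z \<in> solutions (act (inv x) f)"
proof -
  have "conjg z y = conjg (inv x) v" if "(y, v) \<in> f" for y v
  proof -
    have "y \<in> carrier G" using that assms(1) by blast
    moreover have "conjg (x \<otimes> z) y = v" using assms(4) that by (auto simp: solutions_def)
    ultimately show ?thesis using assms by (auto simp: conjg_conjg[symmetric])
  qed
  then show ?thesis by (auto simp: solutions_def act_def)
qed

text \<open>A system with a solution is the graph of a function on its first coordinates. This
  bounds the cardinalities in the extremal choice of a cover.\<close>

lemma card_le_of_solution:
  assumes "z \<in> solutions f" "f \<subseteq> Y \<times> UNIV" "finite Y"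
  shows "card f \<le> card Y"
proof -
  have "snd p = conjg z (fst p)" if "p \<in> f" for p using assms(1) that by (auto simp: solutions_def)
  then have "inj_on fst f" by (auto simp: inj_on_def prod_eq_iff)
  then have "card f = card (fst ` f)" by (simp add: card_image)
  also have "\<dots> \<le> card Y" using assms by (intro card_mono) auto
  finally show ?thesis .
qed

section \<open>Comparing elements of the FC centre\<close>

text \<open>With the quotient formed on the right, invariance under right translation is formal,
  while left translation uses that \<open>P\<close> is stable under conjugation. Elements of one
  torsion coset lie below each other.\<close>

definition cone_le :: "'a set \<Rightarrow> 'a \<Rightarrow> 'a \<Rightarrow> bool" where
  "cone_le P x y \<longleftrightarrow> y \<otimes> inv x \<in> P"

definition torsion_coset :: "'a set \<Rightarrow> 'a \<Rightarrow> 'a set" where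
  "torsion_coset H g = {x \<in> carrier G. x \<otimes> inv g \<in> fc_torsion H}"

lemma cone_le_trans:
  assumes "subgroup H G" "positive_cone H P" "x \<in> carrier G" "y \<in> carrier G" "z \<in> carrier G"
    and "cone_le P x y" "cone_le P y z"
  shows "cone_le P x z"
proof -
  have "(z \<otimes> inv y) \<otimes> (y \<otimes> inv x) \<in> P" using assms unfolding cone_le_def positive_cone_def by blast
  then show ?thesis using assms by (simp add: cone_le_def m_assoc)
qed

lemma cone_le_mult_right:
  "x \<in> carrier G \<Longrightarrow> y \<in> carrier G \<Longrightarrow> z \<in> carrier G \<Longrightarrow> cone_le P (x \<otimes> z) (y \<otimes> z) \<longleftrightarrow> cone_le P x y"
  by (simp add: cone_le_def group_simps)

lemma cone_le_mult_left:
  assumes "positive_cone H P" "z \<in> fc_center H" "z \<in> carrier G" "x \<in> carrier G" "y \<in> carrier G" "cone_le P x y"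
  shows "cone_le P (z \<otimes> x) (z \<otimes> y)"
proof -
  have "conjg z (y \<otimes> inv x) \<in> P" using assms unfolding positive_cone_def cone_le_def by blast
  then show ?thesis using assms by (simp add: cone_le_def conjg_def group_simps)
qed

lemma cone_le_torsion: "positive_cone H P \<Longrightarrow> y \<otimes> inv x \<in> fc_torsion H \<Longrightarrow> cone_le P x y"
  by (auto simp: cone_le_def positive_cone_def)

lemma cone_le_antisym:
  assumes "positive_cone H P" "x \<in> carrier G" "y \<in> carrier G" "cone_le P x y" "cone_le P y x"
  shows "x \<otimes> inv y \<in> fc_torsion H"
proof -
  have "inv (x \<otimes> inv y) = y \<otimes> inv x" using assms by (simp add: inv_mult_group)
  then show ?thesis using assms unfolding cone_le_def positive_cone_def by metis
qed

lemma cone_max: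
  assumes H: "subgroup H G" and P: "positive_cone H P" "\<And>x. x \<in> fc_center H \<Longrightarrow> x \<in> P \<or> inv x \<in> P"
    and F: "finite F" "F \<noteq> {}" "F \<subseteq> fc_center H"
  shows "\<exists>g\<in>F. \<forall>x\<in>F. cone_le P x g"
  using F
proof (induction F rule: finite_ne_induct)
  have K: "subgroup (fc_center H) G" by (rule fc_center_subgroup[OF H])
  have KG: "\<And>x. x \<in> fc_center H \<Longrightarrow> x \<in> carrier G" using subgroup.mem_carrier[OF K] .
  have refl: "cone_le P x x" if "x \<in> fc_center H" for x
    using KG[OF that] subgroup.one_closed[OF fc_torsion_subgroup[OF H]] P(1) by (auto simp: cone_le_def positive_cone_def)
  {
    case (singleton x)
    then show ?case using refl by auto
  next
    case (insert x F)
    then obtain g where g: "g \<in> F" "\<forall>x\<in>F. cone_le P x g" by auto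
    have xg: "x \<in> fc_center H" "g \<in> fc_center H" using insert g by auto
    then have G: "x \<in> carrier G" "g \<in> carrier G" using KG by auto
    have "g \<otimes> inv x \<in> P \<or> inv (g \<otimes> inv x) \<in> P"
      using P(2)[OF subgroup.m_closed[OF K xg(2) subgroup.m_inv_closed[OF K xg(1)]]] .
    then have "cone_le P x g \<or> cone_le P g x" using G by (simp add: cone_le_def inv_mult_group)
    then show ?case
    proof
      assume "cone_le P x g"
      then show ?thesis using g by auto
    next
      assume gx: "cone_le P g x"
      have "cone_le P y x" if "y \<in> F" for y
        using cone_le_trans[OF H P(1) _ G(2,1) _ gx, of y] g(2) that insert.prems KG by auto
      then show ?thesis using refl[OF xg(1)] by auto
    qed
  }
qed

end

section \<open>Strongly graded rings\<close>

lemma set_prodE: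
  assumes "x \<in> U \<star> V"
  obtains n u v where "x = (\<Sum>i<(n::nat). u i * v i)" "\<And>i. i < n \<Longrightarrow> u i \<in> U" "\<And>i. i < n \<Longrightarrow> v i \<in> V"
  using assms unfolding set_prod_def by blast

lemma set_prodI: "u \<in> U \<Longrightarrow> v \<in> V \<Longrightarrow> u * v \<in> U \<star> V"
  unfolding set_prod_def
  by (rule CollectI, rule exI[of _ "1::nat"], rule exI[of _ "\<lambda>_. u"], rule exI[of _ "\<lambda>_. v"]) auto

lemma zero_in_set_prod: "0 \<in> U \<star> V"
  unfolding set_prod_def by (auto intro!: exI[of _ "0::nat"])

lemma set_prod_add:
  assumes "x \<in> U \<star> V" "y \<in> U \<star> V"
  shows "x + y \<in> U \<star> V"
proof -
  obtain n u v where x: "x = (\<Sum>i<(n::nat). u i * v i)" "\<And>i. i < n \<Longrightarrow> u i \<in> U" "\<And>i. i < n \<Longrightarrow> v i \<in> V"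
    using assms(1) by (rule set_prodE) blast
  obtain m u' v' where y: "y = (\<Sum>i<(m::nat). u' i * v' i)" "\<And>i. i < m \<Longrightarrow> u' i \<in> U" "\<And>i. i < m \<Longrightarrow> v' i \<in> V"
    using assms(2) by (rule set_prodE) blast
  define a where "a i = (if i < n then u i else u' (i - n))" for i
  define b where "b i = (if i < n then v i else v' (i - n))" for i
  have "(\<Sum>i<n + m. a i * b i) = (\<Sum>i<n. a i * b i) + (\<Sum>i=n..<n + m. a i * b i)"
    by (simp add: lessThan_atLeast0 sum.atLeastLessThan_concat)
  also have "(\<Sum>i=n..<n + m. a i * b i) = (\<Sum>i<m. a (i + n) * b (i + n))"
    using sum.shift_bounds_nat_ivl[of "\<lambda>i. a i * b i" 0 n m] by (simp add: lessThan_atLeast0 add.commute)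
  also have "(\<Sum>i<n. a i * b i) + \<dots> = x + y" using x(1) y(1) by (simp add: a_def b_def)
  finally have "x + y = (\<Sum>i<n + m. a i * b i)" by simp
  moreover have "\<forall>i<n + m. a i \<in> U \<and> b i \<in> V" using x y by (auto simp: a_def b_def)
  ultimately show ?thesis unfolding set_prod_def by blast
qed

lemma set_prod_uminus:
  assumes "x \<in> U \<star> V" "\<And>u. u \<in> U \<Longrightarrow> - u \<in> U"
  shows "- x \<in> U \<star> V"
proof -
  obtain n u v where x: "x = (\<Sum>i<(n::nat). u i * v i)" "\<And>i. i < n \<Longrightarrow> u i \<in> U" "\<And>i. i < n \<Longrightarrow> v i \<in> V"
    using assms(1) by (rule set_prodE) blast
  have "- x = (\<Sum>i<n. (- u i) * v i)" by (simp add: x(1) sum_negf)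
  moreover have "\<forall>i<n. - u i \<in> U \<and> v i \<in> V" using x(2,3) assms(2) by blast
  ultimately show ?thesis unfolding set_prod_def
    by (intro CollectI exI[of _ n] exI[of _ "\<lambda>i. - u i"] exI[of _ v]) blast
qed

lemma add_subgroupD:
  assumes "add_subgroup A"
  shows "0 \<in> A" "\<And>a b. a \<in> A \<Longrightarrow> b \<in> A \<Longrightarrow> a - b \<in> A" "\<And>a. a \<in> A \<Longrightarrow> - a \<in> A"
    "\<And>a b. a \<in> A \<Longrightarrow> b \<in> A \<Longrightarrow> a + b \<in> A"
proof -
  show z: "0 \<in> A" and d: "\<And>a b. a \<in> A \<Longrightarrow> b \<in> A \<Longrightarrow> a - b \<in> A"
    using assms by (auto simp: add_subgroup_def)
  show n: "\<And>a. a \<in> A \<Longrightarrow> - a \<in> A" using d[OF z] by simp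
  show "\<And>a b. a \<in> A \<Longrightarrow> b \<in> A \<Longrightarrow> a + b \<in> A" using d[OF _ n] by fastforce
qed

lemma add_subgroup_sum:
  assumes "add_subgroup A" "\<And>i. i \<in> F \<Longrightarrow> f i \<in> A"
  shows "sum f F \<in> A"
  using assms(2) add_subgroupD[OF assms(1)] by (induction F rule: infinite_finite_induct) auto

lemma set_prod_subset:
  assumes "add_subgroup Z" "\<And>u v. u \<in> U \<Longrightarrow> v \<in> V \<Longrightarrow> u * v \<in> Z"
  shows "U \<star> V \<subseteq> Z"
proof
  fix x assume "x \<in> U \<star> V"
  then show "x \<in> Z" by (rule set_prodE) (auto intro!: add_subgroup_sum assms)
qed

lemma add_subgroup_zero: "add_subgroup {0}"
  by (simp add: add_subgroup_def)

lemma set_prod_eq_zero_iff: "U \<star> V = {0} \<longleftrightarrow> (\<forall>u\<in>U. \<forall>v\<in>V. u * v = 0)"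
  using set_prod_subset[OF add_subgroup_zero, of U V] zero_in_set_prod[of U V] set_prodI[of _ U _ V] by blast

lemma add_subgroup_set_prod:
  assumes "add_subgroup U"
  shows "add_subgroup (U \<star> V)"
  unfolding add_subgroup_def
proof (intro conjI ballI)
  fix a b assume "a \<in> U \<star> V" "b \<in> U \<star> V"
  then have "a + - b \<in> U \<star> V" by (intro set_prod_add set_prod_uminus add_subgroupD(3)[OF assms])
  then show "a - b \<in> U \<star> V" by simp
qed (rule zero_in_set_prod)

lemma add_subgroup_vimage: "add_subgroup {w. a * w * b = (0 :: 'a::ring)}"
  by (auto simp: add_subgroup_def algebra_simps)

definition add_span :: "'a::ring set \<Rightarrow> 'a set" where
  "add_span X = \<Inter>{A. add_subgroup A \<and> X \<subseteq> A}"

lemma add_span_base: "x \<in> X \<Longrightarrow> x \<in> add_span X"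
  by (auto simp: add_span_def)

lemma add_span_subgroup: "add_subgroup (add_span X)"
  by (auto simp: add_span_def add_subgroup_def)

lemma add_span_subset: "add_subgroup A \<Longrightarrow> X \<subseteq> A \<Longrightarrow> add_span X \<subseteq> A"
  by (auto simp: add_span_def)

lemma add_span_mult_left:
  assumes "\<And>x. x \<in> X \<Longrightarrow> r * x \<in> add_span Y" "x \<in> add_span X"
  shows "r * x \<in> add_span Y"
proof -
  have "add_subgroup {x. r * x \<in> add_span Y}"
    using add_subgroupD(1,2)[OF add_span_subgroup[of Y]]
    by (simp add: add_subgroup_def right_diff_distrib)
  from add_span_subset[OF this, of X] assms(1) have "add_span X \<subseteq> {x. r * x \<in> add_span Y}" by blast
  then show ?thesis using assms(2) by blast
qed

lemma add_span_mult_right: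
  assumes "\<And>x. x \<in> X \<Longrightarrow> x * r \<in> add_span Y" "x \<in> add_span X"
  shows "x * r \<in> add_span Y"
proof -
  have "add_subgroup {x. x * r \<in> add_span Y}"
    using add_subgroupD(1,2)[OF add_span_subgroup[of Y]]
    by (simp add: add_subgroup_def left_diff_distrib)
  from add_span_subset[OF this, of X] assms(1) have "add_span X \<subseteq> {x. x * r \<in> add_span Y}" by blast
  then show ?thesis using assms(2) by blast
qed

lemma add_span_mult_zero:
  assumes "\<And>x y. x \<in> X \<Longrightarrow> y \<in> Y \<Longrightarrow> x * y = 0" "x \<in> add_span X" "y \<in> add_span Y"
  shows "x * y = 0"
proof -
  have "add_subgroup {x. x * y = 0}" for y :: 'a by (simp add: add_subgroup_def left_diff_distrib)
  from add_span_subset[OF this] assms(1) have "add_span X \<subseteq> {x. x * y = 0}" if "y \<in> Y" for y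
    using that by blast
  then have 1: "x * y = 0" if "y \<in> Y" for y using that assms(2) by blast
  have "add_subgroup {y. x * y = 0}" by (simp add: add_subgroup_def right_diff_distrib)
  from add_span_subset[OF this, of Y] 1 have "add_span Y \<subseteq> {y. x * y = 0}" by blast
  then show ?thesis using assms(3) by blast
qed

section \<open>Homogeneous components and supports\<close>

locale strong_graded_ring = group G for G :: "('g, 'm) monoid_scheme" (structure) +
  fixes S :: "'g \<Rightarrow> 'a::ring set"
  assumes strongly_graded: "strongly_graded G S"
    and s_unital: "s_unital (UNIV :: 'a set)"
begin

lemma graded: "graded G S"
  using strongly_graded unfolding strongly_graded_def by blast

lemma S_subgroup: "x \<in> carrier G \<Longrightarrow> add_subgroup (S x)"
  using graded unfolding graded_def by blast

lemmas S_zero [simp] = add_subgroupD(1)[OF S_subgroup]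
  and S_diff = add_subgroupD(2)[OF S_subgroup]

lemma S_set_prod: "x \<in> carrier G \<Longrightarrow> y \<in> carrier G \<Longrightarrow> S x \<star> S y = S (x \<otimes> y)"
  using strongly_graded unfolding strongly_graded_def by blast

lemma S_mult: "a \<in> S x \<Longrightarrow> b \<in> S y \<Longrightarrow> x \<in> carrier G \<Longrightarrow> y \<in> carrier G \<Longrightarrow> a * b \<in> S (x \<otimes> y)"
  using set_prodI[of a "S x" b "S y"] S_set_prod[of x y] by simp

definition cmp :: "'a \<Rightarrow> 'g \<Rightarrow> 'a" where
  "cmp s = (THE f. (\<forall>x\<in>carrier G. f x \<in> S x) \<and> (\<forall>x. x \<notin> carrier G \<longrightarrow> f x = 0) \<and>
     finite {x. f x \<noteq> 0} \<and> s = (\<Sum>x | f x \<noteq> 0. f x))"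

definition supp :: "'a \<Rightarrow> 'g set" where
  "supp s = {x. cmp s x \<noteq> 0}"

lemma decomp_ex1:
  "\<exists>!f. (\<forall>x\<in>carrier G. f x \<in> S x) \<and> (\<forall>x. x \<notin> carrier G \<longrightarrow> f x = 0) \<and>
     finite {x. f x \<noteq> 0} \<and> s = (\<Sum>x | f x \<noteq> 0. f x)"
  using graded unfolding graded_def by blast

lemma cmp_all:
  "(\<forall>x\<in>carrier G. cmp s x \<in> S x) \<and> (\<forall>x. x \<notin> carrier G \<longrightarrow> cmp s x = 0) \<and>
     finite {x. cmp s x \<noteq> 0} \<and> s = (\<Sum>x | cmp s x \<noteq> 0. cmp s x)"
  unfolding cmp_def by (rule theI'[OF decomp_ex1])

lemma cmp_in: "x \<in> carrier G \<Longrightarrow> cmp s x \<in> S x"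
  and cmp_outside: "x \<notin> carrier G \<Longrightarrow> cmp s x = 0"
  and finite_supp [simp]: "finite (supp s)"
  and decomp: "s = (\<Sum>x\<in>supp s. cmp s x)"
  using cmp_all[of s] unfolding supp_def by blast+

lemma supp_carrier: "supp s \<subseteq> carrier G"
  using cmp_outside by (auto simp: supp_def)

lemma not_in_supp: "x \<notin> supp s \<Longrightarrow> cmp s x = 0"
  by (simp add: supp_def)

lemma cmp_eqI:
  assumes "finite F" "F \<subseteq> carrier G" "\<And>x. x \<in> F \<Longrightarrow> f x \<in> S x" "s = sum f F"
  shows "cmp s x = (if x \<in> F then f x else 0)"
proof -
  define g where "g x = (if x \<in> F then f x else 0)" for x
  have "{x. g x \<noteq> 0} \<subseteq> F" by (auto simp: g_def split: if_splits)
  then have fin: "finite {x. g x \<noteq> 0}" using assms(1) finite_subset by blast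
  have "sum f F = (\<Sum>x | g x \<noteq> 0. g x)"
    by (rule sum.mono_neutral_cong_right) (use assms in \<open>auto simp: g_def split: if_splits\<close>)
  then have g: "(\<forall>x\<in>carrier G. g x \<in> S x) \<and> (\<forall>x. x \<notin> carrier G \<longrightarrow> g x = 0) \<and>
     finite {x. g x \<noteq> 0} \<and> s = (\<Sum>x | g x \<noteq> 0. g x)"
    using assms fin by (auto simp: g_def)
  have "cmp s = g" unfolding cmp_def by (rule the1_equality, rule decomp_ex1, rule g)
  then show ?thesis by (simp add: g_def)
qed

lemma decomp_superset: "finite F \<Longrightarrow> supp s \<subseteq> F \<Longrightarrow> s = (\<Sum>x\<in>F. cmp s x)"
  by (rule trans[OF decomp sum.mono_neutral_left]) (auto intro: not_in_supp)

lemma cmp_diff: "cmp (s - t) x = cmp s x - cmp t x"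
proof -
  let ?F = "supp s \<union> supp t"
  have "s - t = (\<Sum>x\<in>?F. cmp s x) - (\<Sum>x\<in>?F. cmp t x)"
    by (intro arg_cong2[of _ _ _ _ "(-)"] decomp_superset) auto
  also have "\<dots> = (\<Sum>x\<in>?F. cmp s x - cmp t x)" by (simp add: sum_subtractf)
  finally have "cmp (s - t) x = (if x \<in> ?F then cmp s x - cmp t x else 0)"
    using supp_carrier by (intro cmp_eqI) (auto intro!: S_diff cmp_in)
  then show ?thesis by (auto simp: supp_def)
qed

lemma cmp_zero [simp]: "cmp 0 x = 0"
  using cmp_diff[of 0 0 x] by simp

lemma cmp_add: "cmp (s + t) x = cmp s x + cmp t x"
  using cmp_diff[of s "0 - t" x] cmp_diff[of 0 t x] by simp

lemma cmp_sum: "cmp (sum f F) x = (\<Sum>i\<in>F. cmp (f i) x)"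
  by (induction F rule: infinite_finite_induct) (auto simp: cmp_add)

lemma cmp_hom: "s \<in> S x \<Longrightarrow> x \<in> carrier G \<Longrightarrow> cmp s y = (if y = x then s else 0)"
  using cmp_eqI[of "{x}" "\<lambda>_. s" s y] by auto

lemma zeroI: "(\<And>x. x \<in> carrier G \<Longrightarrow> cmp s x = 0) \<Longrightarrow> s = 0"
  using supp_carrier[of s] by (intro trans[OF decomp sum.neutral]) auto

lemma nonzeroE: assumes "s \<noteq> 0" obtains x where "x \<in> supp s" "x \<in> carrier G" "cmp s x \<noteq> 0"
  using assms zeroI[of s] by (auto simp: supp_def)

lemma cmp_mult_left:
  assumes "a \<in> S y" "y \<in> carrier G" "z \<in> carrier G"
  shows "cmp (a * s) z = a * cmp s (inv y \<otimes> z)"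
proof -
  have "a * s = (\<Sum>x\<in>supp s. a * cmp s x)" by (rule trans[OF arg_cong[OF decomp, of "\<lambda>s. a * s"] sum_distrib_left])
  then have "cmp (a * s) z = (\<Sum>x\<in>supp s. cmp (a * cmp s x) z)" by (simp add: cmp_sum)
  also have "\<dots> = (\<Sum>x\<in>supp s. if x = inv y \<otimes> z then a * cmp s x else 0)"
  proof (rule sum.cong)
    fix x assume "x \<in> supp s"
    then have x: "x \<in> carrier G" using supp_carrier by auto
    then have "a * cmp s x \<in> S (y \<otimes> x)" using S_mult[OF assms(1) cmp_in] assms by auto
    then have "cmp (a * cmp s x) z = (if z = y \<otimes> x then a * cmp s x else 0)"
      using cmp_hom x assms by auto
    moreover have "z = y \<otimes> x \<longleftrightarrow> x = inv y \<otimes> z" using x assms by (auto simp: m_assoc[symmetric])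
    ultimately show "cmp (a * cmp s x) z = (if x = inv y \<otimes> z then a * cmp s x else 0)" by simp
  qed simp
  also have "\<dots> = a * cmp s (inv y \<otimes> z)" by (simp add: not_in_supp)
  finally show ?thesis .
qed

lemma cmp_mult_right:
  assumes "a \<in> S y" "y \<in> carrier G" "z \<in> carrier G"
  shows "cmp (s * a) z = cmp s (z \<otimes> inv y) * a"
proof -
  have "s * a = (\<Sum>x\<in>supp s. cmp s x * a)"
    by (rule trans[OF arg_cong[OF decomp, of "\<lambda>s. s * a"] sum_distrib_right])
  then have "cmp (s * a) z = (\<Sum>x\<in>supp s. cmp (cmp s x * a) z)" by (simp add: cmp_sum)
  also have "\<dots> = (\<Sum>x\<in>supp s. if x = z \<otimes> inv y then cmp s x * a else 0)"
  proof (rule sum.cong)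
    fix x assume "x \<in> supp s"
    then have x: "x \<in> carrier G" using supp_carrier by auto
    then have "cmp s x * a \<in> S (x \<otimes> y)" using S_mult[OF cmp_in assms(1)] assms by auto
    then have "cmp (cmp s x * a) z = (if z = x \<otimes> y then cmp s x * a else 0)"
      using cmp_hom x assms by auto
    moreover have "z = x \<otimes> y \<longleftrightarrow> x = z \<otimes> inv y" using x assms by (auto simp: m_assoc)
    ultimately show "cmp (cmp s x * a) z = (if x = z \<otimes> inv y then cmp s x * a else 0)" by simp
  qed simp
  also have "\<dots> = cmp s (z \<otimes> inv y) * a" by (simp add: not_in_supp)
  finally show ?thesis .
qed

lemma cmp_mult:
  assumes "z \<in> carrier G" "finite F" "supp s \<subseteq> F" "F \<subseteq> carrier G"
  shows "cmp (s * t) z = (\<Sum>x\<in>F. cmp s x * cmp t (inv x \<otimes> z))"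
proof -
  have "s * t = (\<Sum>x\<in>F. cmp s x * t)"
    by (rule trans[OF arg_cong[OF decomp_superset[OF assms(2,3)], of "\<lambda>s. s * t"] sum_distrib_right])
  then show ?thesis using assms by (auto simp: cmp_sum intro!: sum.cong cmp_mult_left cmp_in)
qed

lemma supp_mult:
  assumes "z \<in> supp (s * t)"
  shows "\<exists>x\<in>supp s. \<exists>y\<in>supp t. z = x \<otimes> y \<and> cmp s x * cmp t y \<noteq> 0"
proof -
  have z: "z \<in> carrier G" "cmp (s * t) z \<noteq> 0" using assms supp_carrier by (auto simp: supp_def)
  then have "(\<Sum>x\<in>supp s. cmp s x * cmp t (inv x \<otimes> z)) \<noteq> 0"
    using cmp_mult[OF z(1) finite_supp subset_refl supp_carrier, of s t] by simp
  then have "\<exists>x\<in>supp s. cmp s x * cmp t (inv x \<otimes> z) \<noteq> 0"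
    by (rule contrapos_np) (auto intro: sum.neutral)
  then obtain x where x: "x \<in> supp s" "cmp s x * cmp t (inv x \<otimes> z) \<noteq> 0" by blast
  have "inv x \<otimes> z \<in> supp t" using x(2) by (auto simp: supp_def)
  moreover have "x \<otimes> (inv x \<otimes> z) = z" using x(1) z(1) supp_carrier[of s] by auto
  ultimately show ?thesis using x by (intro bexI[of _ x] bexI[of _ "inv x \<otimes> z"]) auto
qed

lemma supp_hom: "a \<in> S y \<Longrightarrow> y \<in> carrier G \<Longrightarrow> supp a \<subseteq> {y}"
  using cmp_hom[of a y] by (auto simp: supp_def split: if_splits)

lemma supp_hom_left:
  assumes "a \<in> S y" "y \<in> carrier G"
  shows "supp (a * s) \<subseteq> (\<lambda>x. y \<otimes> x) ` supp s"
proof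
  fix z assume "z \<in> supp (a * s)"
  from supp_mult[OF this] supp_hom[OF assms] show "z \<in> (\<lambda>x. y \<otimes> x) ` supp s" by auto
qed

lemma supp_hom_right:
  assumes "a \<in> S y" "y \<in> carrier G"
  shows "supp (s * a) \<subseteq> (\<lambda>x. x \<otimes> y) ` supp s"
proof
  fix z assume "z \<in> supp (s * a)"
  from supp_mult[OF this] supp_hom[OF assms] show "z \<in> (\<lambda>x. x \<otimes> y) ` supp s" by auto
qed

lemma supp_diff: "supp (s - t) \<subseteq> supp s \<union> supp t"
  by (auto simp: supp_def cmp_diff)

definition proj :: "'a \<Rightarrow> 'g set \<Rightarrow> 'a" where
  "proj s X = (\<Sum>x\<in>supp s \<inter> X. cmp s x)"

lemma cmp_proj: "cmp (proj s X) x = (if x \<in> X then cmp s x else 0)"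
proof -
  have "cmp (proj s X) x = (if x \<in> supp s \<inter> X then cmp s x else 0)"
    unfolding proj_def using supp_carrier by (intro cmp_eqI) (auto intro!: cmp_in)
  then show ?thesis by (auto simp: not_in_supp)
qed

lemma supp_proj: "supp (proj s X) = supp s \<inter> X"
  by (auto simp: supp_def cmp_proj)

lemma eqI: "(\<And>x. x \<in> carrier G \<Longrightarrow> cmp s x = cmp t x) \<Longrightarrow> s = t"
  using zeroI[of "s - t"] by (simp add: cmp_diff)

lemma proj_id: "supp s \<subseteq> X \<Longrightarrow> proj s X = s"
  by (rule eqI) (auto simp: cmp_proj supp_def)

lemma proj_hom_left:
  assumes "a \<in> S y" "y \<in> carrier G" "\<And>x. x \<in> carrier G \<Longrightarrow> y \<otimes> x \<in> Y \<longleftrightarrow> x \<in> X"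
  shows "proj (a * s) Y = a * proj s X"
proof (rule eqI)
  fix z assume z: "z \<in> carrier G"
  have "z \<in> Y \<longleftrightarrow> inv y \<otimes> z \<in> X" using assms(3)[of "inv y \<otimes> z"] assms(2) z by simp
  then show "cmp (proj (a * s) Y) z = cmp (a * proj s X) z"
    using assms(1,2) z by (simp add: cmp_proj cmp_mult_left)
qed

lemma proj_hom_right:
  assumes "a \<in> S y" "y \<in> carrier G" "\<And>x. x \<in> carrier G \<Longrightarrow> x \<otimes> y \<in> Y \<longleftrightarrow> x \<in> X"
  shows "proj (s * a) Y = proj s X * a"
proof (rule eqI)
  fix z assume z: "z \<in> carrier G"
  have "z \<in> Y \<longleftrightarrow> z \<otimes> inv y \<in> X" using assms(3)[of "z \<otimes> inv y"] assms(2) z by (simp add: m_assoc)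
  then show "cmp (proj (s * a) Y) z = cmp (proj s X * a) z"
    using assms(1,2) z by (simp add: cmp_proj cmp_mult_right)
qed

lemma grade_sum_iff:
  assumes "N \<subseteq> carrier G"
  shows "s \<in> grade_sum S N \<longleftrightarrow> supp s \<subseteq> N"
proof
  assume "s \<in> grade_sum S N"
  then obtain F f where "finite F" "F \<subseteq> N" "\<forall>x\<in>F. f x \<in> S x" "s = (\<Sum>x\<in>F. f x)"
    by (auto simp: grade_sum_def)
  then show "supp s \<subseteq> N" using cmp_eqI[of F f s] assms by (auto simp: supp_def split: if_splits)
next
  assume "supp s \<subseteq> N"
  then show "s \<in> grade_sum S N"
    unfolding grade_sum_def using cmp_in assms
    by (intro CollectI exI[of _ "supp s"] exI[of _ "cmp s"] conjI decomp) auto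
qed

section \<open>Local units and nonvanishing\<close>

lemma strong_zero:
  assumes "w \<in> S (x \<otimes> y)" "x \<in> carrier G" "y \<in> carrier G"
    and "\<And>u v. u \<in> S x \<Longrightarrow> v \<in> S y \<Longrightarrow> a * (u * v) * b = 0"
  shows "a * w * b = 0"
proof -
  have "S x \<star> S y \<subseteq> {w. a * w * b = 0}"
    using assms(4) by (intro set_prod_subset[OF add_subgroup_vimage]) auto
  then show ?thesis using assms(1) S_set_prod[OF assms(2,3)] by auto
qed

text \<open>By s-unitality some ring element fixes \<open>a\<close> from the left; comparing
  components of degree \<open>x\<close> shows that its component of degree \<open>\<one>\<close>
  already does.\<close>

lemma left_unit:
  assumes "a \<in> S x" "x \<in> carrier G"
  shows "\<exists>e\<in>S \<one>. e * a = a"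
proof -
  have "a \<in> UNIV \<star> {a}" using s_unital by (simp add: s_unital_def)
  then obtain n u v where e: "a = (\<Sum>i<(n::nat). u i * v i)" "\<And>i. i < n \<Longrightarrow> v i \<in> {a}"
    by (rule set_prodE) blast
  have "a = (\<Sum>i<n. u i * a)" by (rule trans[OF e(1) sum.cong]) (use e(2) in auto)
  also have "\<dots> = (\<Sum>i<n. u i) * a" by (rule sum_distrib_right[symmetric])
  finally have "cmp a x = cmp ((\<Sum>i<n. u i) * a) x" by (rule arg_cong)
  also have "\<dots> = cmp (\<Sum>i<n. u i) (x \<otimes> inv x) * a"
    by (rule cmp_mult_right[OF assms assms(2)])
  finally have "cmp a x = cmp (\<Sum>i<n. u i) (x \<otimes> inv x) * a" .
  then have "cmp (\<Sum>i<n. u i) \<one> * a = a" using assms cmp_hom[OF assms, of x] by simp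
  then show ?thesis using cmp_in[OF one_closed] by blast
qed

lemma right_unit:
  assumes "a \<in> S x" "x \<in> carrier G"
  shows "\<exists>e\<in>S \<one>. a * e = a"
proof -
  have "a \<in> {a} \<star> UNIV" using s_unital by (simp add: s_unital_def)
  then obtain n u v where e: "a = (\<Sum>i<(n::nat). u i * v i)" "\<And>i. i < n \<Longrightarrow> u i \<in> {a}"
    by (rule set_prodE) blast
  have "a = (\<Sum>i<n. a * v i)" by (rule trans[OF e(1) sum.cong]) (use e(2) in auto)
  also have "\<dots> = a * (\<Sum>i<n. v i)" by (rule sum_distrib_left[symmetric])
  finally have "cmp a x = cmp (a * (\<Sum>i<n. v i)) x" by (rule arg_cong)
  also have "\<dots> = a * cmp (\<Sum>i<n. v i) (inv x \<otimes> x)"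
    by (rule cmp_mult_left[OF assms assms(2)])
  finally have "cmp a x = a * cmp (\<Sum>i<n. v i) (inv x \<otimes> x)" .
  then have "a * cmp (\<Sum>i<n. v i) \<one> = a" using assms cmp_hom[OF assms, of x] by simp
  then show ?thesis using cmp_in[OF one_closed] by blast
qed

text \<open>The replacement for a unit of degree \<open>x\<close>. A local unit \<open>e\<close> of
  a nonzero component of \<open>s\<close> lies in \<open>S (inv x) \<star> S x\<close>, so it would
  annihilate \<open>s\<close> if \<open>S x\<close> did.\<close>

lemma nonzero_left:
  assumes "s \<noteq> 0" "x \<in> carrier G"
  shows "\<exists>u\<in>S x. u * s \<noteq> 0"
proof (rule ccontr)
  assume n: "\<not> ?thesis"
  obtain y where y: "y \<in> carrier G" "cmp s y \<noteq> 0" using assms(1) by (rule nonzeroE)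
  obtain e where e: "e \<in> S \<one>" "e * cmp s y = cmp s y" using left_unit[OF cmp_in] y by blast
  have "e * e * s = 0" if "e \<in> S (inv x \<otimes> x)" for e
    using that n assms(2) by (intro strong_zero[of e "inv x" x e s]) (auto simp: mult.assoc)
  then have "w * e * s = 0" if "w \<in> S \<one>" for w
    using strong_zero[of e "inv x" x w s] n assms(2) e(1) by (simp add: mult.assoc)
  moreover obtain e' where "e' \<in> S \<one>" "e' * e = e" using left_unit e(1) by blast
  ultimately have "e * s = 0" by metis
  then have "cmp (e * s) y = 0" by simp
  then show False using e y cmp_mult_left[of e \<one> y s] by simp
qed

lemma nonzero_right:
  assumes "s \<noteq> 0" "x \<in> carrier G"
  shows "\<exists>u\<in>S x. s * u \<noteq> 0"
proof (rule ccontr)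
  assume n: "\<not> ?thesis"
  obtain y where y: "y \<in> carrier G" "cmp s y \<noteq> 0" using assms(1) by (rule nonzeroE)
  obtain e where e: "e \<in> S \<one>" "cmp s y * e = cmp s y" using right_unit[OF cmp_in] y by blast
  have "s * e * w = 0" if "w \<in> S \<one>" for w
    using strong_zero[of e x "inv x" s w] n assms(2) e(1) by (simp add: mult.assoc[symmetric])
  moreover obtain e' where "e' \<in> S \<one>" "e * e' = e" using right_unit e(1) by blast
  ultimately have "s * e = 0" by (metis mult.assoc)
  then have "cmp (s * e) y = 0" by simp
  then show False using e y cmp_mult_right[of e \<one> y s] by simp
qed

lemma homogeneous_zero_cmp:
  assumes "a \<in> S y" "y \<in> carrier G" "a * s = 0"
  shows "a * cmp s z = 0"
proof (cases "z \<in> carrier G")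
  case True
  then have "cmp (a * s) (y \<otimes> z) = a * cmp s z" using assms(1,2) by (simp add: cmp_mult_left)
  then show ?thesis using assms(3) by simp
qed (simp add: cmp_outside)

section \<open>Good pairs and the right ideal \<open>I \<star> UNIV\<close>\<close>

definition good_pair :: "'g set \<Rightarrow> 'a set \<Rightarrow> bool" where
  "good_pair H I \<longleftrightarrow> subgroup H G \<and> ideal_of I (S \<one>) \<and> I \<noteq> {0} \<and> invariant G S H I \<and>
     (\<forall>x \<in> carrier G - H. conj_set G S I x \<star> I = {0})"

lemma conj_set_subset:
  assumes "add_subgroup Z" "\<And>u i v. u \<in> S (inv x) \<Longrightarrow> i \<in> I \<Longrightarrow> v \<in> S x \<Longrightarrow> u * i * v \<in> Z"
  shows "conj_set G S I x \<subseteq> Z"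
  unfolding conj_set_def
proof (rule set_prod_subset[OF assms(1)])
  fix w v assume w: "w \<in> S (inv x) \<star> I" and v: "v \<in> S x"
  have "add_subgroup {w. w * v \<in> Z}"
    using add_subgroupD(1,2)[OF assms(1)] by (simp add: add_subgroup_def left_diff_distrib)
  then have "S (inv x) \<star> I \<subseteq> {w. w * v \<in> Z}" using assms(2) v by (intro set_prod_subset) auto
  then show "w * v \<in> Z" using w by blast
qed

lemma conj_setI: "u \<in> S (inv x) \<Longrightarrow> i \<in> I \<Longrightarrow> v \<in> S x \<Longrightarrow> u * i * v \<in> conj_set G S I x"
  unfolding conj_set_def by (intro set_prodI)

lemma ideal_ofD:
  assumes "ideal_of I R"
  shows "I \<subseteq> R" "add_subgroup I" "\<And>r i. r \<in> R \<Longrightarrow> i \<in> I \<Longrightarrow> r * i \<in> I"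
    "\<And>r i. r \<in> R \<Longrightarrow> i \<in> I \<Longrightarrow> i * r \<in> I"
  using assms by (auto simp: ideal_of_def)

lemma good_pairD:
  assumes "good_pair H I"
  shows "subgroup H G" "H \<subseteq> carrier G" "I \<subseteq> S \<one>" "add_subgroup I" "I \<noteq> {0}"
    "\<And>r i. r \<in> S \<one> \<Longrightarrow> i \<in> I \<Longrightarrow> r * i \<in> I" "\<And>r i. r \<in> S \<one> \<Longrightarrow> i \<in> I \<Longrightarrow> i * r \<in> I"
  using assms ideal_ofD[of I "S \<one>"] subgroup.subset[of H G] unfolding good_pair_def by blast+

lemma good_pair_conj:
  assumes "good_pair H I" "h \<in> H" "u \<in> S h" "i \<in> I" "v \<in> S (inv h)"
  shows "u * i * v \<in> I"
proof -
  have H: "subgroup H G" using good_pairD(1)[OF assms(1)] .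
  have "inv h \<in> H" "inv (inv h) = h"
    using subgroup.m_inv_closed[OF H assms(2)] subgroup.mem_carrier[OF H assms(2)] by auto
  then have "conj_set G S I (inv h) \<subseteq> I" "u * i * v \<in> conj_set G S I (inv h)"
    using assms conj_setI[of u "inv h" i I v] by (auto simp: good_pair_def invariant_def)
  then show ?thesis by blast
qed

text \<open>The definition only makes the product vanish after multiplication by
  \<open>S (inv x)\<close> on the left; by \<open>nonzero_left\<close> this left factor can be
  cancelled.\<close>

lemma good_pair_zero:
  assumes "good_pair H I" "x \<in> carrier G" "x \<notin> H" "i \<in> I" "v \<in> S x" "j \<in> I"
  shows "i * v * j = 0"
proof (rule ccontr)
  assume "i * v * j \<noteq> 0"
  then obtain u where u: "u \<in> S (inv x)" "u * (i * v * j) \<noteq> 0"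
    using nonzero_left[of "i * v * j" "inv x"] assms(2) by auto
  have "conj_set G S I x \<star> I = {0}" using assms by (auto simp: good_pair_def)
  then have "u * i * v * j = 0"
    using conj_setI[of u x i I v] assms u(1) unfolding set_prod_eq_zero_iff by blast
  then show False using u(2) by (simp add: mult.assoc)
qed

lemma good_pairI:
  assumes "subgroup H G" "ideal_of I (S \<one>)" "I \<noteq> {0}"
    and "\<And>h u i v. h \<in> H \<Longrightarrow> u \<in> S h \<Longrightarrow> i \<in> I \<Longrightarrow> v \<in> S (inv h) \<Longrightarrow> u * i * v \<in> I"
    and "\<And>x i v j. x \<in> carrier G \<Longrightarrow> x \<notin> H \<Longrightarrow> i \<in> I \<Longrightarrow> v \<in> S x \<Longrightarrow> j \<in> I \<Longrightarrow> i * v * j = 0"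
  shows "good_pair H I"
  unfolding good_pair_def invariant_def
proof (intro conjI ballI assms(1,2,3))
  fix x assume x: "x \<in> H"
  then have "inv x \<in> H" "inv (inv x) = x"
    using subgroup.m_inv_closed[OF assms(1)] subgroup.mem_carrier[OF assms(1)] by auto
  then show "conj_set G S I x \<subseteq> I"
    using assms(4)[of "inv x"] by (intro conj_set_subset ideal_ofD(2)[OF assms(2)]) auto
next
  fix x assume x: "x \<in> carrier G - H"
  have "a * j = 0" if a: "a \<in> conj_set G S I x" and j: "j \<in> I" for a j
  proof -
    have "add_subgroup {a. a * j = 0}" by (simp add: add_subgroup_def left_diff_distrib)
    moreover have "u * i * v * j = 0" if "i \<in> I" "v \<in> S x" for u i v
      using assms(5)[of x i v j] x that j by (simp add: mult.assoc)
    ultimately have "conj_set G S I x \<subseteq> {a. a * j = 0}" by (intro conj_set_subset) auto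
    then show ?thesis using a by blast
  qed
  then show "conj_set G S I x \<star> I = {0}" unfolding set_prod_eq_zero_iff by blast
qed

lemma proj_diff: "proj (s - t) X = proj s X - proj t X"
  by (rule eqI) (simp add: cmp_proj cmp_diff)

context
  fixes H I
  assumes good: "good_pair H I"
begin

lemma hull_subgroup: "add_subgroup (I \<star> UNIV)"
  by (rule add_subgroup_set_prod[OF good_pairD(4)[OF good]])

lemma hull_right:
  assumes "s \<in> I \<star> UNIV"
  shows "s * t \<in> I \<star> UNIV"
proof -
  have "add_subgroup {s. s * t \<in> I \<star> UNIV}"
    using add_subgroupD(1,2)[OF hull_subgroup] by (simp add: add_subgroup_def left_diff_distrib)
  then have "I \<star> UNIV \<subseteq> {s. s * t \<in> I \<star> UNIV}"
    by (intro set_prod_subset) (auto simp: mult.assoc intro: set_prodI)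
  then show ?thesis using assms by blast
qed

text \<open>A right local unit of \<open>i\<close> lies in \<open>S (inv h) \<star> S h\<close>.
  Inserting it between \<open>i\<close> and \<open>t\<close> splits \<open>u * i * t\<close> into
  sums of an element \<open>u * i * v\<close> of \<open>I\<close> times a ring element.\<close>

lemma hull_left:
  assumes "h \<in> H" "u \<in> S h" "s \<in> I \<star> UNIV"
  shows "u * s \<in> I \<star> UNIV"
proof -
  have hG: "h \<in> carrier G" using assms(1) good_pairD(2)[OF good] by blast
  have base: "u * (i * t) \<in> I \<star> UNIV" if i: "i \<in> I" for i t
  proof -
    obtain e where e: "e \<in> S \<one>" "i * e = i" using right_unit[of i \<one>] i good_pairD(3)[OF good] by blast
    have "add_subgroup {e. u * i * e * t \<in> I \<star> UNIV}"
      using add_subgroupD(1,2)[OF hull_subgroup]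
      by (simp add: add_subgroup_def left_diff_distrib right_diff_distrib)
    moreover have "u * i * (v * w) * t \<in> I \<star> UNIV" if "v \<in> S (inv h)" for v w
      using set_prodI[OF good_pair_conj[OF good assms(1,2) i that], of "w * t" UNIV]
      by (simp add: mult.assoc)
    ultimately have "S (inv h) \<star> S h \<subseteq> {e. u * i * e * t \<in> I \<star> UNIV}"
      by (intro set_prod_subset) auto
    then have "u * i * e * t \<in> I \<star> UNIV" using e(1) S_set_prod[of "inv h" h] hG by auto
    moreover have "u * i * e * t = u * (i * e) * t" by (simp add: mult.assoc)
    ultimately show ?thesis using e(2) by (simp add: mult.assoc)
  qed
  have "add_subgroup {s. u * s \<in> I \<star> UNIV}"
    using add_subgroupD(1,2)[OF hull_subgroup] by (simp add: add_subgroup_def right_diff_distrib)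
  then have "I \<star> UNIV \<subseteq> {s. u * s \<in> I \<star> UNIV}" using base by (intro set_prod_subset) auto
  then show ?thesis using assms(3) by blast
qed

text \<open>The argument works in \<open>I \<star> UNIV\<close>; this recovers the containment in
  \<open>I \<star> grade_sum S N\<close> that a datum demands.\<close>

lemma hull_proj_grade_sum:
  assumes "N \<subseteq> carrier G" "s \<in> I \<star> UNIV"
  shows "proj s N \<in> I \<star> grade_sum S N"
proof -
  have sub: "add_subgroup (I \<star> grade_sum S N)"
    by (rule add_subgroup_set_prod[OF good_pairD(4)[OF good]])
  have "add_subgroup {s. proj s N \<in> I \<star> grade_sum S N}"
    using add_subgroupD(1,2)[OF sub] proj_diff
    by (simp add: add_subgroup_def) (simp add: proj_def supp_def)
  moreover have "proj (i * t) N \<in> I \<star> grade_sum S N" if i: "i \<in> I" for i t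
  proof -
    have "proj (i * t) N = i * proj t N"
      using proj_hom_left[of i \<one> N N t] i good_pairD(3)[OF good] by auto
    moreover have "proj t N \<in> grade_sum S N" using grade_sum_iff[OF assms(1)] supp_proj by auto
    ultimately show ?thesis using i by (auto intro: set_prodI)
  qed
  ultimately have "I \<star> UNIV \<subseteq> {s. proj s N \<in> I \<star> grade_sum S N}" by (intro set_prod_subset) auto
  then show ?thesis using assms(2) by blast
qed

lemma hull_cmp:
  assumes "s \<in> I \<star> UNIV"
  shows "cmp s x \<in> I \<star> UNIV"
proof (cases "x \<in> carrier G")
  case True
  have "add_subgroup {s. cmp s x \<in> I \<star> UNIV}"
    using add_subgroupD(1,2)[OF hull_subgroup] by (simp add: add_subgroup_def cmp_diff)
  moreover have "cmp (i * t) x \<in> I \<star> UNIV" if i: "i \<in> I" for i t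
  proof -
    have "i \<in> S \<one>" using i good_pairD(3)[OF good] by blast
    from cmp_mult_left[OF this one_closed True, of t] show ?thesis using i by (auto intro: set_prodI)
  qed
  ultimately have "I \<star> UNIV \<subseteq> {s. cmp s x \<in> I \<star> UNIV}" by (intro set_prod_subset) auto
  then show ?thesis using assms by blast
qed (simp add: cmp_outside zero_in_set_prod)

lemma hull_proj: "s \<in> I \<star> UNIV \<Longrightarrow> proj s X \<in> I \<star> UNIV"
  unfolding proj_def by (intro add_subgroup_sum hull_subgroup hull_cmp)

lemma hull_degree_one:
  assumes "s \<in> I \<star> UNIV" "s \<in> S \<one>"
  shows "s \<in> I"
proof -
  have "add_subgroup {s. cmp s \<one> \<in> I}"
    using add_subgroupD(1,2)[OF good_pairD(4)[OF good]] by (simp add: add_subgroup_def cmp_diff)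
  moreover have "cmp (i * t) \<one> \<in> I" if "i \<in> I" for i t
    using cmp_mult_left[of i \<one> \<one> t] that good_pairD(3)[OF good] good_pairD(7)[OF good cmp_in that, of t] by auto
  ultimately have "I \<star> UNIV \<subseteq> {s. cmp s \<one> \<in> I}" by (intro set_prod_subset) auto
  then have "cmp s \<one> \<in> I" using assms(1) by blast
  then show ?thesis using cmp_hom[OF assms(2)] by simp
qed

lemma subset_hull:
  assumes "i \<in> I"
  shows "i \<in> I \<star> UNIV"
proof -
  obtain e where "i * e = i" using right_unit[of i \<one>] assms good_pairD(3)[OF good] by blast
  then show ?thesis using set_prodI[of i I e UNIV] assms by simp
qed

end

section \<open>Invariant ideals generated by one element\<close>

text \<open>Allowing \<open>x \<otimes> y\<close> in \<open>N\<close>, and not only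
  \<open>y = inv x\<close>, makes this absorb multiplication by \<open>grade_sum S N\<close> as well
  as conjugation by \<open>H\<close>. For \<open>N = {\<one>}\<close> only the terms with
  \<open>y = inv x\<close> remain.\<close>

definition conj_ideal :: "'g set \<Rightarrow> 'g set \<Rightarrow> 'a \<Rightarrow> 'a set" where
  "conj_ideal H N a = add_span {p * a * q | p q x y. x \<in> H \<and> y \<in> H \<and> x \<otimes> y \<in> N \<and> p \<in> S x \<and> q \<in> S y}"

lemma conj_idealI:
  "x \<in> H \<Longrightarrow> y \<in> H \<Longrightarrow> x \<otimes> y \<in> N \<Longrightarrow> p \<in> S x \<Longrightarrow> q \<in> S y \<Longrightarrow> p * a * q \<in> conj_ideal H N a"
  unfolding conj_ideal_def by (intro add_span_base) blast

lemma conj_ideal_subset: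
  assumes "add_subgroup Z" "\<And>p q x y. x \<in> H \<Longrightarrow> y \<in> H \<Longrightarrow> x \<otimes> y \<in> N \<Longrightarrow> p \<in> S x \<Longrightarrow> q \<in> S y \<Longrightarrow> p * a * q \<in> Z"
  shows "conj_ideal H N a \<subseteq> Z"
  unfolding conj_ideal_def using assms by (intro add_span_subset) auto

text \<open>Normality of \<open>N\<close> gives the degree condition: the product of
  \<open>h\<close>, \<open>x\<close>, \<open>y\<close>, \<open>k\<close> is the conjugate of
  \<open>x \<otimes> y\<close> by \<open>h\<close>, times \<open>h \<otimes> k\<close>.\<close>

lemma conj_ideal_conj:
  assumes H: "subgroup H G" and N: "N \<lhd> G\<lparr>carrier := H\<rparr>"
    and "h \<in> H" "k \<in> H" "h \<otimes> k \<in> N" "u \<in> S h" "v \<in> S k" "b \<in> conj_ideal H N a"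
  shows "u * b * v \<in> conj_ideal H N a"
proof -
  have Hc: "\<And>h. h \<in> H \<Longrightarrow> h \<in> carrier G" using subgroup.mem_carrier[OF H] .
  interpret HG: group "G\<lparr>carrier := H\<rparr>" using subgroup_imp_group[OF H] .
  have sN: "subgroup N (G\<lparr>carrier := H\<rparr>)" using N by (rule normal_imp_subgroup)
  have NH: "N \<subseteq> H" using subgroup.subset[OF sN] by simp
  have sub: "add_subgroup (conj_ideal H N a)" unfolding conj_ideal_def by (rule add_span_subgroup)
  have "add_subgroup {b. u * b * v \<in> conj_ideal H N a}"
    using add_subgroupD(1,2)[OF sub] by (simp add: add_subgroup_def left_diff_distrib right_diff_distrib)
  moreover have "u * (p * a * q) * v \<in> conj_ideal H N a"
    if xy: "x \<in> H" "y \<in> H" "x \<otimes> y \<in> N" "p \<in> S x" "q \<in> S y" for p q x y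
  proof -
    have G: "h \<in> carrier G" "k \<in> carrier G" "x \<in> carrier G" "y \<in> carrier G" using assms xy Hc by auto
    have "h \<otimes> (x \<otimes> y) \<otimes> inv h \<in> N"
      using N assms(3) xy(3) m_inv_consistent[OF H assms(3)] unfolding HG.normal_inv_iff by auto
    then have "(h \<otimes> (x \<otimes> y) \<otimes> inv h) \<otimes> (h \<otimes> k) \<in> N" using subgroup.m_closed[OF sN] assms(5) by auto
    moreover have "(h \<otimes> (x \<otimes> y) \<otimes> inv h) \<otimes> (h \<otimes> k) = (h \<otimes> x) \<otimes> (y \<otimes> k)"
      using G by (simp add: group_simps)
    ultimately have "(u * p) * a * (q * v) \<in> conj_ideal H N a"
      using assms xy G by (intro conj_idealI[of "h \<otimes> x" H "y \<otimes> k"] subgroup.m_closed[OF H] S_mult) auto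
    then show ?thesis by (simp add: mult.assoc)
  qed
  ultimately have "conj_ideal H N a \<subseteq> {b. u * b * v \<in> conj_ideal H N a}"
    by (intro conj_ideal_subset) auto
  then show ?thesis using assms by blast
qed

lemma conj_ideal_invariant:
  assumes H: "subgroup H G" and N: "N \<lhd> G\<lparr>carrier := H\<rparr>"
  shows "invariant G S H (conj_ideal H N a)"
  unfolding invariant_def
proof
  fix h assume h: "h \<in> H"
  have sN: "subgroup N (G\<lparr>carrier := H\<rparr>)" using N by (rule normal_imp_subgroup)
  have "inv h \<otimes> h \<in> N" using subgroup.one_closed[OF sN] subgroup.mem_carrier[OF H h] by simp
  then show "conj_set G S (conj_ideal H N a) h \<subseteq> conj_ideal H N a"
    using conj_ideal_conj[OF H N subgroup.m_inv_closed[OF H h] h]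
    by (intro conj_set_subset) (auto simp: conj_ideal_def add_span_subgroup)
qed

lemma conj_ideal_nonzero:
  assumes "a \<noteq> 0" "\<one> \<in> H" "\<one> \<in> N"
  shows "conj_ideal H N a \<noteq> {0}"
proof -
  obtain p where p: "p \<in> S \<one>" "p * a \<noteq> 0" using nonzero_left[OF assms(1) one_closed] by blast
  obtain q where q: "q \<in> S \<one>" "p * a * q \<noteq> 0" using nonzero_right[OF p(2) one_closed] by blast
  have "p * a * q \<in> conj_ideal H N a" using assms p q by (intro conj_idealI[of \<one> H \<one>]) auto
  then show ?thesis using q by auto
qed

lemma conj_ideal_mult_grade_sum:
  assumes H: "subgroup H G" and N: "N \<lhd> G\<lparr>carrier := H\<rparr>"
    and r: "r \<in> grade_sum S N" and b: "b \<in> conj_ideal H N a"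
  shows "r * b \<in> conj_ideal H N a" "b * r \<in> conj_ideal H N a"
proof -
  have sN: "subgroup N (G\<lparr>carrier := H\<rparr>)" using N by (rule normal_imp_subgroup)
  have NH: "N \<subseteq> H" and NG: "N \<subseteq> carrier G"
    using subgroup.subset[OF sN] subgroup.subset[OF H] by auto
  have Nm: "\<And>x y. x \<in> N \<Longrightarrow> y \<in> N \<Longrightarrow> x \<otimes> y \<in> N" using subgroup.m_closed[OF sN] by simp
  have sub: "add_subgroup (conj_ideal H N a)" unfolding conj_ideal_def by (rule add_span_subgroup)
  have rN: "supp r \<subseteq> N" using r grade_sum_iff[OF NG] by blast
  have hom_left: "c * b \<in> conj_ideal H N a" if c: "c \<in> S n" "n \<in> N" for c n
  proof -
    have "add_subgroup {b. c * b \<in> conj_ideal H N a}"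
      using add_subgroupD(1,2)[OF sub] by (simp add: add_subgroup_def right_diff_distrib)
    moreover have "c * (p * a * q) \<in> conj_ideal H N a"
      if xy: "x \<in> H" "y \<in> H" "x \<otimes> y \<in> N" "p \<in> S x" "q \<in> S y" for p q x y
    proof -
      have G: "n \<in> carrier G" "x \<in> carrier G" "y \<in> carrier G" "n \<in> H"
        using c xy NG NH subgroup.mem_carrier[OF H] by auto
      then have "(n \<otimes> x) \<otimes> y \<in> N" using Nm[OF c(2) xy(3)] by (simp add: m_assoc)
      then have "(c * p) * a * q \<in> conj_ideal H N a"
        using xy G c by (intro conj_idealI[of "n \<otimes> x" H y] subgroup.m_closed[OF H] S_mult)
      then show ?thesis by (simp add: mult.assoc)
    qed
    ultimately have "conj_ideal H N a \<subseteq> {b. c * b \<in> conj_ideal H N a}"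
      by (intro conj_ideal_subset) auto
    then show ?thesis using b by blast
  qed
  have hom_right: "b * c \<in> conj_ideal H N a" if c: "c \<in> S n" "n \<in> N" for c n
  proof -
    have "add_subgroup {b. b * c \<in> conj_ideal H N a}"
      using add_subgroupD(1,2)[OF sub] by (simp add: add_subgroup_def left_diff_distrib)
    moreover have "(p * a * q) * c \<in> conj_ideal H N a"
      if xy: "x \<in> H" "y \<in> H" "x \<otimes> y \<in> N" "p \<in> S x" "q \<in> S y" for p q x y
    proof -
      have G: "n \<in> carrier G" "x \<in> carrier G" "y \<in> carrier G" "n \<in> H"
        using c xy NG NH subgroup.mem_carrier[OF H] by auto
      then have "x \<otimes> (y \<otimes> n) \<in> N" using Nm[OF xy(3) c(2)] by (simp add: m_assoc)
      then have "p * a * (q * c) \<in> conj_ideal H N a"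
        using xy G c by (intro conj_idealI[of x H "y \<otimes> n"] subgroup.m_closed[OF H] S_mult)
      then show ?thesis by (simp add: mult.assoc)
    qed
    ultimately have "conj_ideal H N a \<subseteq> {b. b * c \<in> conj_ideal H N a}"
      by (intro conj_ideal_subset) auto
    then show ?thesis using b by blast
  qed
  have "r * b = (\<Sum>x\<in>supp r. cmp r x * b)"
    by (rule trans[OF arg_cong[OF decomp, of "\<lambda>r. r * b"] sum_distrib_right])
  moreover have "(\<Sum>x\<in>supp r. cmp r x * b) \<in> conj_ideal H N a"
    using rN NG by (intro add_subgroup_sum[OF sub] hom_left[OF cmp_in]) auto
  ultimately show "r * b \<in> conj_ideal H N a" by simp
  have "b * r = (\<Sum>x\<in>supp r. b * cmp r x)"
    by (rule trans[OF arg_cong[OF decomp, of "\<lambda>r. b * r"] sum_distrib_left])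
  moreover have "(\<Sum>x\<in>supp r. b * cmp r x) \<in> conj_ideal H N a"
    using rN NG by (intro add_subgroup_sum[OF sub] hom_right[OF cmp_in]) auto
  ultimately show "b * r \<in> conj_ideal H N a" by simp
qed

text \<open>For \<open>n\<close> in the support of \<open>a\<close>, the degree
  \<open>x \<otimes> n \<otimes> y\<close> is the conjugate of \<open>n\<close> by \<open>x\<close>
  times \<open>x \<otimes> y\<close>, hence in \<open>N\<close>.\<close>

lemma conj_ideal_hull:
  assumes good: "good_pair H I" and N: "N \<lhd> G\<lparr>carrier := H\<rparr>"
    and a: "a \<in> I \<star> UNIV" "supp a \<subseteq> N" and b: "b \<in> conj_ideal H N a"
  shows "b \<in> I \<star> grade_sum S N" "b \<in> grade_sum S N"
proof -
  have H: "subgroup H G" using good_pairD(1)[OF good] .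
  interpret HG: group "G\<lparr>carrier := H\<rparr>" using subgroup_imp_group[OF H] .
  have sN: "subgroup N (G\<lparr>carrier := H\<rparr>)" using N by (rule normal_imp_subgroup)
  have NH: "N \<subseteq> H" and NG: "N \<subseteq> carrier G"
    using subgroup.subset[OF sN] subgroup.subset[OF H] by auto
  have main: "p * a * q \<in> {s \<in> I \<star> UNIV. supp s \<subseteq> N}"
    if xy: "x \<in> H" "y \<in> H" "x \<otimes> y \<in> N" "p \<in> S x" "q \<in> S y" for p q x y
  proof -
    have G: "x \<in> carrier G" "y \<in> carrier G" using xy subgroup.mem_carrier[OF H] by auto
    have "z \<in> N" if z: "z \<in> supp (p * a * q)" for z
    proof -
      obtain n where n: "n \<in> supp a" "z = x \<otimes> n \<otimes> y"
        using subsetD[OF supp_hom_right[OF xy(5) G(2)] z] supp_hom_left[OF xy(4) G(1)] by blast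
      then have nN: "n \<in> N" "n \<in> carrier G" using a NG by auto
      have "x \<otimes> n \<otimes> inv x \<in> N"
        using N xy(1) nN(1) m_inv_consistent[OF H xy(1)] unfolding HG.normal_inv_iff by auto
      then have "(x \<otimes> n \<otimes> inv x) \<otimes> (x \<otimes> y) \<in> N" using subgroup.m_closed[OF sN] xy(3) by auto
      then show ?thesis using G nN n(2) by (simp add: group_simps)
    qed
    moreover have "p * a * q \<in> I \<star> UNIV"
      using hull_right[OF good hull_left[OF good xy(1,4) a(1)]] by blast
    ultimately show ?thesis by blast
  qed
  have "add_subgroup {s \<in> I \<star> UNIV. supp s \<subseteq> N}"
  proof -
    have "supp 0 \<subseteq> N" "\<And>s t. supp s \<subseteq> N \<Longrightarrow> supp t \<subseteq> N \<Longrightarrow> supp (s - t) \<subseteq> N"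
      using supp_diff by (simp add: supp_def, blast)
    then show ?thesis
      using add_subgroupD(1,2)[OF hull_subgroup[OF good]] by (simp add: add_subgroup_def)
  qed
  from conj_ideal_subset[OF this, of H N a] main have "conj_ideal H N a \<subseteq> {s \<in> I \<star> UNIV. supp s \<subseteq> N}" by blast
  then have bN: "b \<in> I \<star> UNIV" "supp b \<subseteq> N" using b by auto
  then show "b \<in> grade_sum S N" using grade_sum_iff[OF NG] by blast
  show "b \<in> I \<star> grade_sum S N" using hull_proj_grade_sum[OF good NG bN(1)] proj_id[OF bN(2)] by simp
qed

text \<open>In a product of generators the inner factors \<open>q\<close> and \<open>p'\<close>
  combine to a homogeneous element between \<open>a\<close> and \<open>c\<close> whose degree lies
  in \<open>H\<close>.\<close>

lemma conj_ideal_mult_zero: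
  assumes H: "subgroup H G" and z: "\<And>h s. h \<in> H \<Longrightarrow> s \<in> S h \<Longrightarrow> a * s * c = 0"
    and b: "b \<in> conj_ideal H N a" "d \<in> conj_ideal H N c"
  shows "b * d = 0"
proof -
  have "p * a * q * (p' * c * q') = 0" if "q \<in> S y" "p' \<in> S x" "y \<in> H" "x \<in> H" for p q p' q' x y
  proof -
    have "q * p' \<in> S (y \<otimes> x)" using that S_mult subgroup.mem_carrier[OF H] by auto
    then have "a * (q * p') * c = 0" using z subgroup.m_closed[OF H] that by blast
    then have "p * (a * (q * p') * c) * q' = 0" by simp
    then show ?thesis by (simp add: mult.assoc)
  qed
  note gen = this
  show ?thesis
  proof (rule add_span_mult_zero[OF _ b[unfolded conj_ideal_def]], elim CollectE exE conjE)
    fix x y p q p' q' x1 y1 x2 y2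
    assume "x = p * a * q" "y = p' * c * q'" "q \<in> S y1" "p' \<in> S x2" "y1 \<in> H" "x2 \<in> H"
    then show "x * y = 0" using gen[of q y1 p' x2 p q'] by simp
  qed
qed

lemma NP_datum_from_elements:
  assumes good: "good_pair H I" and N: "N \<lhd> G\<lparr>carrier := H\<rparr>" "finite N"
    and a: "a \<in> I \<star> UNIV" "supp a \<subseteq> N" "a \<noteq> 0" and c: "c \<in> I \<star> UNIV" "supp c \<subseteq> N" "c \<noteq> 0"
    and z: "\<And>h s. h \<in> H \<Longrightarrow> s \<in> S h \<Longrightarrow> a * s * c = 0"
  shows "NP_datum G S H N I (conj_ideal H N a) (conj_ideal H N c)"
    "invariant G S H (conj_ideal H N a)" "invariant G S H (conj_ideal H N c)"
proof -
  have H: "subgroup H G" using good_pairD(1)[OF good] .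
  have one: "\<one> \<in> H" "\<one> \<in> N"
    using subgroup.one_closed[OF H] subgroup.one_closed[OF normal_imp_subgroup[OF N(1)]] by auto
  have ideal: "ideal_of (conj_ideal H N a) (grade_sum S N)" if "a \<in> I \<star> UNIV" "supp a \<subseteq> N" for a
    unfolding ideal_of_def
    using conj_ideal_hull(2)[OF good N(1) that] conj_ideal_mult_grade_sum[OF H N(1)]
    by (auto simp: conj_ideal_def add_span_subgroup)
  show "NP_datum G S H N I (conj_ideal H N a) (conj_ideal H N c)"
    unfolding NP_datum_def
  proof (intro conjI)
    show "conj_ideal H N a \<star> conj_ideal H N c = {0}"
      unfolding set_prod_eq_zero_iff
    proof (intro ballI)
      fix u v assume uv: "u \<in> conj_ideal H N a" "v \<in> conj_ideal H N c"
      show "u * v = 0" by (rule conj_ideal_mult_zero[OF H _ uv]) (use z in blast)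
    qed
    show "conj_ideal H N a \<subseteq> I \<star> grade_sum S N" "conj_ideal H N c \<subseteq> I \<star> grade_sum S N"
      using conj_ideal_hull(1)[OF good N(1)] a c by auto
    show "ideal_of (conj_ideal H N a) (grade_sum S N)" "ideal_of (conj_ideal H N c) (grade_sum S N)"
      using ideal a c by auto
    show "conj_ideal H N a \<noteq> {0}" "conj_ideal H N c \<noteq> {0}"
      using conj_ideal_nonzero one a c by auto
  qed (use good N in \<open>auto simp: good_pair_def\<close>)
  show "invariant G S H (conj_ideal H N a)" "invariant G S H (conj_ideal H N c)"
    by (rule conj_ideal_invariant[OF H N(1)])+
qed

section \<open>Return sets and passage to subgroups\<close>

definition returns :: "'g set \<Rightarrow> 'a \<Rightarrow> 'g set" where
  "returns H m = {x \<in> H. \<exists>s\<in>S x. m * s * m \<noteq> 0}"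

text \<open>This compensates for \<open>returns H m\<close> not being closed under multiplication.
  With \<open>q = u * m * s\<close> and \<open>s\<close> of degree \<open>x\<close>, a nonzero
  product of \<open>q * m\<close>, \<open>t\<close> and \<open>q * m\<close> contains one
  \<open>m\<close>, \<open>t * q\<close>, \<open>m\<close> of middle degree \<open>z\<close> and
  another \<open>m\<close>, \<open>s * m * t * q\<close>, \<open>m\<close> of middle degree
  \<open>x \<otimes> z\<close>.\<close>

lemma returns_step:
  assumes H: "subgroup H G" and m: "m \<in> S \<one>" and x: "x \<in> returns H m"
  shows "\<exists>q\<in>S \<one>. q * m \<noteq> 0 \<and> returns H (q * m) \<subseteq> {z \<in> returns H m. x \<otimes> z \<in> returns H m}"
proof -
  obtain s where s: "x \<in> H" "s \<in> S x" "m * s * m \<noteq> 0" using x by (auto simp: returns_def)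
  have xG: "x \<in> carrier G" using subgroup.mem_carrier[OF H s(1)] .
  obtain u where u: "u \<in> S (inv x)" "u * (m * s * m) \<noteq> 0" using nonzero_left[OF s(3), of "inv x"] xG by auto
  define q where "q = u * m * s"
  have "u * m * s \<in> S (inv x \<otimes> \<one> \<otimes> x)" using s u m xG by (intro S_mult) auto
  then have q: "q \<in> S \<one>" using xG by (simp add: q_def)
  have "z \<in> returns H m \<and> x \<otimes> z \<in> returns H m" if z: "z \<in> returns H (q * m)" for z
  proof -
    obtain t where t: "z \<in> H" "t \<in> S z" "q * m * t * (q * m) \<noteq> 0" using z by (auto simp: returns_def)
    have zG: "z \<in> carrier G" using subgroup.mem_carrier[OF H t(1)] .
    have "q * m * t * (q * m) = q * (m * (t * q) * m)" by (simp add: mult.assoc)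
    then have "m * (t * q) * m \<noteq> 0" using t(3) by auto
    moreover have "t * q \<in> S z" using S_mult[OF t(2) q zG] zG by simp
    ultimately have 1: "z \<in> returns H m" using t(1) by (auto simp: returns_def)
    have "q * m * t * (q * m) = u * (m * (s * m * t * q) * m)" by (simp add: q_def mult.assoc)
    then have "m * (s * m * t * q) * m \<noteq> 0" using t(3) by auto
    moreover have "s * m * t * q \<in> S (x \<otimes> \<one> \<otimes> z \<otimes> \<one>)" using s m t q xG zG by (intro S_mult) auto
    ultimately have "x \<otimes> z \<in> returns H m"
      using subgroup.m_closed[OF H s(1) t(1)] xG zG by (auto simp: returns_def)
    then show ?thesis using 1 by blast
  qed
  moreover have "q * m \<noteq> 0" using u(2) by (simp add: q_def mult.assoc)
  ultimately show ?thesis using q by blast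
qed

text \<open>For \<open>x\<close> outside \<open>H\<close> the vanishing is inherited from
  \<open>I\<close>. For \<open>x\<close> in \<open>H\<close> outside \<open>K\<close> the inner
  factors of two generators give a middle degree \<open>y \<otimes> x \<otimes> x'\<close> between
  two copies of \<open>m\<close>; it lies in \<open>H\<close> but not in \<open>K\<close>, hence is
  not a return of \<open>m\<close>.\<close>

lemma good_pair_subgroup:
  assumes good: "good_pair H I" and m: "m \<in> I" "m \<noteq> 0"
    and K: "subgroup K G" "K \<subseteq> H" "returns H m \<subseteq> K"
  shows "good_pair K (conj_ideal K {\<one>} m)"
proof (rule good_pairI[OF K(1)])
  have KG: "\<And>x. x \<in> K \<Longrightarrow> x \<in> carrier G" using subgroup.mem_carrier[OF K(1)] .
  have inv_iff: "y = inv x" if "x \<in> K" "y \<in> K" "x \<otimes> y \<in> {\<one>}" for x y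
    using that KG by (metis inv_equality inv_inv inv_closed singletonD)
  interpret KG: group "G\<lparr>carrier := K\<rparr>" using subgroup_imp_group[OF K(1)] .
  have N: "{\<one>} \<lhd> G\<lparr>carrier := K\<rparr>" using KG.one_is_normal by simp
  have gs: "grade_sum S {\<one>} = S \<one>"
  proof (rule Set.set_eqI)
    fix s
    show "s \<in> grade_sum S {\<one>} \<longleftrightarrow> s \<in> S \<one>"
    proof
      assume "s \<in> grade_sum S {\<one>}"
      then have "supp s \<subseteq> {\<one>}" using grade_sum_iff[of "{\<one>}"] by auto
      then have "s = (\<Sum>x\<in>{\<one>}. cmp s x)" by (intro decomp_superset) auto
      then show "s \<in> S \<one>" using cmp_in[OF one_closed, of s] by simp
    next
      assume "s \<in> S \<one>"
      then show "s \<in> grade_sum S {\<one>}" using supp_hom[of s \<one>] grade_sum_iff[of "{\<one>}"] by auto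
    qed
  qed
  have subI: "conj_ideal K {\<one>} m \<subseteq> I"
  proof (rule conj_ideal_subset[OF good_pairD(4)[OF good]])
    fix p q x y assume "x \<in> K" "y \<in> K" "x \<otimes> y \<in> {\<one>}" "p \<in> S x" "q \<in> S y"
    then show "p * m * q \<in> I" using inv_iff[of x y] good_pair_conj[OF good _ _ m(1), of x p q] K(2) by auto
  qed
  show "ideal_of (conj_ideal K {\<one>} m) (S \<one>)"
    unfolding ideal_of_def
    using conj_ideal_mult_grade_sum[OF K(1) N] gs subI good_pairD(3)[OF good]
    by (auto simp: conj_ideal_def add_span_subgroup)
  show "conj_ideal K {\<one>} m \<noteq> {0}"
    using conj_ideal_nonzero[OF m(2)] subgroup.one_closed[OF K(1)] by auto
  show "u * i * v \<in> conj_ideal K {\<one>} m" if "h \<in> K" "u \<in> S h" "i \<in> conj_ideal K {\<one>} m" "v \<in> S (inv h)" for h u i v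
    using conj_ideal_conj[OF K(1) N that(1) subgroup.m_inv_closed[OF K(1) that(1)] _ that(2,4,3)] KG that by auto
  show "i * v * j = 0"
    if x: "x \<in> carrier G" "x \<notin> K" and ij: "i \<in> conj_ideal K {\<one>} m" "v \<in> S x" "j \<in> conj_ideal K {\<one>} m" for x i v j
  proof (cases "x \<in> H")
    case False
    then show ?thesis using good_pair_zero[OF good x(1)] subI ij by blast
  next
    case True
    have gen: "p * m * q * v * (p' * m * q') = 0"
      if "y \<in> K" "x' \<in> K" "q \<in> S y" "p' \<in> S x'" for p q p' q' y x'
    proof -
      have yx: "y \<in> carrier G" "x' \<in> carrier G" using that KG by auto
      have "q * v * p' \<in> S (y \<otimes> x \<otimes> x')" using that ij yx x by (intro S_mult) auto
      moreover have "y \<otimes> x \<otimes> x' \<in> H" using that True K(2) subgroup.m_closed[OF good_pairD(1)[OF good]] by blast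
      moreover have "y \<otimes> x \<otimes> x' \<notin> K"
      proof
        assume a: "y \<otimes> x \<otimes> x' \<in> K"
        have "inv y \<otimes> (y \<otimes> x \<otimes> x') \<otimes> inv x' \<in> K"
          using subgroup.m_closed[OF K(1) subgroup.m_closed[OF K(1) subgroup.m_inv_closed[OF K(1) that(1)] a]
            subgroup.m_inv_closed[OF K(1) that(2)]] .
        moreover have "inv y \<otimes> (y \<otimes> x \<otimes> x') \<otimes> inv x' = x" using x yx by (simp add: m_assoc)
        ultimately show False using x(2) by simp
      qed
      ultimately have "m * (q * v * p') * m = 0" using K(3) unfolding returns_def by blast
      then have "p * (m * (q * v * p') * m) * q' = 0" by simp
      then show ?thesis by (simp add: mult.assoc)
    qed
    \<comment> \<open>The middle factor \<open>v\<close> is absorbed into the second generating set,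
      so that vanishing on generators extends to both spans.\<close>
    define X where "X = {p * m * q | p q x y. x \<in> K \<and> y \<in> K \<and> x \<otimes> y \<in> {\<one>} \<and> p \<in> S x \<and> q \<in> S y}"
    have iX: "i \<in> add_span X" "j \<in> add_span X" using ij by (auto simp: conj_ideal_def X_def)
    have "a * (v * b) = 0" if "a \<in> X" "b \<in> X" for a b
      using that gen unfolding X_def by (auto simp: mult.assoc[symmetric])
    then have "i * b = 0" if "b \<in> (*) v ` X" for b
      using add_span_mult_zero[of X "(*) v ` X" i b] that iX(1) by (auto intro: add_span_base)
    moreover have "v * j \<in> add_span ((*) v ` X)"
      by (rule add_span_mult_left[OF _ iX(2)]) (auto intro: add_span_base)
    ultimately have "i * (v * j) = 0"
      using add_span_mult_zero[of "{i}" "(*) v ` X" i "v * j"] by (auto intro: add_span_base)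
    then show ?thesis by (simp add: mult.assoc)
  qed
qed

section \<open>Coset counts, annihilators and McCoy's argument\<close>

text \<open>A bound on the number of right cosets of \<open>K\<close> that meet the support. The
  representatives in \<open>Q\<close> may be redundant, so covers can be translated without checking
  that cosets stay distinct.\<close>

definition covered :: "'g set \<Rightarrow> nat \<Rightarrow> 'a \<Rightarrow> bool" where
  "covered K n s \<longleftrightarrow> (\<exists>Q. finite Q \<and> card Q \<le> n \<and> Q \<subseteq> carrier G \<and>
     (\<forall>x\<in>supp s. \<exists>k\<in>K. \<exists>q\<in>Q. x = k \<otimes> q))"

lemma ideal_of_UNIV:
  assumes "ideal_of A (UNIV :: 'a set)"
  shows "a \<in> A \<Longrightarrow> r * a \<in> A" "a \<in> A \<Longrightarrow> a * r \<in> A"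
  using assms by (auto simp: ideal_of_def)

lemma supp_mult_hom_middle:
  assumes "z \<in> supp (a * s * b)" "s \<in> S w" "w \<in> carrier G"
  shows "\<exists>x\<in>supp a. \<exists>y\<in>supp b. z = x \<otimes> w \<otimes> y"
proof -
  obtain x' y where "x' \<in> supp (a * s)" "y \<in> supp b" "z = x' \<otimes> y" using supp_mult[OF assms(1)] by blast
  moreover obtain x where "x \<in> supp a" "x' = x \<otimes> w"
    using supp_hom_right[OF assms(2,3), of a] \<open>x' \<in> supp (a * s)\<close> by blast
  ultimately show ?thesis by blast
qed

text \<open>The projections of elements of \<open>A\<close> need not lie in \<open>A\<close>, so
  annihilation is required for all \<open>a\<close> in \<open>A \<inter> (I \<star> UNIV)\<close>
  and all middle degrees in \<open>H\<close> at once; this uniformity makes the set stable under the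
  multiplications of the next lemma.\<close>

definition right_annihilator :: "'a set \<Rightarrow> 'g set \<Rightarrow> 'a set \<Rightarrow> 'a set" where
  "right_annihilator A H I = {c \<in> I \<star> UNIV. supp c \<subseteq> fc_center H \<and>
     (\<forall>a\<in>A \<inter> (I \<star> UNIV). \<forall>h\<in>H. \<forall>s\<in>S h. proj a (almost_centralizer H) * s * c = 0)}"

text \<open>Let \<open>t\<close> have degree \<open>l\<close> and let \<open>x\<close> be in the
  support of \<open>k\<close>. Splitting \<open>s\<close> along
  \<open>h = inv l \<otimes> (l \<otimes> h)\<close> as \<open>v * w\<close> makes
  \<open>t * cmp k x * v\<close> homogeneous of degree \<open>conjg l x\<close> in \<open>D\<close>.
  It can therefore be absorbed into \<open>a\<close> before projecting to \<open>D\<close>, and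
  \<open>w\<close> has degree in \<open>H\<close> again.\<close>

lemma right_annihilator_mult:
  assumes good: "good_pair H I" and A: "ideal_of A (UNIV :: 'a set)" and c: "c \<in> right_annihilator A H I"
    and k: "supp k \<subseteq> fc_center H" and h: "h \<in> H" "s \<in> S h" "u \<in> S (inv h)"
  shows "k * (s * c * u) \<in> right_annihilator A H I"
proof -
  have H: "subgroup H G" and HG: "\<And>h. h \<in> H \<Longrightarrow> h \<in> carrier G"
    using good_pairD(1,2)[OF good] by auto
  have K: "subgroup (fc_center H) G" by (rule fc_center_subgroup[OF H])
  define D where "D = almost_centralizer H"
  have D: "subgroup D G" unfolding D_def by (rule almost_centralizer_subgroup[OF H])
  have hG: "h \<in> carrier G" using h HG by blast
  have cI: "c \<in> I \<star> UNIV" and cs: "supp c \<subseteq> fc_center H"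
    and ann: "\<And>a h s. a \<in> A \<Longrightarrow> a \<in> I \<star> UNIV \<Longrightarrow> h \<in> H \<Longrightarrow> s \<in> S h \<Longrightarrow> proj a D * s * c = 0"
    using c by (auto simp: right_annihilator_def D_def)
  have kx: "x \<in> H" "x \<in> D" "x \<in> carrier G" if "x \<in> supp k" for x
    using that k HG by (auto simp: fc_center_def D_def)
  have k_sum: "k * b = (\<Sum>x\<in>supp k. cmp k x * b)" for b
    by (rule trans[OF arg_cong[OF decomp, of "\<lambda>k. k * b"] sum_distrib_right])
  have "s * c * u \<in> I \<star> UNIV" by (intro hull_right[OF good] hull_left[OF good h(1,2) cI])
  then have "k * (s * c * u) \<in> I \<star> UNIV"
    unfolding k_sum using kx
    by (intro add_subgroup_sum[OF hull_subgroup[OF good] hull_left[OF good _ cmp_in]])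
  moreover have "supp (k * (s * c * u)) \<subseteq> fc_center H"
  proof
    fix z assume "z \<in> supp (k * (s * c * u))"
    then obtain x y' where xy: "x \<in> supp k" "y' \<in> supp (s * c * u)" "z = x \<otimes> y'" using supp_mult by blast
    then obtain y where y: "y \<in> supp (s * c)" "y' = y \<otimes> inv h" using supp_hom_right[OF h(3)] hG by blast
    then obtain v where v: "v \<in> supp c" "y = h \<otimes> v" using supp_hom_left[OF h(2) hG] by blast
    have "conjg h v \<in> fc_center H" using fc_center_conjg[OF H h(1)] v(1) cs by blast
    then show "z \<in> fc_center H" using xy y v k subgroup.m_closed[OF K] by (auto simp: conjg_def)
  qed
  moreover have "proj a D * t * (k * (s * c * u)) = 0"
    if a: "a \<in> A" "a \<in> I \<star> UNIV" and l: "l \<in> H" "t \<in> S l" for a l t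
  proof -
    have lG: "l \<in> carrier G" using l HG by blast
    have hom: "proj a D * t * cmp k x * s * c = 0" if x: "x \<in> supp k" for x
    proof (rule strong_zero[of s "inv l" "l \<otimes> h"])
      have "inv l \<otimes> (l \<otimes> h) = h" using lG hG by simp
      then show "s \<in> S (inv l \<otimes> (l \<otimes> h))" using h(2) by simp
      show "inv l \<in> carrier G" "l \<otimes> h \<in> carrier G" using lG hG by auto
      fix v w assume v: "v \<in> S (inv l)" and w: "w \<in> S (l \<otimes> h)"
      define r where "r = t * cmp k x * v"
      have r: "r \<in> S (conjg l x)"
        unfolding r_def conjg_def using l v lG kx[OF x] by (intro S_mult cmp_in) auto
      have lx: "conjg l x \<in> D" unfolding D_def
        using almost_centralizer_conjg[OF H l(1)] kx(2)[OF x] by (simp add: D_def)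
      have "proj (a * r) D = proj a D * r"
      proof (rule proj_hom_right[OF r])
        show "conjg l x \<in> carrier G" using lG kx[OF x] by simp
        fix z assume "z \<in> carrier G"
        then have "z = z \<otimes> conjg l x \<otimes> inv (conjg l x)" using lG kx[OF x] by (simp add: m_assoc)
        then show "z \<otimes> conjg l x \<in> D \<longleftrightarrow> z \<in> D"
          using subgroup.m_closed[OF D] subgroup.m_inv_closed[OF D] lx by metis
      qed
      then have "proj a D * r * w * c = 0"
        using ann[OF ideal_of_UNIV(2)[OF A a(1)] hull_right[OF good a(2)] subgroup.m_closed[OF H l(1) h(1)] w, of r]
        by simp
      then show "proj a D * t * cmp k x * (v * w) * c = 0" by (simp add: r_def mult.assoc)
    qed
    have "proj a D * t * (k * (s * c * u)) = (\<Sum>x\<in>supp k. proj a D * t * cmp k x * s * c * u)"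
      unfolding k_sum by (simp add: sum_distrib_left mult.assoc)
    then show ?thesis using hom by simp
  qed
  ultimately show ?thesis by (auto simp: right_annihilator_def D_def)
qed

text \<open>McCoy's argument: a leading coefficient times \<open>c\<close> again lies in the right annihilator but needs
  fewer cosets, hence vanishes.\<close>

lemma torsion_components_annihilate:
  assumes good: "good_pair H I" and A: "ideal_of A (UNIV :: 'a set)" and c: "c \<in> right_annihilator A H I"
    and n: "covered (fc_torsion H) n c"
    and min: "\<And>c' n'. c' \<in> right_annihilator A H I \<Longrightarrow> c' \<noteq> 0 \<Longrightarrow> covered (fc_torsion H) n' c' \<Longrightarrow> n \<le> n'"
    and a: "supp a \<subseteq> fc_center H" "\<And>h s. h \<in> H \<Longrightarrow> s \<in> S h \<Longrightarrow> a * s * c = 0"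
    and g: "g \<in> carrier G" and h: "h \<in> H" "s \<in> S h"
  shows "proj a (torsion_coset H g) * s * c = 0"
proof -
  have H: "subgroup H G" and HG: "\<And>h. h \<in> H \<Longrightarrow> h \<in> carrier G"
    using good_pairD(1,2)[OF good] by auto
  define K where "K = fc_center H"
  define T where "T = fc_torsion H"
  have K: "subgroup K G" unfolding K_def by (rule fc_center_subgroup[OF H])
  have T: "subgroup T G" unfolding T_def by (rule fc_torsion_subgroup[OF H])
  have KG: "\<And>x. x \<in> K \<Longrightarrow> x \<in> carrier G" using subgroup.mem_carrier[OF K] .
  have TG: "\<And>x. x \<in> T \<Longrightarrow> x \<in> carrier G" using subgroup.mem_carrier[OF T] .
  have KH: "K \<subseteq> H" by (auto simp: K_def fc_center_def)
  obtain P where P: "positive_cone H P" "\<And>x. x \<in> fc_center H \<Longrightarrow> x \<in> P \<or> inv x \<in> P"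
    using exists_total_cone[OF H] by blast
  have cs: "supp c \<subseteq> K" using c by (auto simp: right_annihilator_def K_def)
  have coset_eq: "torsion_coset H g' = torsion_coset H g"
    if "g' \<in> torsion_coset H g" "g \<in> carrier G" for g g'
  proof -
    have G: "g' \<in> carrier G" "g' \<otimes> inv g \<in> T" using that by (auto simp: torsion_coset_def T_def)
    have "x \<otimes> inv g' \<in> T \<longleftrightarrow> x \<otimes> inv g \<in> T" if x: "x \<in> carrier G" for x
    proof
      assume "x \<otimes> inv g' \<in> T"
      then have "(x \<otimes> inv g') \<otimes> (g' \<otimes> inv g) \<in> T" using G(2) subgroup.m_closed[OF T] by blast
      then show "x \<otimes> inv g \<in> T" using x G(1) \<open>g \<in> carrier G\<close> by (simp add: m_assoc)
    next
      assume "x \<otimes> inv g \<in> T"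
      then have "(x \<otimes> inv g) \<otimes> inv (g' \<otimes> inv g) \<in> T"
        using subgroup.m_closed[OF T] subgroup.m_inv_closed[OF T G(2)] by blast
      then show "x \<otimes> inv g' \<in> T" using x G(1) \<open>g \<in> carrier G\<close> by (simp add: group_simps)
    qed
    then show ?thesis by (auto simp: torsion_coset_def T_def)
  qed
  \<comment> \<open>The induction peels off the maximal torsion coset. Only the support condition
    and the annihilation of \<open>c\<close> are carried along, because the remainder need not be
    the projection of an element of \<open>A\<close>.\<close>
  have "\<forall>g\<in>carrier G. \<forall>h\<in>H. \<forall>s\<in>S h. proj a (torsion_coset H g) * s * c = 0"
    using a
  proof (induction "card (supp a)" arbitrary: a rule: less_induct)
    case less
    show ?case
    proof (cases "supp a = {}")
      case True
      then show ?thesis by (auto simp: proj_def)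
    next
      case False
      then obtain g where g: "g \<in> supp a" "\<And>x. x \<in> supp a \<Longrightarrow> cone_le P x g"
        using cone_max[OF H P finite_supp False less.prems(1)] by blast
      have gK: "g \<in> K" and gG: "g \<in> carrier G" using g(1) less.prems(1) KG by (auto simp: K_def)
      define b where "b = proj a (torsion_coset H g)"
      have sb: "supp b = supp a \<inter> torsion_coset H g" by (simp add: b_def supp_proj)
      have gb: "g \<in> supp b" using g(1) gG subgroup.one_closed[OF T] by (simp add: sb torsion_coset_def T_def)
      have top: "b * s * c = 0" if h: "h \<in> H" "s \<in> S h" for h s
      proof (rule ccontr)
        assume "b * s * c \<noteq> 0"
        have hG: "h \<in> carrier G" using h HG by blast
        \<comment> \<open>Of degree \<open>inv h\<close>, so that the support of \<open>d\<close>
          consists of \<open>H\<close>-conjugates of support elements of \<open>c\<close> and stays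
          in the FC centre.\<close>
        obtain u where u: "u \<in> S (inv h)" "b * s * c * u \<noteq> 0"
          using nonzero_right[OF \<open>b * s * c \<noteq> 0\<close>, of "inv h"] hG by auto
        define d where "d = s * c * u"
        have bd: "b * d \<noteq> 0" using u(2) by (simp add: d_def mult.assoc)
        have bdA: "b * d \<in> right_annihilator A H I"
          unfolding d_def using sb less.prems(1) h u(1)
          by (intro right_annihilator_mult[OF good A c, of b h s u]) auto
        have ad: "a * d = 0"
        proof -
          have "a * d = a * s * c * u" by (simp add: d_def mult.assoc)
          then show ?thesis using less.prems(2)[OF h] by simp
        qed
        have sd: "\<exists>v\<in>supp c. y = conjg h v" if y: "y \<in> supp d" for y
        proof -
          obtain y' where y': "y' \<in> supp (s * c)" "y = y' \<otimes> inv h"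
            using y supp_hom_right[OF u(1)] hG unfolding d_def by blast
          then obtain v where "v \<in> supp c" "y' = h \<otimes> v" using supp_hom_left[OF h(2) hG] by blast
          then show ?thesis using y' by (auto simp: conjg_def)
        qed
        have dK: "supp d \<subseteq> K" using sd fc_center_conjg[OF H h(1)] cs unfolding K_def by blast
        have "d \<noteq> 0" using bd by auto
        then have "supp d \<noteq> {}" using nonzeroE by blast
        then obtain p where p: "p \<in> supp d" "\<And>x. x \<in> supp d \<Longrightarrow> cone_le P x p"
          using cone_max[OF H P finite_supp, of d] dK unfolding K_def by blast
        have pK: "p \<in> K" and pG: "p \<in> carrier G" using p(1) dK KG by auto
        obtain Q where Q: "finite Q" "card Q \<le> n" "Q \<subseteq> carrier G" "\<And>x. x \<in> supp c \<Longrightarrow> \<exists>k\<in>T. \<exists>q\<in>Q. x = k \<otimes> q"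
          using n unfolding covered_def T_def by blast
        have dQ: "\<exists>k\<in>T. \<exists>q\<in>conjg h ` Q. y = k \<otimes> q" if y: "y \<in> supp d" for y
        proof -
          obtain v where v: "v \<in> supp c" "y = conjg h v" using sd[OF y] by blast
          obtain k q where kq: "k \<in> T" "q \<in> Q" "v = k \<otimes> q" using Q(4)[OF v(1)] by blast
          have "y = conjg h k \<otimes> conjg h q" using v kq TG Q(3) hG by (auto simp: conjg_mult)
          moreover have "conjg h k \<in> T" using fc_torsion_conjg[OF H h(1)] kq(1) by (simp add: T_def)
          ultimately show ?thesis using kq(2) by blast
        qed
        obtain kp qp where kp: "kp \<in> T" "qp \<in> conjg h ` Q" "p = kp \<otimes> qp" using dQ[OF p(1)] by blast
        have qG: "q \<in> carrier G" if "q \<in> conjg h ` Q" for q using that Q(3) hG by auto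
        \<comment> \<open>The support of \<open>b\<close> lies in the torsion coset of
          \<open>g\<close> and that of \<open>d\<close> in the cosets of the elements of
          \<open>conjg h\<close> applied to \<open>Q\<close>. Torsion is stable under conjugation by
          \<open>g\<close>, so the products \<open>g \<otimes> q\<close> represent the cosets of
          \<open>b * d\<close>. The one for \<open>qp\<close>, whose coset contains the maximum
          \<open>p\<close>, can be omitted.\<close>
        define Q' where "Q' = (\<lambda>q. g \<otimes> q) ` (conjg h ` Q - {qp})"
        have "covered (fc_torsion H) (n - 1) (b * d)"
          unfolding covered_def
        proof (intro exI[of _ Q'] conjI ballI)
          show "finite Q'" using Q(1) by (simp add: Q'_def)
          have "card Q' \<le> card (conjg h ` Q - {qp})" unfolding Q'_def using Q(1) by (intro card_image_le) auto
          also have "\<dots> = card (conjg h ` Q) - 1" using kp(2) by simp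
          also have "\<dots> \<le> card Q - 1" using card_image_le[OF Q(1)] by (intro diff_le_mono) auto
          finally show "card Q' \<le> n - 1" using Q(2) by simp
          show "Q' \<subseteq> carrier G" using qG gG by (auto simp: Q'_def)
          fix e assume e: "e \<in> supp (b * d)"
          then obtain z z' where z: "z \<in> supp b" "z' \<in> supp d" "e = z \<otimes> z'" using supp_mult by blast
          obtain k' q' where q': "k' \<in> T" "q' \<in> conjg h ` Q" "z' = k' \<otimes> q'" using dQ[OF z(2)] by blast
          have zG: "z \<in> carrier G" "z \<otimes> inv g \<in> T" "z' \<in> carrier G" "z' \<in> K"
            using z sb dK KG by (auto simp: torsion_coset_def T_def)
          have eG: "e \<in> carrier G" using z zG by simp
          have k'G: "k' \<in> carrier G" "q' \<in> carrier G" "qp \<in> carrier G" "kp \<in> carrier G"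
            using q' kp qG TG by auto
          have "q' \<noteq> qp"
          proof
            assume "q' = qp"
            then have "z' \<otimes> inv p = k' \<otimes> inv kp" using q'(3) kp(3) k'G by (simp add: group_simps)
            then have "z' \<otimes> inv p \<in> T"
              using subgroup.m_closed[OF T q'(1) subgroup.m_inv_closed[OF T kp(1)]] by simp
            then have "cone_le P p z'" using cone_le_torsion[OF P(1)] by (simp add: T_def)
            then have 1: "cone_le P (g \<otimes> p) (g \<otimes> z')"
              using cone_le_mult_left[OF P(1) _ gG pG] gK zG by (simp add: K_def)
            have "cone_le P g z" using cone_le_torsion[OF P(1)] zG(2) by (simp add: T_def)
            then have "cone_le P (g \<otimes> z') (z \<otimes> z')" using gG zG by (simp add: cone_le_mult_right)
            then have gpe: "cone_le P (g \<otimes> p) e"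
              using cone_le_trans[OF H P(1) _ _ _ 1] gG pG zG z(3) by simp
            \<comment> \<open>In degree \<open>e\<close> only the top coset of \<open>a\<close>
              contributes: if \<open>inv x \<otimes> e\<close> is in the support of
              \<open>d\<close>, then \<open>g \<otimes> p\<close> lies below \<open>e\<close> and
              \<open>e\<close> below \<open>x \<otimes> p\<close>, so \<open>x\<close> lies in the
              coset of \<open>g\<close>. Hence \<open>b * d\<close> and \<open>a * d = 0\<close>
              agree in degree \<open>e\<close>.\<close>
            have "cmp b x * cmp d (inv x \<otimes> e) = cmp a x * cmp d (inv x \<otimes> e)" if x: "x \<in> supp a" for x
            proof (cases "x \<in> torsion_coset H g")
              case True
              then show ?thesis by (simp add: b_def cmp_proj)
            next
              case False
              have xK: "x \<in> K" and xG: "x \<in> carrier G" using x less.prems(1) KG by (auto simp: K_def)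
              have "inv x \<otimes> e \<notin> supp d"
              proof
                assume y: "inv x \<otimes> e \<in> supp d"
                have "cone_le P (x \<otimes> (inv x \<otimes> e)) (x \<otimes> p)"
                  using cone_le_mult_left[OF P(1) _ xG _ pG p(2)[OF y]] xK xG eG by (simp add: K_def)
                then have "cone_le P e (x \<otimes> p)" using xG eG by simp
                then have "cone_le P (g \<otimes> p) (x \<otimes> p)"
                  using cone_le_trans[OF H P(1) _ _ _ gpe] gG pG xG eG by simp
                then have "cone_le P g x" using gG pG xG by (simp add: cone_le_mult_right)
                then have "x \<otimes> inv g \<in> fc_torsion H" using cone_le_antisym[OF P(1) xG gG g(2)[OF x]] by blast
                then show False using False xG by (simp add: torsion_coset_def)
              qed
              then show ?thesis by (simp add: not_in_supp)
            qed
            then have "cmp (b * d) e = cmp (a * d) e"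
              using cmp_mult[OF eG finite_supp _ supp_carrier, of b a d]
                cmp_mult[OF eG finite_supp subset_refl supp_carrier, of a d] sb by (auto intro: sum.cong)
            then show False using ad e by (simp add: supp_def)
          qed
          have "e = (z \<otimes> inv g) \<otimes> conjg g k' \<otimes> (g \<otimes> q')"
            using z(3) q'(3) zG k'G gG by (simp add: conjg_def group_simps)
          moreover have "(z \<otimes> inv g) \<otimes> conjg g k' \<in> T"
            using subgroup.m_closed[OF T zG(2)] fc_torsion_conjg[OF H, of g k'] gK KH q'(1) by (auto simp: T_def)
          ultimately show "\<exists>k\<in>fc_torsion H. \<exists>q\<in>Q'. e = k \<otimes> q"
            using q'(2) \<open>q' \<noteq> qp\<close> unfolding Q'_def T_def by blast
        qed
        then have "n \<le> n - 1" using min[OF bdA bd] by blast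
        \<comment> \<open>Since subtraction is truncated, the contradiction needs
          \<open>n > 0\<close>.\<close>
        moreover have "Q \<noteq> {}" using kp(2) by blast
        then have "n > 0" using Q(1,2) card_gt_0_iff[of Q] by force
        ultimately show False by simp
      qed
      define a' where "a' = a - b"
      have sa': "supp a' = supp a - torsion_coset H g"
        by (auto simp: a'_def b_def supp_def cmp_diff cmp_proj)
      have "card (supp a') < card (supp a)"
        using gb sb by (intro psubset_card_mono) (auto simp: sa')
      moreover have "supp a' \<subseteq> fc_center H" using sa' less.prems(1) by blast
      moreover have "a' * s * c = 0" if "h \<in> H" "s \<in> S h" for h s
        using top[OF that] less.prems(2)[OF that] by (simp add: a'_def left_diff_distrib)
      ultimately have IH: "\<forall>g\<in>carrier G. \<forall>h\<in>H. \<forall>s\<in>S h. proj a' (torsion_coset H g) * s * c = 0"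
        by (rule less.hyps)
      show ?thesis
      proof (intro ballI)
        fix g' h s assume 1: "g' \<in> carrier G" "h \<in> H" "s \<in> S h"
        show "proj a (torsion_coset H g') * s * c = 0"
        proof (cases "torsion_coset H g' = torsion_coset H g")
          case True
          then show ?thesis using top 1 by (simp add: b_def)
        next
          case False
          have disj: "x \<notin> torsion_coset H g" if "x \<in> torsion_coset H g'" for x
            using coset_eq[OF that 1(1)] coset_eq[of x g] gG False by metis
          have "proj a (torsion_coset H g') = proj a' (torsion_coset H g')"
            by (rule eqI) (auto simp: cmp_proj a'_def b_def cmp_diff dest: disj)
          then show ?thesis using IH 1 by simp
        qed
      qed
    qed
  qed
  then show ?thesis using g h by blast
qed

lemma covered_self:
  assumes "\<one> \<in> K"
  shows "covered K (card (supp s)) s"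
  unfolding covered_def
proof (intro exI[of _ "supp s"] conjI ballI supp_carrier)
  fix x assume x: "x \<in> supp s"
  then have "x = \<one> \<otimes> x" using supp_carrier[of s] by auto
  then show "\<exists>k\<in>K. \<exists>q\<in>supp s. x = k \<otimes> q" using assms x by blast
qed simp_all

lemma good_pair_whole:
  assumes "(UNIV :: 'a set) \<noteq> {0}"
  shows "good_pair (carrier G) (S \<one>)"
proof (rule good_pairI)
  show "subgroup (carrier G) G" by (rule subgroup_self)
  show "ideal_of (S \<one>) (S \<one>)"
    using S_subgroup[OF one_closed] S_mult[of _ \<one> _ \<one>] by (auto simp: ideal_of_def)
  show "S \<one> \<noteq> {0}"
  proof
    assume z: "S \<one> = {0}"
    obtain a :: 'a where "a \<noteq> 0" using assms by blast
    then show False using nonzero_left[of a \<one>] z by auto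
  qed
  show "u * i * v \<in> S \<one>" if "h \<in> carrier G" "u \<in> S h" "i \<in> S \<one>" "v \<in> S (inv h)" for h u i v
    using S_mult[OF S_mult[OF that(2,3)] that(4)] that(1) by simp
qed auto

section \<open>From a datum to ideals with product zero\<close>

text \<open>It suffices to show \<open>a * w * b = 0\<close> for homogeneous \<open>w\<close> of
  degree \<open>x\<close>. For \<open>x\<close> in \<open>H\<close>, a left factor of degree
  \<open>inv x\<close> conjugates \<open>a\<close> into \<open>A\<close>, whose product with
  \<open>B\<close> is zero. For \<open>x\<close> outside \<open>H\<close>, the degrees
  \<open>n \<otimes> x\<close> with \<open>n\<close> in \<open>N\<close> also lie outside
  \<open>H\<close>, and there two elements of \<open>I\<close> annihilate.\<close>

lemma not_prime_if_datum:
  assumes datum: "NP_datum G S H N I A B" and A: "invariant G S H A"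
  shows "\<not> prime_ring (UNIV :: 'a set)"
proof
  assume prime: "prime_ring (UNIV :: 'a set)"
  have good: "good_pair H I" using datum by (simp add: NP_datum_def good_pair_def)
  have H: "subgroup H G" and HG: "\<And>h. h \<in> H \<Longrightarrow> h \<in> carrier G"
    using good_pairD(1,2)[OF good] by auto
  have NH: "N \<subseteq> H"
    using datum subgroup.subset[OF normal_imp_subgroup[of N "G\<lparr>carrier := H\<rparr>"]] by (auto simp: NP_datum_def)
  have NG: "N \<subseteq> carrier G" using NH HG by blast
  have AI: "A \<subseteq> I \<star> grade_sum S N" "B \<subseteq> I \<star> grade_sum S N" and ne: "A \<noteq> {0}" "B \<noteq> {0}"
    and AB: "A \<star> B = {0}" and subs: "add_subgroup A" "add_subgroup B"
    using datum by (auto simp: NP_datum_def ideal_of_def)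
  have hom: "a * w * b = 0" if a: "a \<in> A" and b: "b \<in> B" and x: "x \<in> carrier G" "w \<in> S x" for a b w x
  proof (cases "x \<in> H")
    case True
    show ?thesis
    proof (rule ccontr)
      assume "a * w * b \<noteq> 0"
      then obtain v where v: "v \<in> S (inv x)" "v * (a * w * b) \<noteq> 0"
        using nonzero_left[of "a * w * b" "inv x"] x(1) by auto
      have "v * a * w \<in> A" using conj_setI[of v x a A w] v(1) a x(2) A True by (auto simp: invariant_def)
      then have "v * a * w * b = 0" using AB b unfolding set_prod_eq_zero_iff by blast
      then show False using v(2) by (simp add: mult.assoc)
    qed
  next
    case False
    have gen: "i * s * w * (j * t) = 0" if i: "i \<in> I" and s: "s \<in> grade_sum S N" and j: "j \<in> I" for i s j t
    proof -
      have "cmp s n * w \<in> S (n \<otimes> x) \<and> n \<otimes> x \<in> carrier G \<and> n \<otimes> x \<notin> H" if n: "n \<in> supp s" for n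
      proof (intro conjI)
        have nN: "n \<in> N" using n s grade_sum_iff[OF NG] by blast
        then have nH: "n \<in> H" "n \<in> carrier G" using NH HG by auto
        show "cmp s n * w \<in> S (n \<otimes> x)" using S_mult[OF cmp_in x(2)] nH x(1) by simp
        show "n \<otimes> x \<in> carrier G" using nH x(1) by simp
        show "n \<otimes> x \<notin> H"
        proof
          assume "n \<otimes> x \<in> H"
          then have "inv n \<otimes> (n \<otimes> x) \<in> H" using subgroup.m_closed[OF H subgroup.m_inv_closed[OF H nH(1)]] by blast
          then show False using False nH x(1) by simp
        qed
      qed
      then have z: "i * (cmp s n * w) * j = 0" if "n \<in> supp s" for n
        using good_pair_zero[OF good _ _ i _ j] that by blast
      have "s * (w * (j * t)) = (\<Sum>n\<in>supp s. cmp s n * (w * (j * t)))"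
        by (rule trans[OF arg_cong[OF decomp, of "\<lambda>s. s * (w * (j * t))"] sum_distrib_right])
      then have "i * s * w * (j * t) = (\<Sum>n\<in>supp s. i * (cmp s n * w) * j * t)"
        by (simp add: sum_distrib_left mult.assoc)
      then show ?thesis using z by simp
    qed
    have "add_subgroup {b. c * w * b = 0}" for c :: 'a by (simp add: add_subgroup_def right_diff_distrib)
    then have "I \<star> grade_sum S N \<subseteq> {b. i * s * w * b = 0}" if "i \<in> I" "s \<in> grade_sum S N" for i s
      by (rule set_prod_subset) (simp add: gen that)
    then have 1: "i * s * w * b = 0" if "i \<in> I" "s \<in> grade_sum S N" for i s
      using that AI(2) b by blast
    have "add_subgroup {a. a * w * b = 0}" by (simp add: add_subgroup_def left_diff_distrib)
    then have "I \<star> grade_sum S N \<subseteq> {a. a * w * b = 0}"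
      by (rule set_prod_subset) (simp add: 1)
    then show ?thesis using a AI(1) by blast
  qed
  have all: "a * w * b = 0" if "a \<in> A" "b \<in> B" for a w b
  proof -
    have "a * w * b = (\<Sum>x\<in>supp w. a * cmp w x * b)"
      by (rule trans[OF arg_cong[OF decomp, of "\<lambda>w. a * w * b"]]) (simp add: sum_distrib_left sum_distrib_right)
    also have "\<dots> = 0" using hom[OF that _ cmp_in] supp_carrier[of w] by (intro sum.neutral) auto
    finally show ?thesis .
  qed
  define J where "J A = add_span {p * a * q | p q a. a \<in> A}" for A :: "'a set"
  have ideal: "ideal_of (J A) UNIV" for A
    unfolding ideal_of_def
  proof (intro conjI ballI)
    show "add_subgroup (J A)" unfolding J_def by (rule add_span_subgroup)
    fix r c assume c: "c \<in> J A"
    show "r * c \<in> J A"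
      unfolding J_def
    proof (rule add_span_mult_left[OF _ c[unfolded J_def]])
      fix x assume "x \<in> {p * a * q |p q a. a \<in> A}"
      then obtain p a q where "x = p * a * q" "a \<in> A" by blast
      then have "r * x = r * p * a * q" "a \<in> A" by (simp_all add: mult.assoc)
      then show "r * x \<in> add_span {p * a * q |p q a. a \<in> A}"
        by (intro add_span_base CollectI exI[of _ "r * p"] exI[of _ q] exI[of _ a] conjI)
    qed
    show "c * r \<in> J A"
      unfolding J_def
    proof (rule add_span_mult_right[OF _ c[unfolded J_def]])
      fix x assume "x \<in> {p * a * q |p q a. a \<in> A}"
      then obtain p a q where "x = p * a * q" "a \<in> A" by blast
      then have "x * r = p * a * (q * r)" "a \<in> A" by (simp_all add: mult.assoc)
      then show "x * r \<in> add_span {p * a * q |p q a. a \<in> A}"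
        by (intro add_span_base CollectI exI[of _ p] exI[of _ "q * r"] exI[of _ a] conjI)
    qed
  qed simp
  have nonzero: "J A \<noteq> {0}" if A: "add_subgroup A" "A \<noteq> {0}" for A
  proof -
    obtain a where a: "a \<in> A" "a \<noteq> 0" using A by (auto simp: add_subgroup_def)
    obtain p where p: "p * a \<noteq> 0" using nonzero_left[OF a(2) one_closed] by blast
    obtain q where q: "p * a * q \<noteq> 0" using nonzero_right[OF p one_closed] by blast
    have "p * a * q \<in> J A" unfolding J_def using a(1) by (intro add_span_base) blast
    then show ?thesis using q by auto
  qed
  have "c * d = 0" if "c \<in> J A" "d \<in> J B" for c d
  proof (rule add_span_mult_zero[OF _ that[unfolded J_def]])
    fix x y assume "x \<in> {p * a * q |p q a. a \<in> A}" "y \<in> {p * a * q |p q a. a \<in> B}"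
    then obtain p a q p' b q' where xy: "x = p * a * q" "a \<in> A" "y = p' * b * q'" "b \<in> B" by blast
    have "x * y = p * (a * (q * p') * b) * q'" by (simp add: xy mult.assoc)
    then show "x * y = 0" using all[OF xy(2,4)] by simp
  qed
  then have "J A \<star> J B = {0}" unfolding set_prod_eq_zero_iff by blast
  moreover have "\<forall>A B. ideal_of A (UNIV :: 'a set) \<and> ideal_of B UNIV \<and> A \<star> B = {0} \<longrightarrow> A = {0} \<or> B = {0}"
    using prime unfolding prime_ring_def by (elim conjE)
  ultimately have "J A = {0} \<or> J B = {0}" using ideal[of A] ideal[of B] by simp
  then show False using nonzero[OF subs(1) ne(1)] nonzero[OF subs(2) ne(2)] by simp
qed

end

section \<open>Strongly graded rings without NP-datum\<close>

locale no_NP_datum = strong_graded_ring G S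
  for G :: "('g, 'm) monoid_scheme" (structure) and S :: "'g \<Rightarrow> 'a::ring set" +
  assumes no_datum: "\<not> (\<exists>H N I A B. NP_datum G S H N I A B \<and> invariant G S H A \<and> invariant G S H B)"
begin

section \<open>Consequences of the absence of a datum\<close>

text \<open>The absence of a datum enters the argument only through this statement: two elements
  with supports in a common finite normal subgroup behave as in a prime ring.\<close>

lemma prime_like:
  assumes "good_pair H I" "N \<lhd> G\<lparr>carrier := H\<rparr>" "finite N"
    and "a \<in> I \<star> UNIV" "supp a \<subseteq> N" "a \<noteq> 0" and "c \<in> I \<star> UNIV" "supp c \<subseteq> N" "c \<noteq> 0"
  shows "\<exists>h\<in>H. \<exists>s\<in>S h. a * s * c \<noteq> 0"
proof (rule ccontr)
  assume "\<not> ?thesis"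
  then have z: "\<And>h s. h \<in> H \<Longrightarrow> s \<in> S h \<Longrightarrow> a * s * c = 0" by blast
  have "NP_datum G S H N I (conj_ideal H N a) (conj_ideal H N c)"
    by (rule NP_datum_from_elements(1)[OF assms]) (use z in blast)
  moreover have "invariant G S H (conj_ideal H N a)" "invariant G S H (conj_ideal H N c)"
    by (rule NP_datum_from_elements(2,3)[OF assms], use z in blast)+
  ultimately show False using no_datum by blast
qed

lemma prime_like_degree_one:
  assumes good: "good_pair H I" and "a \<in> I" "a \<noteq> 0" "c \<in> I" "c \<noteq> 0"
  shows "\<exists>h\<in>H. \<exists>s\<in>S h. a * s * c \<noteq> 0"
proof -
  interpret HG: group "G\<lparr>carrier := H\<rparr>" using subgroup_imp_group[OF good_pairD(1)[OF good]] .
  have N: "{\<one>} \<lhd> G\<lparr>carrier := H\<rparr>" using HG.one_is_normal by simp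
  have "a \<in> S \<one>" "c \<in> S \<one>" using assms good_pairD(3)[OF good] by auto
  then show ?thesis
    using assms subset_hull[OF good] supp_hom by (intro prime_like[OF good N]) auto
qed

lemma returns_nonempty: "good_pair H I \<Longrightarrow> m \<in> I \<Longrightarrow> m \<noteq> 0 \<Longrightarrow> returns H m \<noteq> {}"
  using prime_like_degree_one[of H I m m] by (auto simp: returns_def)

text \<open>A finite set \<open>f\<close> of pairs stands for the intersection of cosets of centralizers \<open>solutions f\<close>.
  Among all covers of some \<open>returns H m\<close> by finitely many such intersections, take one where the
  smallest cardinality \<open>k\<close> of its members is as large as possible, and then one with as few members of
  cardinality \<open>k\<close> as possible. These members are permuted by \<open>returns H m\<close>.\<close>

lemma returns_in_subgroup:
  assumes good: "good_pair H I" and l: "l \<in> I" "l \<noteq> 0"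
    and fin: "finite Y" "Y \<subseteq> carrier G" "finite V" "finite Z" "Z \<subseteq> almost_centralizer H"
    and ret: "returns H l \<subseteq> {z. \<exists>y\<in>Y. conjg z y \<in> V} \<union> {z. \<exists>g\<in>Z. conjg z g \<noteq> g}"
  shows "\<exists>q K y. q \<in> S \<one> \<and> q * l \<noteq> 0 \<and> subgroup K G \<and> K \<subseteq> H \<and> returns H (q * l) \<subseteq> K \<and>
    y \<in> Y \<and> finite (conj_class K y)"
proof -
  have H: "subgroup H G" and HG: "\<And>h. h \<in> H \<Longrightarrow> h \<in> carrier G"
    using good_pairD(1,2)[OF good] by auto
  have ZG: "Z \<subseteq> carrier G" using fin(5) almost_centralizer_subset by blast
  have retH: "returns H m \<subseteq> H" for m by (auto simp: returns_def)
  define Y' where "Y' = Y \<union> Z"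
  have Y': "finite Y'" "Y' \<subseteq> carrier G" using fin ZG by (auto simp: Y'_def)
  \<comment> \<open>The pair with \<open>y \<in> Y \<or> v \<noteq> y\<close> survives enlarging
    \<open>f\<close>. At the end it is evaluated in a system solved by \<open>\<one>\<close>, where
    all pairs have \<open>v = y\<close>, and so it delivers an element of \<open>Y\<close>.\<close>
  define valid where "valid m \<F> \<longleftrightarrow> (\<exists>q\<in>S \<one>. m = q * l) \<and> m \<noteq> 0 \<and> finite \<F> \<and>
      returns H m \<subseteq> (\<Union>f\<in>\<F>. solutions f) \<and>
      (\<forall>f\<in>\<F>. finite f \<and> f \<subseteq> Y' \<times> carrier G \<and> (\<exists>(y, v)\<in>f. y \<in> Y \<or> v \<noteq> y) \<and>
        solutions f \<inter> returns H m \<noteq> {})" for m \<F>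
  have validI: "m \<in> I" "m \<noteq> 0" if "valid m \<F>" for m \<F>
    using that l good_pairD(6)[OF good] by (auto simp: valid_def)
  have valid_ne: "returns H m \<noteq> {}" if "valid m \<F>" for m \<F>
    using returns_nonempty[OF good validI[OF that]] .
  have valid0: "\<exists>\<F>. valid l \<F>"
  proof -
    \<comment> \<open>One equation per member. The second kind records how \<open>z\<close> moves
      some \<open>g\<close> in \<open>Z\<close>; there are finitely many because elements of
      \<open>Z\<close> have finite \<open>H\<close>-classes.\<close>
    define \<G> where "\<G> = (\<lambda>p. {p}) ` (Y \<times> (V \<inter> carrier G)) \<union>
        (\<lambda>p. {p}) ` {p \<in> (SIGMA g:Z. conj_class H g). snd p \<noteq> fst p}"
    define \<F> where "\<F> = {f \<in> \<G>. solutions f \<inter> returns H l \<noteq> {}}"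
    have "finite (SIGMA g:Z. conj_class H g)"
      using fin by (auto simp: almost_centralizer_def)
    then have "finite \<G>" using fin by (auto simp: \<G>_def)
    moreover have "\<exists>q\<in>S \<one>. l = q * l" using left_unit[of l \<one>] l(1) good_pairD(3)[OF good] by (metis one_closed subsetD)
    moreover have "returns H l \<subseteq> (\<Union>f\<in>\<F>. solutions f)"
    proof
      fix z assume z: "z \<in> returns H l"
      then have zH: "z \<in> H" using retH by blast
      have "\<exists>f\<in>\<G>. z \<in> solutions f"
      proof (cases "\<exists>y\<in>Y. conjg z y \<in> V")
        case True
        then obtain y where "y \<in> Y" "conjg z y \<in> V" by blast
        then have "{(y, conjg z y)} \<in> \<G>" using fin(2) HG[OF zH] by (auto simp: \<G>_def)
        then show ?thesis by (intro bexI[of _ "{(y, conjg z y)}"]) (auto simp: solutions_def)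
      next
        case False
        then obtain g where "g \<in> Z" "conjg z g \<noteq> g" using ret z by blast
        then have "{(g, conjg z g)} \<in> \<G>" using zH by (auto simp: \<G>_def conj_class_def)
        then show ?thesis by (intro bexI[of _ "{(g, conjg z g)}"]) (auto simp: solutions_def)
      qed
      then show "z \<in> (\<Union>f\<in>\<F>. solutions f)" using z by (auto simp: \<F>_def)
    qed
    moreover have "finite f \<and> f \<subseteq> Y' \<times> carrier G \<and> (\<exists>(y, v)\<in>f. y \<in> Y \<or> v \<noteq> y)" if "f \<in> \<G>" for f
      using that ZG HG by (auto simp: \<G>_def Y'_def conj_class_def)
    ultimately have "valid l \<F>" using l(2) unfolding valid_def \<F>_def by auto
    then show ?thesis by blast
  qed
  define P where "P k \<longleftrightarrow> (\<exists>m \<F>. valid m \<F> \<and> (\<forall>f\<in>\<F>. k \<le> card f))" for k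
  \<comment> \<open>A return set is nonempty, so some member of the cover is solvable and has at
    most \<open>card Y'\<close> equations. This makes a largest \<open>k\<close> exist.\<close>
  have "k < Suc (card Y')" if k: "P k" for k
  proof -
    obtain m \<F> where m: "valid m \<F>" "\<forall>f\<in>\<F>. k \<le> card f" using k unfolding P_def by blast
    obtain z where "z \<in> returns H m" using valid_ne[OF m(1)] by blast
    then obtain f where f: "f \<in> \<F>" "z \<in> solutions f" using m(1) by (auto simp: valid_def)
    moreover have "f \<subseteq> Y' \<times> UNIV" using m(1) f(1) by (auto simp: valid_def)
    ultimately have "card f \<le> card Y'" using card_le_of_solution[of z f Y'] Y'(1) by blast
    then show ?thesis using m(2) f(1) by fastforce
  qed
  moreover have "P 0" using valid0 by (auto simp: P_def)
  ultimately obtain k where k: "P k" "\<And>k'. P k' \<Longrightarrow> k' \<le> k"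
    using ex_has_greatest_nat[of P 0 "\<lambda>k. k" "Suc (card Y')"] by blast
  define R where "R n \<longleftrightarrow> (\<exists>m \<F>. valid m \<F> \<and> (\<forall>f\<in>\<F>. k \<le> card f) \<and> card {f \<in> \<F>. card f = k} = n)" for n
  have "\<exists>n. R n" using k(1) by (auto simp: P_def R_def)
  then obtain n where n: "R n" "\<And>n'. R n' \<Longrightarrow> n \<le> n'"
    by (metis LeastI Least_le)
  then obtain m \<F> where m: "valid m \<F>" "\<forall>f\<in>\<F>. k \<le> card f" "card {f \<in> \<F>. card f = k} = n"
    by (auto simp: R_def)
  define E where "E = {f \<in> \<F>. card f = k}"
  have EF: "E \<subseteq> \<F>" by (auto simp: E_def)
  have \<F>: "finite f" "f \<subseteq> Y' \<times> carrier G" "\<exists>(y, v)\<in>f. y \<in> Y \<or> v \<noteq> y" if "f \<in> \<F>" for f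
    using m(1) that unfolding valid_def by blast+
  have cov: "returns H m \<subseteq> (\<Union>f\<in>\<F>. solutions f)"
    using m(1)[unfolded valid_def] by (elim conjE)
  have sol: "solutions f \<inter> returns H m \<noteq> {}" if "f \<in> \<F>" for f
    using m(1)[unfolded valid_def] that by simp
  have FG: "f \<subseteq> carrier G \<times> carrier G" "f \<subseteq> UNIV \<times> carrier G" if "f \<in> \<F>" for f
    using \<F>(2)[OF that] Y'(2) by auto
  have finF: "finite \<F>" using m(1) by (simp add: valid_def)
  have finE: "finite E" using finF EF finite_subset by blast
  have m1: "m \<in> S \<one>" using validI[OF m(1)] good_pairD(3)[OF good] by blast
  have "E \<noteq> {}"
  proof
    assume "E = {}"
    then have "\<forall>f\<in>\<F>. Suc k \<le> card f" using m(2) by (fastforce simp: E_def)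
    then show False using k(2)[of "Suc k"] m(1) by (auto simp: P_def)
  qed
  have stab: "act x ` E = E" if x: "x \<in> returns H m" for x
  proof -
    have xG: "x \<in> carrier G" and xH: "x \<in> H" using x retH HG by auto
    obtain q where q: "q \<in> S \<one>" "q * m \<noteq> 0" "returns H (q * m) \<subseteq> {z \<in> returns H m. x \<otimes> z \<in> returns H m}"
      using returns_step[OF H m1 x] by blast
    \<comment> \<open>The returns of \<open>q * m\<close> lie in the intersection of the return set
      of \<open>m\<close> with its translate by \<open>inv x\<close>, so they are covered by
      pairwise intersections of members of the old cover and of its translate. Members without a
      solution among the returns are dropped to keep the family valid.\<close>
    define \<F>1 where "\<F>1 = {h. (\<exists>f\<in>\<F>. \<exists>g\<in>\<F>. h = f \<union> act (inv x) g) \<and> solutions h \<inter> returns H (q * m) \<noteq> {}}"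
    have "\<F>1 \<subseteq> (\<lambda>(f, g). f \<union> act (inv x) g) ` (\<F> \<times> \<F>)" by (auto simp: \<F>1_def)
    then have fin1: "finite \<F>1" using finF finite_subset by blast
    have valid1: "valid (q * m) \<F>1"
      unfolding valid_def
    proof (intro conjI ballI)
      obtain q' where "q' \<in> S \<one>" "m = q' * l" using m(1) by (auto simp: valid_def)
      then show "\<exists>q'\<in>S \<one>. q * m = q' * l" using S_mult[OF q(1), of q' \<one>]
        by (intro bexI[of _ "q * q'"]) (auto simp: mult.assoc)
      show "q * m \<noteq> 0" by (rule q(2))
      show "finite \<F>1" by (rule fin1)
      show "returns H (q * m) \<subseteq> (\<Union>f\<in>\<F>1. solutions f)"
      proof
        fix z assume z: "z \<in> returns H (q * m)"
        then have z': "z \<in> returns H m" "x \<otimes> z \<in> returns H m" using q(3) by auto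
        have zG: "z \<in> carrier G" using z retH HG by blast
        obtain f g where fg: "f \<in> \<F>" "g \<in> \<F>" "z \<in> solutions f" "x \<otimes> z \<in> solutions g"
          using z' cov by blast
        have "z \<in> solutions (f \<union> act (inv x) g)"
          using solutions_union[OF fg(3) solutions_act[OF FG(1)[OF fg(2)] xG zG fg(4)]] .
        then show "z \<in> (\<Union>f\<in>\<F>1. solutions f)" using fg z unfolding \<F>1_def by blast
      qed
      fix h assume "h \<in> \<F>1"
      then obtain f g where fg: "f \<in> \<F>" "g \<in> \<F>" "h = f \<union> act (inv x) g" "solutions h \<inter> returns H (q * m) \<noteq> {}"
        by (auto simp: \<F>1_def)
      show "finite h" using \<F>(1) fg by (auto simp: act_def)
      show "h \<subseteq> Y' \<times> carrier G" using \<F>(2) fg act_carrier[of g Y' "inv x"] xG by auto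
      show "\<exists>(y, v)\<in>h. y \<in> Y \<or> v \<noteq> y" using \<F>(3)[OF fg(1)] fg(3) by blast
      show "solutions h \<inter> returns H (q * m) \<noteq> {}" by (rule fg(4))
    qed
    define E1 where "E1 = {h \<in> \<F>1. card h = k}"
    \<comment> \<open>If the union of \<open>f\<close> and the translate of \<open>g\<close> has
      only \<open>k\<close> equations, both parts, having at least \<open>k\<close>, equal it.
      Minimality of \<open>n\<close> then forces \<open>E1 = E\<close>.\<close>
    have E1: "h \<in> E \<and> h \<in> act (inv x) ` E" if hE: "h \<in> E1" for h
    proof -
      obtain f g where fg: "f \<in> \<F>" "g \<in> \<F>" "h = f \<union> act (inv x) g" "card h = k"
        using hE by (auto simp: E1_def \<F>1_def)
      have finh: "finite h" using \<F>(1) fg by (auto simp: act_def)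
      have cg: "card (act (inv x) g) = card g" using card_act[OF FG(2)[OF fg(2)]] xG by simp
      have "f = h" using finh fg m(2) by (intro card_seteq) auto
      moreover have "act (inv x) g = h" using finh fg m(2) cg by (intro card_seteq) auto
      ultimately show ?thesis using fg cg unfolding E_def by force
    qed
    have "R (card E1)"
      unfolding R_def
    proof (intro exI[of _ "q * m"] exI[of _ "\<F>1"] conjI ballI)
      show "valid (q * m) \<F>1" by (rule valid1)
    next
      fix h assume "h \<in> \<F>1"
      then obtain f g where fg: "f \<in> \<F>" "g \<in> \<F>" "h = f \<union> act (inv x) g" by (auto simp: \<F>1_def)
      then have "card f \<le> card h" using \<F>(1) by (intro card_mono) (auto simp: act_def)
      then show "k \<le> card h" using m(2) fg by fastforce
    qed (simp add: E1_def)
    then have "card E \<le> card E1" using n(2) m(3) by (simp add: E_def)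
    then have "E1 = E" using finE E1 by (intro card_seteq) auto
    then have "E \<subseteq> act (inv x) ` E" using E1 by blast
    then have Ei: "E = act (inv x) ` E" using card_image_le[OF finE] finE by (intro card_seteq) auto
    have "act x ` E = act x ` (act (inv x) ` E)" using Ei by simp
    also have "\<dots> = (\<lambda>f. f) ` E"
      unfolding image_image
    proof (rule image_cong)
      fix f assume "f \<in> E"
      then have "f \<subseteq> UNIV \<times> carrier G" using FG(2) EF by blast
      then show "act x (act (inv x) f) = f" using xG by (simp add: act_act act_one)
    qed simp
    also have "\<dots> = E" by simp
    finally show ?thesis .
  qed
  define K where "K = {x \<in> H. act x ` E = E}"
  have EG: "f \<subseteq> UNIV \<times> carrier G" if "f \<in> E" for f using that EF FG by blast
  have act2: "act (x \<otimes> y) ` E = act x ` (act y ` E)" if "x \<in> H" "y \<in> H" for x y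
    unfolding image_image using act_act[OF EG] HG that by (auto intro!: image_cong)
  have act1: "act \<one> ` E = E" using act_one[OF EG] by force
  have K: "subgroup K G"
  proof (rule subgroupI)
    show "K \<subseteq> carrier G" using HG by (auto simp: K_def)
    show "K \<noteq> {}" using act1 subgroup.one_closed[OF H] by (auto simp: K_def)
    fix a assume a: "a \<in> K"
    then have aH: "a \<in> H" "act a ` E = E" by (auto simp: K_def)
    have "act (inv a) ` E = act (inv a \<otimes> a) ` E"
      using act2[OF subgroup.m_inv_closed[OF H aH(1)] aH(1)] aH by simp
    then show "inv a \<in> K" using act1 HG aH subgroup.m_inv_closed[OF H aH(1)] by (simp add: K_def)
    fix b assume "b \<in> K"
    then show "a \<otimes> b \<in> K" using act2 aH subgroup.m_closed[OF H] by (auto simp: K_def)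
  qed
  have KH: "K \<subseteq> H" and retK: "returns H m \<subseteq> K" using stab retH[of m] by (auto simp: K_def)
  obtain f where f: "f \<in> E" using \<open>E \<noteq> {}\<close> by blast
  then have "solutions f \<inter> returns H m \<noteq> {}" using sol EF by blast
  then obtain z where z: "z \<in> solutions f" "z \<in> returns H m" by blast
  have zK: "z \<in> K" and zG: "z \<in> carrier G" using z retK KH HG by auto
  \<comment> \<open>Translating \<open>f\<close> by \<open>inv z\<close>, where \<open>z\<close>
    solves it, gives another member of \<open>E\<close>, and this one is solved by
    \<open>\<one>\<close>.\<close>
  have "inv z \<in> K" using subgroup.m_inv_closed[OF K zK] .
  then have fE: "act (inv z) f \<in> E" using f unfolding K_def by blast
  obtain y v where yv: "(y, v) \<in> act (inv z) f" "y \<in> Y \<or> v \<noteq> y" using \<F>(3) fE EF by blast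
  have "v = y"
  proof -
    obtain v' where v': "(y, v') \<in> f" "v = conjg (inv z) v'" using yv(1) by (auto simp: act_def)
    have "y \<in> carrier G" using v'(1) FG(1) f EF by blast
    moreover have "v' = conjg z y" using z(1) v'(1) by (auto simp: solutions_def)
    ultimately show ?thesis using v'(2) zG by simp
  qed
  then have y: "y \<in> Y" "(y, y) \<in> act (inv z) f" using yv by auto
  \<comment> \<open>\<open>K\<close> permutes \<open>E\<close>, so every \<open>h\<close> in
    \<open>K\<close> carries the pair \<open>(y, y)\<close> to \<open>(y, conjg h y)\<close> in some
    member of the finite family \<open>E\<close>.\<close>
  have "conj_class K y \<subseteq> snd ` (\<Union>E)"
  proof
    fix w assume "w \<in> conj_class K y"
    then obtain h where h: "h \<in> K" "w = conjg h y" by (auto simp: conj_class_def)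
    then have "(y, w) \<in> act h (act (inv z) f)" using y(2) by (force simp: act_def)
    moreover have "act h (act (inv z) f) \<in> E" using h(1) fE unfolding K_def by blast
    ultimately show "w \<in> snd ` (\<Union>E)" by force
  qed
  moreover have "finite (snd ` (\<Union>E))" using finE \<F>(1) EF by auto
  ultimately have "finite (conj_class K y)" using finite_subset by blast
  moreover obtain q where "q \<in> S \<one>" "m = q * l" using m(1) by (auto simp: valid_def)
  ultimately show ?thesis using validI(2)[OF m(1)] K KH retK y(1) by blast
qed

section \<open>Thin hit sets and the descent to a smaller subgroup\<close>

definition hits :: "'g set \<Rightarrow> 'a \<Rightarrow> 'a \<Rightarrow> 'g set" where
  "hits H c a = {w \<in> H. \<exists>t\<in>S w. a * t * c \<noteq> 0}"

text \<open>The elements \<open>w\<close> with \<open>conjg w y = v\<close> form a coset of the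
  centralizer of \<open>y\<close>, if there are any. The last clause thus confines the hit set to
  finitely many such cosets with \<open>y\<close> in \<open>Y\<close>.\<close>

definition candidate :: "'g set \<Rightarrow> 'a set \<Rightarrow> 'g set \<Rightarrow> 'g set \<Rightarrow> 'a \<Rightarrow> 'a \<Rightarrow> bool" where
  "candidate H I Y X c a \<longleftrightarrow> a \<in> I \<star> UNIV \<and> supp a \<subseteq> X \<and> hits H c a \<noteq> {} \<and>
     (\<exists>V. finite V \<and> hits H c a \<subseteq> {w. \<exists>y\<in>Y. conjg w y \<in> V})"

text \<open>For \<open>a\<close> of minimal support, \<open>cmp a g * s * a - a * s * cmp a g\<close> has smaller support, so it
  annihilates \<open>c\<close>.\<close>

lemma minimal_support_commutes:
  assumes good: "good_pair H I" and Y: "Y \<subseteq> carrier G"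
    and a: "candidate H I Y (supp a) c a"
    and min: "\<And>a'. candidate H I Y (supp a) c a' \<Longrightarrow> card (supp a) \<le> card (supp a')"
    and x: "x \<in> H" "\<And>z. z \<in> supp a \<Longrightarrow> conjg x z = z" and g: "g \<in> supp a"
    and s: "s \<in> S (inv g \<otimes> x)" and w: "w \<in> H" and t: "t \<in> S w"
  shows "cmp a g * s * a * t * c = a * (s * cmp a g * t) * c"
proof (rule ccontr)
  assume ne: "\<not> ?thesis"
  have H: "subgroup H G" and HG: "\<And>h. h \<in> H \<Longrightarrow> h \<in> carrier G"
    using good_pairD(1,2)[OF good] by auto
  have xG: "x \<in> carrier G" and gG: "g \<in> carrier G" and wG: "w \<in> carrier G"
    using x(1) w HG g supp_carrier[of a] by auto
  have xg: "x \<otimes> g = g \<otimes> x" using x(2)[OF g] xG gG conjg_eq_iff_commute by blast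
  have aI: "a \<in> I \<star> UNIV" using a by (simp add: candidate_def)
  obtain V where V: "finite V" "hits H c a \<subseteq> {w. \<exists>y\<in>Y. conjg w y \<in> V}" using a by (auto simp: candidate_def)
  define b where "b = cmp a g"
  define d0 where "d0 = b * s * a - a * s * b"
  have b: "b \<in> S g" unfolding b_def by (rule cmp_in[OF gG])
  have bs: "b * s \<in> S x" using S_mult[OF b s] xG gG by simp
  have "s * b \<in> S (inv g \<otimes> x \<otimes> g)" using S_mult[OF s b] xG gG by simp
  moreover have "inv g \<otimes> x \<otimes> g = x" using xg xG gG by (simp add: m_assoc)
  ultimately have sb: "s * b \<in> S x" by simp
  have "d0 * t * c = b * s * a * t * c - a * (s * b * t) * c"
    by (simp add: d0_def left_diff_distrib mult.assoc)
  then have "d0 * t * c \<noteq> 0" using ne by (simp add: b_def)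
  \<comment> \<open>As \<open>x\<close> centralizes the support of \<open>a\<close>, both terms of
    \<open>d0\<close> have a component of degree \<open>x \<otimes> z\<close> built from
    \<open>cmp a z\<close>. They agree for \<open>z = g\<close>, and a factor of degree
    \<open>inv x\<close> moves what is left back into the support of \<open>a\<close>.\<close>
  then obtain u where u: "u \<in> S (inv x)" "u * (d0 * t * c) \<noteq> 0"
    using nonzero_left[of "d0 * t * c" "inv x"] xG by auto
  define d where "d = u * d0"
  have d0I: "d0 \<in> I \<star> UNIV"
    unfolding d0_def b_def mult.assoc
    by (intro add_subgroupD(2)[OF hull_subgroup[OF good]] hull_right[OF good] hull_cmp[OF good] aI)
  have dI: "d \<in> I \<star> UNIV"
    unfolding d_def by (rule hull_left[OF good subgroup.m_inv_closed[OF H x(1)] u(1) d0I])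
  have supp_d: "supp d \<subseteq> supp a - {g}"
  proof -
    have "cmp d z = 0" if z: "z \<in> carrier G" "z \<notin> supp a - {g}" for z
    proof -
      have conj: "cmp a (x \<otimes> z \<otimes> inv x) = cmp a z"
      proof (cases "z \<in> supp a")
        case True
        then show ?thesis using x(2)[OF True] by (simp add: conjg_def)
      next
        case False
        have "conjg x z \<notin> supp a"
        proof
          assume "conjg x z \<in> supp a"
          from x(2)[OF this] have "conjg x z = z" using xG z(1) conjg_inject[of x "conjg x z" z] by simp
          then show False using False \<open>conjg x z \<in> supp a\<close> by simp
        qed
        then show ?thesis using False not_in_supp by (simp add: conjg_def)
      qed
      have "cmp d z = u * cmp d0 (x \<otimes> z)" unfolding d_def using cmp_mult_left[OF u(1)] xG z(1) by simp
      also have "cmp d0 (x \<otimes> z) = b * s * cmp a z - cmp a z * (s * b)"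
      proof -
        have "cmp (b * s * a) (x \<otimes> z) = b * s * cmp a z"
          using cmp_mult_left[OF bs xG, of "x \<otimes> z" a] xG z(1) by simp
        moreover have "cmp (a * (s * b)) (x \<otimes> z) = cmp a z * (s * b)"
          using cmp_mult_right[OF sb xG, of "x \<otimes> z" a] xG z(1) conj by simp
        ultimately show ?thesis by (simp add: d0_def cmp_diff mult.assoc)
      qed
      also have "b * s * cmp a z - cmp a z * (s * b) = 0"
        using z(2) by (cases "z = g") (auto simp: b_def mult.assoc not_in_supp)
      finally show ?thesis by simp
    qed
    then show ?thesis using supp_carrier[of d] by (auto simp: supp_def)
  qed
  have "w \<in> hits H c d" using w t u(2) by (auto simp: hits_def d_def mult.assoc)
  \<comment> \<open>The second term of \<open>d0\<close> contributes hits of \<open>a\<close>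
    translated by \<open>x\<close>, which enlarges the finite set of values by its conjugate under
    \<open>inv x\<close>. Thinness thus survives, and \<open>d\<close> is again a candidate.\<close>
  moreover have "hits H c d \<subseteq> {w. \<exists>y\<in>Y. conjg w y \<in> V \<union> conjg (inv x) ` V}"
  proof
    fix w' assume "w' \<in> hits H c d"
    then obtain t' where t': "w' \<in> H" "t' \<in> S w'" "d * t' * c \<noteq> 0" by (auto simp: hits_def)
    have w'G: "w' \<in> carrier G" using t'(1) HG by blast
    have "d * t' * c = u * b * s * (a * t' * c) - u * (a * (s * b * t') * c)"
      by (simp add: d_def d0_def left_diff_distrib right_diff_distrib mult.assoc)
    then have "a * t' * c \<noteq> 0 \<or> a * (s * b * t') * c \<noteq> 0" using t'(3) by auto
    then show "w' \<in> {w. \<exists>y\<in>Y. conjg w y \<in> V \<union> conjg (inv x) ` V}"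
    proof
      assume "a * t' * c \<noteq> 0"
      then have "w' \<in> hits H c a" using t' by (auto simp: hits_def)
      then show ?thesis using V(2) by blast
    next
      assume "a * (s * b * t') * c \<noteq> 0"
      moreover have "s * b * t' \<in> S (x \<otimes> w')" using S_mult[OF sb t'(2) xG w'G] .
      ultimately have "x \<otimes> w' \<in> hits H c a"
        using subgroup.m_closed[OF H x(1) t'(1)] by (auto simp: hits_def)
      then obtain y where y: "y \<in> Y" "conjg (x \<otimes> w') y \<in> V" using V(2) by blast
      moreover have "conjg w' y = conjg (inv x) (conjg (x \<otimes> w') y)"
        using y(1) Y xG w'G by (auto simp: conjg_conjg[symmetric] subset_iff)
      ultimately show ?thesis by blast
    qed
  qed
  moreover have "finite (V \<union> conjg (inv x) ` V)" using V(1) by simp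
  ultimately have "candidate H I Y (supp a) c d" using dI supp_d unfolding candidate_def by blast
  then have "card (supp a) \<le> card (supp d)" by (rule min)
  moreover have "card (supp d) < card (supp a)"
    using supp_d g by (intro psubset_card_mono) auto
  ultimately show False by simp
qed

text \<open>From \<open>a * t * c \<noteq> 0\<close> one cuts a degree-one element \<open>l\<close>
  of \<open>I\<close>. Thinness of the hits of a minimal \<open>a\<close> becomes thinness of the
  returns of \<open>l\<close>, which is what \<open>returns_in_subgroup\<close> consumes. The final
  inequality records that the new element \<open>m\<close> still does not annihilate
  \<open>c\<close>.\<close>

lemma good_pair_from_hits:
  assumes good: "good_pair H I" and Y: "finite Y" "Y \<subseteq> carrier G"
    and a0: "a0 \<in> I \<star> UNIV" "supp a0 \<subseteq> almost_centralizer H" "hits H c a0 \<noteq> {}"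
    and V0: "finite V0" "hits H c a0 \<subseteq> {w. \<exists>y\<in>Y. conjg w y \<in> V0}"
  shows "\<exists>g w K m y k r r'. g \<in> almost_centralizer H \<and> w \<in> H \<and> subgroup K G \<and> K \<subseteq> H \<and> m \<in> I \<and> m \<noteq> 0 \<and>
    returns H m \<subseteq> K \<and> y \<in> Y \<and> finite (conj_class K (conjg w y)) \<and> k \<in> K \<and> r \<in> S k \<and>
    r' \<in> S (g \<otimes> w) \<and> m * r * r' * c \<noteq> 0"
proof -
  have H: "subgroup H G" and HG: "\<And>h. h \<in> H \<Longrightarrow> h \<in> carrier G"
    using good_pairD(1,2)[OF good] by auto
  define cand where "cand X = candidate H I Y X c" for X
  note cand_def = cand_def candidate_def
  have "cand (supp a0) a0" using a0 V0 by (auto simp: cand_def)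
  then obtain a where a: "cand (supp a0) a" "\<And>a'. cand (supp a0) a' \<Longrightarrow> card (supp a) \<le> card (supp a')"
    using ex_has_least_nat[of "cand (supp a0)" a0 "\<lambda>a. card (supp a)"] by blast
  have ca: "cand (supp a) a" using a(1) by (auto simp: cand_def)
  have cmin: "card (supp a) \<le> card (supp a')" if "cand (supp a) a'" for a'
    using that a by (auto simp: cand_def)
  have Z: "supp a \<subseteq> almost_centralizer H" using a(1) a0(2) by (auto simp: cand_def)
  have aI: "a \<in> I \<star> UNIV" using a(1) by (simp add: cand_def)
  obtain V where V: "finite V" "hits H c a \<subseteq> {w. \<exists>y\<in>Y. conjg w y \<in> V}" using a(1) by (auto simp: cand_def)
  obtain w t where w: "w \<in> H" "t \<in> S w" "a * t * c \<noteq> 0" using a(1) by (auto simp: cand_def hits_def)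
  have wG: "w \<in> carrier G" using w HG by blast
  \<comment> \<open>\<open>l\<close> is one homogeneous component of \<open>\<mu>\<close>, shifted
    to degree \<open>\<one>\<close>. It expands over the support of \<open>a\<close> with
    coefficients \<open>\<rho> g\<close> of degree \<open>inv g\<close>.\<close>
  define \<mu> where "\<mu> = a * t * c"
  obtain f where f: "f \<in> carrier G" "cmp \<mu> f \<noteq> 0" using w(3) nonzeroE unfolding \<mu>_def by blast
  obtain v where v: "v \<in> S (inv f)" "cmp \<mu> f * v \<noteq> 0" using nonzero_right[OF f(2), of "inv f"] f(1) by auto
  define l where "l = cmp \<mu> f * v"
  define \<rho> where "\<rho> g = cmp (t * c) (inv g \<otimes> f) * v" for g
  have lS: "l \<in> S \<one>" using S_mult[OF cmp_in[OF f(1)] v(1) f(1)] f(1) by (simp add: l_def)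
  have "\<mu> \<in> I \<star> UNIV" unfolding \<mu>_def by (intro hull_right[OF good] aI)
  then have "l \<in> I \<star> UNIV" unfolding l_def by (intro hull_right[OF good] hull_cmp[OF good])
  then have lI: "l \<in> I" by (rule hull_degree_one[OF good _ lS])
  have l0: "l \<noteq> 0" using v(2) by (simp add: l_def)
  have suppG: "g \<in> carrier G" if "g \<in> supp a" for g using that supp_carrier[of a] by blast
  have \<rho>: "\<rho> g \<in> S (inv g)" if "g \<in> supp a" for g
  proof -
    have "\<rho> g \<in> S (inv g \<otimes> f \<otimes> inv f)"
      unfolding \<rho>_def using suppG[OF that] f(1) v(1) by (intro S_mult cmp_in) auto
    then show ?thesis using suppG[OF that] f(1) by (simp add: m_assoc)
  qed
  have "\<mu> = a * (t * c)" by (simp add: \<mu>_def mult.assoc)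
  then have "cmp \<mu> f = (\<Sum>g\<in>supp a. cmp a g * cmp (t * c) (inv g \<otimes> f))"
    using cmp_mult[OF f(1) finite_supp subset_refl supp_carrier, of a "t * c"] by simp
  then have l_sum: "l = (\<Sum>g\<in>supp a. cmp a g * \<rho> g)"
    unfolding l_def \<rho>_def by (simp add: sum_distrib_right mult.assoc)
  \<comment> \<open>If a return \<open>x\<close> centralizes the support of \<open>a\<close>, then
    in some term of \<open>l\<close> the component \<open>cmp a g\<close> can be moved to the other
    side of \<open>a\<close> by \<open>minimal_support_commutes\<close>. This makes
    \<open>x \<otimes> w\<close> a hit of \<open>a\<close>, hence restricts how \<open>x\<close>
    conjugates \<open>conjg w y\<close>.\<close>
  have ret: "returns H l \<subseteq> {z. \<exists>y\<in>conjg w ` Y. conjg z y \<in> V} \<union> {z. \<exists>g\<in>supp a. conjg z g \<noteq> g}"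
  proof
    fix x assume "x \<in> returns H l"
    then obtain s' where x: "x \<in> H" "s' \<in> S x" "l * s' * l \<noteq> 0" by (auto simp: returns_def)
    have xG: "x \<in> carrier G" using x HG by blast
    show "x \<in> {z. \<exists>y\<in>conjg w ` Y. conjg z y \<in> V} \<union> {z. \<exists>g\<in>supp a. conjg z g \<noteq> g}"
    proof (cases "\<exists>g\<in>supp a. conjg x g \<noteq> g")
      case False
      have "l * s' * l = (\<Sum>g\<in>supp a. cmp a g * \<rho> g * s' * l)"
        using arg_cong[OF l_sum, of "\<lambda>b. b * s' * l"] by (simp add: sum_distrib_right)
      then have "\<exists>g\<in>supp a. cmp a g * \<rho> g * s' * l \<noteq> 0" using x(3) by (auto dest: sum.not_neutral_contains_not_neutral)
      then obtain g where g: "g \<in> supp a" "cmp a g * \<rho> g * s' * l \<noteq> 0" by blast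
      have gG: "g \<in> carrier G" using suppG[OF g(1)] .
      define s where "s = \<rho> g * s'"
      have s: "s \<in> S (inv g \<otimes> x)" unfolding s_def using S_mult[OF \<rho>[OF g(1)] x(2)] gG xG by simp
      have "cmp a g * s * cmp \<mu> f * v \<noteq> 0" using g(2) by (simp add: s_def l_def mult.assoc)
      then have n1: "cmp a g * s * cmp \<mu> f \<noteq> 0" by auto
      have bs: "cmp a g * s \<in> S x" using S_mult[OF cmp_in[OF gG] s gG] gG xG by simp
      have n2: "cmp a g * s * \<mu> \<noteq> 0" using homogeneous_zero_cmp[OF bs xG] n1 by blast
      have "cmp a g * s * a * t * c = a * (s * cmp a g * t) * c"
        by (rule minimal_support_commutes[OF good Y(2) _ _ x(1) _ g(1) s w(1,2)])
          (use ca cmin False in \<open>auto simp: cand_def\<close>)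
      then have n3: "a * (s * cmp a g * t) * c \<noteq> 0" using n2 by (simp add: \<mu>_def mult.assoc)
      have xg: "x \<otimes> g = g \<otimes> x" using False g(1) conjg_eq_iff_commute[OF xG gG] by blast
      have "s * cmp a g * t \<in> S (inv g \<otimes> x \<otimes> g \<otimes> w)"
        using s gG xG wG w(2) by (intro S_mult cmp_in) auto
      then have "s * cmp a g * t \<in> S (x \<otimes> w)" using xg gG xG wG by (simp add: m_assoc)
      then have "x \<otimes> w \<in> hits H c a"
        using n3 subgroup.m_closed[OF H x(1) w(1)] by (auto simp: hits_def)
      then obtain y where y: "y \<in> Y" "conjg (x \<otimes> w) y \<in> V" using V(2) by blast
      then have "conjg x (conjg w y) \<in> V" using Y(2) xG wG by (simp add: conjg_conjg subset_iff)
      then show ?thesis using y(1) by blast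
    qed blast
  qed
  have "\<exists>q K y. q \<in> S \<one> \<and> q * l \<noteq> 0 \<and> subgroup K G \<and> K \<subseteq> H \<and> returns H (q * l) \<subseteq> K \<and>
    y \<in> conjg w ` Y \<and> finite (conj_class K y)"
    by (rule returns_in_subgroup[OF good lI l0 _ _ V(1) finite_supp Z ret]) (use Y wG in auto)
  then obtain q K y where q: "q \<in> S \<one>" "q * l \<noteq> 0" and K: "subgroup K G" "K \<subseteq> H" "returns H (q * l) \<subseteq> K"
    and y: "y \<in> Y" "finite (conj_class K (conjg w y))" by blast
  have mI: "q * l \<in> I" using good_pairD(6)[OF good q(1) lI] .
  \<comment> \<open>Expanding the second copy of \<open>l\<close> in a nonzero product of
    \<open>q * l\<close>, \<open>r\<close>, \<open>q * l\<close> isolates one component of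
    \<open>a\<close> followed by \<open>t * c\<close>; this produces \<open>r'\<close> of degree
    \<open>g \<otimes> w\<close>.\<close>
  obtain k where "k \<in> returns H (q * l)" using returns_nonempty[OF good mI q(2)] by blast
  then obtain r where k: "k \<in> K" "r \<in> S k" "q * l * r * (q * l) \<noteq> 0" using K(3) by (auto simp: returns_def)
  have kG: "k \<in> carrier G" using k(1) subgroup.mem_carrier[OF K(1)] by blast
  have "q * l * r * (q * l) = (\<Sum>g\<in>supp a. q * l * r * q * (cmp a g * \<rho> g))"
    using arg_cong[OF l_sum, of "\<lambda>b. q * l * r * q * b"] by (simp add: sum_distrib_left mult.assoc)
  then have "\<exists>g\<in>supp a. q * l * r * q * (cmp a g * \<rho> g) \<noteq> 0"
    using k(3) by (auto dest: sum.not_neutral_contains_not_neutral)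
  then obtain g where g: "g \<in> supp a" "q * l * r * q * (cmp a g * \<rho> g) \<noteq> 0" by blast
  have gG: "g \<in> carrier G" using suppG[OF g(1)] .
  have "q * l * r * q * cmp a g * cmp (t * c) (inv g \<otimes> f) * v \<noteq> 0"
    using g(2) by (simp add: \<rho>_def mult.assoc)
  then have n1: "q * l * r * q * cmp a g * cmp (t * c) (inv g \<otimes> f) \<noteq> 0" by auto
  have "q * l * r * q * cmp a g \<in> S (\<one> \<otimes> \<one> \<otimes> k \<otimes> \<one> \<otimes> g)"
    using q lS k kG gG by (intro S_mult cmp_in) auto
  from homogeneous_zero_cmp[OF this] n1 have n2: "q * l * r * q * cmp a g * (t * c) \<noteq> 0"
    using kG gG by auto
  define r' where "r' = q * cmp a g * t"
  have "r' \<in> S (\<one> \<otimes> g \<otimes> w)" unfolding r'_def using q gG wG w(2) by (intro S_mult cmp_in) auto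
  then have r': "r' \<in> S (g \<otimes> w)" using gG by simp
  have "q * l * r * r' * c \<noteq> 0" using n2 by (simp add: r'_def mult.assoc)
  then show ?thesis using g(1) Z w(1) K mI q(2) y k(1,2) r' by blast
qed

text \<open>At a degree \<open>g \<otimes> w \<otimes> d\<close> of the product of the
  \<open>D\<close>-parts, the vanishing of \<open>a * s * b\<close> requires another contribution
  \<open>g' \<otimes> w \<otimes> d'\<close>. Here \<open>d'\<close> is not in \<open>D\<close>, as
  otherwise \<open>g'\<close> would be too. Hence \<open>conjg w d'\<close> is
  \<open>inv g' \<otimes> g \<otimes> conjg w d\<close>, with finitely many values since
  \<open>d\<close> has a finite class.\<close>

lemma hits_thin:
  fixes a b :: 'a and H
  defines "D \<equiv> almost_centralizer H"
  assumes H: "subgroup H G" and zero: "\<And>s. a * s * b = 0"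
  shows "\<exists>V. finite V \<and> hits H (proj b D) (proj a D) \<subseteq> {w. \<exists>y\<in>supp b - D. conjg w y \<in> V}"
proof -
  have D: "subgroup D G" unfolding D_def by (rule almost_centralizer_subgroup[OF H])
  have HG: "\<And>h. h \<in> H \<Longrightarrow> h \<in> carrier G" using subgroup.mem_carrier[OF H] .
  have DG: "\<And>d. d \<in> D \<Longrightarrow> d \<in> carrier G" using subgroup.mem_carrier[OF D] .
  define V where "V = (\<lambda>(x, y, z). inv x \<otimes> y \<otimes> z) ` (supp a \<times> supp a \<times> (\<Union>d\<in>supp b \<inter> D. conj_class H d))"
  have "finite V" unfolding V_def by (auto simp: D_def almost_centralizer_def)
  moreover have "\<exists>y\<in>supp b - D. conjg w y \<in> V" if w: "w \<in> hits H (proj b D) (proj a D)" for w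
  proof -
    obtain s where s: "w \<in> H" "s \<in> S w" "proj a D * s * proj b D \<noteq> 0" using w by (auto simp: hits_def)
    have wG: "w \<in> carrier G" using s HG by blast
    obtain z where z: "z \<in> supp (proj a D * s * proj b D)" using nonzeroE[OF s(3)] by blast
    then obtain g d where gd: "g \<in> supp a" "g \<in> D" "d \<in> supp b" "d \<in> D" "z = g \<otimes> w \<otimes> d"
      using supp_mult_hom_middle[OF z s(2) wG] by (auto simp: supp_proj)
    define a' where "a' = a - proj a D"
    define b' where "b' = b - proj b D"
    have supp': "supp a' = supp a - D" "supp b' = supp b - D"
      by (auto simp: supp_def a'_def b'_def cmp_diff cmp_proj)
    have "0 = proj a D * s * proj b D + proj a D * s * b' + a' * s * b"
      using zero[of s] by (simp add: a'_def b'_def left_diff_distrib right_diff_distrib)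
    then have "cmp (proj a D * s * proj b D) z + cmp (proj a D * s * b') z + cmp (a' * s * b) z = 0"
      by (metis cmp_add cmp_zero)
    then have "z \<in> supp (proj a D * s * b') \<or> z \<in> supp (a' * s * b)"
      using z by (auto simp: supp_def)
    then obtain g' d' where gd': "g' \<in> supp a" "d' \<in> supp b" "z = g' \<otimes> w \<otimes> d'" "d' \<notin> D \<or> g' \<notin> D"
      using supp_mult_hom_middle[OF _ s(2) wG, of z] by (fastforce simp: supp_proj supp')
    have G: "g \<in> carrier G" "d \<in> carrier G" "g' \<in> carrier G" "d' \<in> carrier G"
      using gd gd' supp_carrier[of a] supp_carrier[of b] by auto
    have e: "g' \<otimes> w \<otimes> d' = g \<otimes> w \<otimes> d" using gd(5) gd'(3) by simp
    have "d' \<notin> D"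
    proof
      assume d': "d' \<in> D"
      have "g' = (g' \<otimes> w \<otimes> d') \<otimes> (inv d' \<otimes> inv w)" using G wG by (simp add: m_assoc)
      also have "\<dots> = g \<otimes> conjg w (d \<otimes> inv d')" using e G wG by (simp add: conjg_def m_assoc)
      also have "\<dots> \<in> D"
      proof -
        have "d \<otimes> inv d' \<in> D" using gd(4) d' subgroup.m_closed[OF D] subgroup.m_inv_closed[OF D] by blast
        then have "conjg w (d \<otimes> inv d') \<in> D" unfolding D_def by (rule almost_centralizer_conjg[OF H s(1)])
        then show ?thesis using subgroup.m_closed[OF D gd(2)] by blast
      qed
      finally show False using gd'(4) d' by blast
    qed
    moreover have "conjg w d' \<in> V"
    proof -
      have "conjg w d' = inv g' \<otimes> (g' \<otimes> w \<otimes> d') \<otimes> inv w" using G wG by (simp add: conjg_def m_assoc)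
      also have "\<dots> = inv g' \<otimes> g \<otimes> conjg w d" unfolding e using G wG by (simp add: conjg_def m_assoc)
      finally show ?thesis
        using gd gd' s(1) unfolding V_def conj_class_def by (intro image_eqI[of _ _ "(g', g, conjg w d)"]) auto
    qed
    ultimately show ?thesis using gd'(2) by blast
  qed
  ultimately show ?thesis by blast
qed

section \<open>Minimal coset covers\<close>

lemma minimal_cover_annihilates:
  fixes b :: 'a and H
  defines "D \<equiv> almost_centralizer H"
  assumes A: "ideal_of A UNIV" and B: "ideal_of B UNIV" and AB: "A \<star> B = {0}"
    and good: "good_pair H I" and b: "b \<in> B" "covered D n b"
    and min: "\<And>H' I' b' i n'. good_pair H' I' \<Longrightarrow> b' \<in> B \<Longrightarrow> i \<in> I' \<Longrightarrow> i * b' \<noteq> 0 \<Longrightarrow>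
      covered (almost_centralizer H') n' b' \<Longrightarrow> n \<le> n'"
    and a: "a \<in> A" "a \<in> I \<star> UNIV" and h: "h \<in> H" "s \<in> S h"
  shows "proj a D * s * proj b D = 0"
proof (rule ccontr)
  assume ne: "\<not> ?thesis"
  have H: "subgroup H G" and HG: "\<And>h. h \<in> H \<Longrightarrow> h \<in> carrier G"
    using good_pairD(1,2)[OF good] by auto
  have D: "subgroup D G" unfolding D_def by (rule almost_centralizer_subgroup[OF H])
  have DG: "\<And>d. d \<in> D \<Longrightarrow> d \<in> carrier G" using subgroup.mem_carrier[OF D] .
  have "a * s * b = 0" for s
    using ideal_of_UNIV(2)[OF A a(1)] b(1) AB unfolding set_prod_eq_zero_iff by blast
  from hits_thin[OF H this] obtain V where V: "finite V"
    "hits H (proj b D) (proj a D) \<subseteq> {w. \<exists>y\<in>supp b - D. conjg w y \<in> V}" unfolding D_def by blast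
  have "hits H (proj b D) (proj a D) \<noteq> {}" using ne h by (auto simp: hits_def)
  then have "\<exists>g w K m y k r r'. g \<in> almost_centralizer H \<and> w \<in> H \<and> subgroup K G \<and> K \<subseteq> H \<and> m \<in> I \<and> m \<noteq> 0 \<and>
    returns H m \<subseteq> K \<and> y \<in> supp b - D \<and> finite (conj_class K (conjg w y)) \<and> k \<in> K \<and> r \<in> S k \<and>
    r' \<in> S (g \<otimes> w) \<and> m * r * r' * proj b D \<noteq> 0"
    by (intro good_pair_from_hits[OF good _ _ hull_proj[OF good a(2)] _ _ V])
      (use supp_carrier[of b] in \<open>auto simp: supp_proj D_def\<close>)
  then obtain g w K m y k r r' where g: "g \<in> D" and w: "w \<in> H" and K: "subgroup K G" "K \<subseteq> H"
    and m: "m \<in> I" "m \<noteq> 0" "returns H m \<subseteq> K" and y: "y \<in> supp b - D" "finite (conj_class K (conjg w y))"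
    and k: "k \<in> K" "r \<in> S k" "r' \<in> S (g \<otimes> w)" "m * r * r' * proj b D \<noteq> 0" unfolding D_def by blast
  have G: "g \<in> carrier G" "w \<in> carrier G" "k \<in> carrier G" "y \<in> carrier G"
    using g w k(1) K(2) y HG DG supp_carrier[of b] by auto
  define I' where "I' = conj_ideal K {\<one>} m"
  have good': "good_pair K I'" unfolding I'_def by (rule good_pair_subgroup[OF good m(1,2) K m(3)])
  have mS: "m \<in> S \<one>" using m(1) good_pairD(3)[OF good] by blast
  have "m * r * r' \<in> S (\<one> \<otimes> k \<otimes> (g \<otimes> w))" using mS k G by (intro S_mult) auto
  then have mr: "m * r * r' \<in> S (k \<otimes> (g \<otimes> w))" and kgw: "k \<otimes> (g \<otimes> w) \<in> carrier G" using G by auto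
  obtain d where d: "d \<in> supp (proj b D)"
  proof -
    have "proj b D \<noteq> 0" using k(4) by auto
    then show thesis using nonzeroE that by blast
  qed
  have dD: "d \<in> supp b" "d \<in> D" using d by (auto simp: supp_proj)
  \<comment> \<open>The left factor is homogeneous, so annihilating \<open>b\<close> would mean
    annihilating each component, in particular those in \<open>D\<close>.\<close>
  have "m * r * r' * b \<noteq> 0"
  proof
    assume z: "m * r * r' * b = 0"
    have "cmp (m * r * r' * proj b D) z = 0" if "z \<in> carrier G" for z
    proof -
      have "cmp (m * r * r' * proj b D) z = m * r * r' * cmp (proj b D) (inv (k \<otimes> (g \<otimes> w)) \<otimes> z)"
        using cmp_mult_left[OF mr kgw that] .
      then show ?thesis using homogeneous_zero_cmp[OF mr kgw z] by (simp add: cmp_proj)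
    qed
    then show False using k(4) zeroI by blast
  qed
  \<comment> \<open>Of degree \<open>inv k\<close>, so that \<open>u * m * r\<close> is a generator
    of the new ideal and does not annihilate \<open>r' * b\<close>.\<close>
  then obtain u where u: "u \<in> S (inv k)" "u * (m * r * r' * b) \<noteq> 0"
    using nonzero_left[of "m * r * r' * b" "inv k"] G by auto
  have iI: "u * m * r \<in> I'"
    unfolding I'_def using k u G subgroup.m_inv_closed[OF K(1) k(1)] by (intro conj_idealI[of "inv k" K k]) auto
  have ib: "u * m * r * (r' * b) \<noteq> 0" using u(2) by (simp add: mult.assoc)
  define D' where "D' = almost_centralizer K"
  have DD': "D \<subseteq> D'" unfolding D_def D'_def by (rule almost_centralizer_antimono[OF K(2)])
  have D': "subgroup D' G" unfolding D'_def by (rule almost_centralizer_subgroup[OF K(1)])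
  have yD': "conjg w y \<in> D'" using y(2) G by (auto simp: D'_def almost_centralizer_def)
  have conjD: "conjg w x \<in> D'" if "x \<in> D" for x
    using DD' almost_centralizer_conjg[OF H w, of x] that by (auto simp: D_def)
  obtain Q where Q: "finite Q" "card Q \<le> n" "Q \<subseteq> carrier G" "\<And>x. x \<in> supp b \<Longrightarrow> \<exists>k\<in>D. \<exists>q\<in>Q. x = k \<otimes> q"
    using b(2) unfolding covered_def by blast
  obtain k1 q1 where 1: "k1 \<in> D" "q1 \<in> Q" "d = k1 \<otimes> q1" using Q(4)[OF dD(1)] by blast
  obtain k2 q2 where 2: "k2 \<in> D" "q2 \<in> Q" "y = k2 \<otimes> q2" using Q(4) y(1) by blast
  have QG: "q1 \<in> carrier G" "q2 \<in> carrier G" "k1 \<in> carrier G" "k2 \<in> carrier G" using 1 2 Q(3) DG by auto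
  have q1D: "q1 \<in> D"
  proof -
    have "inv k1 \<otimes> d \<in> D" using subgroup.m_closed[OF D subgroup.m_inv_closed[OF D 1(1)] dD(2)] .
    then show ?thesis using 1(3) QG by simp
  qed
  have "q1 \<noteq> q2" using 2 q1D y(1) subgroup.m_closed[OF D] by blast
  define Q' where "Q' = (\<lambda>q. w \<otimes> q) ` (Q - {q2})"
  have "covered D' (n - 1) (r' * b)"
    unfolding covered_def
  proof (intro exI[of _ Q'] conjI ballI)
    show "finite Q'" using Q(1) by (simp add: Q'_def)
    have "card Q' \<le> card (Q - {q2})" unfolding Q'_def using Q(1) by (intro card_image_le) auto
    also have "\<dots> = card Q - 1" using 2(2) by simp
    finally show "card Q' \<le> n - 1" using Q(2) by simp
    show "Q' \<subseteq> carrier G" using Q(3) G by (auto simp: Q'_def)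
    fix x assume x: "x \<in> supp (r' * b)"
    then obtain z where z: "z \<in> supp b" "x = g \<otimes> w \<otimes> z" using supp_hom_left[OF k(3)] G by blast
    obtain l q where lq: "l \<in> D" "q \<in> Q" "z = l \<otimes> q" using Q(4)[OF z(1)] by blast
    have lG: "l \<in> carrier G" "q \<in> carrier G" using lq DG Q(3) by auto
    have gl: "g \<otimes> conjg w l \<in> D'" using g DD' conjD[OF lq(1)] subgroup.m_closed[OF D'] by blast
    have x1: "x = g \<otimes> conjg w l \<otimes> (w \<otimes> q)" using z(2) lq(3) lG G by (simp add: conjg_def m_assoc)
    show "\<exists>k\<in>D'. \<exists>q\<in>Q'. x = k \<otimes> q"
    proof (cases "q = q2")
      case False
      then show ?thesis using gl x1 lq(2) by (auto simp: Q'_def)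
    next
      case True
      define l' where "l' = g \<otimes> conjg w l \<otimes> (conjg w (inv k2) \<otimes> conjg w y \<otimes> conjg w (inv q1))"
      have "conjg w (inv k2) \<in> D'" "conjg w (inv q1) \<in> D'"
        using conjD subgroup.m_inv_closed[OF D] 2(1) q1D by auto
      moreover have "g \<in> D'" "conjg w l \<in> D'" using g DD' conjD[OF lq(1)] by auto
      ultimately have "l' \<in> D'" unfolding l'_def using yD' by (intro subgroup.m_closed[OF D'])
      moreover have "x = l' \<otimes> (w \<otimes> q1)"
        using x1 True 2(3) lG QG G by (simp add: l'_def conjg_def group_simps)
      moreover have "w \<otimes> q1 \<in> Q'" using 1(2) \<open>q1 \<noteq> q2\<close> by (auto simp: Q'_def)
      ultimately show ?thesis by blast
    qed
  qed
  then have "n \<le> n - 1"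
    unfolding D'_def by (rule min[OF good' ideal_of_UNIV(1)[OF B b(1)] iI ib])
  moreover have "n > 0" using Q(1,2) 1(2) card_gt_0_iff[of Q] by force
  ultimately show False by simp
qed

text \<open>The minimum is taken over all good pairs simultaneously, because the descent changes the
  pair. The pair given by the whole group and \<open>S \<one>\<close> shows that there is something
  to minimize.\<close>

lemma exists_minimal_annihilated:
  assumes A: "ideal_of A (UNIV :: 'a set)" and B: "ideal_of B (UNIV :: 'a set)" "B \<noteq> {0}" and AB: "A \<star> B = {0}"
  shows "\<exists>H I i b. good_pair H I \<and> i \<in> I \<and> i * cmp b \<one> \<noteq> 0 \<and>
    (\<forall>a\<in>A \<inter> (I \<star> UNIV). \<forall>h\<in>H. \<forall>s\<in>S h.
       proj a (almost_centralizer H) * s * proj b (almost_centralizer H) = 0)"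
proof -
  define P where "P n \<longleftrightarrow> (\<exists>H I b i. good_pair H I \<and> b \<in> B \<and> i \<in> I \<and> i * b \<noteq> 0 \<and>
      covered (almost_centralizer H) n b)" for n
  obtain b' where b': "b' \<in> B" "b' \<noteq> 0" using B by (auto simp: ideal_of_def add_subgroup_def)
  have whole: "good_pair (carrier G) (S \<one>)" using b' by (intro good_pair_whole) auto
  obtain i' where i': "i' \<in> S \<one>" "i' * b' \<noteq> 0" using nonzero_left[OF b'(2) one_closed] by blast
  have "\<one> \<in> almost_centralizer (carrier G)"
    using subgroup.one_closed[OF almost_centralizer_subgroup[OF subgroup_self]] .
  then have "covered (almost_centralizer (carrier G)) (card (supp b')) b'"
    by (rule covered_self)
  then have "\<exists>n. P n" using whole b' i' unfolding P_def by blast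
  then obtain n where n: "P n" "\<And>n'. P n' \<Longrightarrow> n \<le> n'" by (metis LeastI Least_le)
  then obtain H I b i where good: "good_pair H I" and b: "b \<in> B" "i \<in> I" "i * b \<noteq> 0"
    "covered (almost_centralizer H) n b" unfolding P_def by blast
  have iS: "i \<in> S \<one>" using b(2) good_pairD(3)[OF good] by blast
  obtain y where y: "y \<in> carrier G" "cmp (i * b) y \<noteq> 0" using b(3) nonzeroE by blast
  then have "i * cmp b y \<noteq> 0" using cmp_mult_left[OF iS one_closed y(1)] by simp
  \<comment> \<open>Right multiplication by \<open>t\<close> brings a surviving component to degree
    \<open>\<one>\<close>, which belongs to \<open>D\<close>, and merely translates the
    representatives of the cover.\<close>
  then obtain t where t: "t \<in> S (inv y)" "i * cmp b y * t \<noteq> 0"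
    using nonzero_right[of "i * cmp b y" "inv y"] y(1) by auto
  have "cmp (b * t) \<one> = cmp b y * t" using cmp_mult_right[OF t(1), of \<one> b] y(1) by simp
  then have ibt: "i * cmp (b * t) \<one> \<noteq> 0" using t(2) by (simp add: mult.assoc)
  obtain Q where Q: "finite Q" "card Q \<le> n" "Q \<subseteq> carrier G"
    "\<And>x. x \<in> supp b \<Longrightarrow> \<exists>k\<in>almost_centralizer H. \<exists>q\<in>Q. x = k \<otimes> q"
    using b(4) unfolding covered_def by blast
  have "covered (almost_centralizer H) n (b * t)"
    unfolding covered_def
  proof (intro exI[of _ "(\<lambda>q. q \<otimes> inv y) ` Q"] conjI ballI)
    show "card ((\<lambda>q. q \<otimes> inv y) ` Q) \<le> n" using card_image_le[OF Q(1)] Q(2) le_trans by blast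
    show "(\<lambda>q. q \<otimes> inv y) ` Q \<subseteq> carrier G" using Q(3) y(1) by auto
    fix x assume "x \<in> supp (b * t)"
    then obtain x' where x': "x' \<in> supp b" "x = x' \<otimes> inv y" using supp_hom_right[OF t(1)] y(1) by blast
    obtain k q where kq: "k \<in> almost_centralizer H" "q \<in> Q" "x' = k \<otimes> q" using Q(4)[OF x'(1)] by blast
    moreover have "x = k \<otimes> (q \<otimes> inv y)"
    proof -
      have "k \<in> carrier G" "q \<in> carrier G" using kq(1,2) Q(3) almost_centralizer_subset by auto
      then show ?thesis using x'(2) kq(3) y(1) by (simp add: m_assoc)
    qed
    ultimately show "\<exists>k\<in>almost_centralizer H. \<exists>q\<in>(\<lambda>q. q \<otimes> inv y) ` Q. x = k \<otimes> q" by blast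
  qed (use Q(1) in simp)
  from minimal_cover_annihilates[OF A B(1) AB good ideal_of_UNIV(2)[OF B(1) b(1)] this] n(2)
  have "proj a (almost_centralizer H) * s * proj (b * t) (almost_centralizer H) = 0"
    if "a \<in> A" "a \<in> I \<star> UNIV" "h \<in> H" "s \<in> S h" for a h s
    using that unfolding P_def by blast
  then show ?thesis using good b(2) ibt by blast
qed

section \<open>Reduction to a finite normal subgroup\<close>

lemma no_zero_product:
  assumes A: "ideal_of A (UNIV :: 'a set)" "A \<noteq> {0}" and B: "ideal_of B (UNIV :: 'a set)" "B \<noteq> {0}"
    and AB: "A \<star> B = {0}"
  shows False
proof -
  obtain H I i b where good: "good_pair H I" and i: "i \<in> I" "i * cmp b \<one> \<noteq> 0"
    and ann0: "\<forall>a\<in>A \<inter> (I \<star> UNIV). \<forall>h\<in>H. \<forall>s\<in>S h.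
       proj a (almost_centralizer H) * s * proj b (almost_centralizer H) = 0"
    using exists_minimal_annihilated[OF A(1) B AB] by blast
  have H: "subgroup H G" and HG: "\<And>h. h \<in> H \<Longrightarrow> h \<in> carrier G"
    using good_pairD(1,2)[OF good] by auto
  define D where "D = almost_centralizer H"
  have D: "subgroup D G" unfolding D_def by (rule almost_centralizer_subgroup[OF H])
  have ann: "proj a D * s * proj b D = 0" if "a \<in> A" "a \<in> I \<star> UNIV" "h \<in> H" "s \<in> S h" for a h s
    using ann0 that unfolding D_def by blast
  have iS: "i \<in> S \<one>" and i0: "i \<noteq> 0" using i good_pairD(3)[OF good] by auto
  have iI: "i \<in> I \<star> UNIV" by (rule subset_hull[OF good i(1)])
  have in_H: "x \<in> H" if "z \<otimes> x \<in> H" "z \<in> H" "x \<in> carrier G" for x z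
  proof -
    have "inv z \<otimes> (z \<otimes> x) \<in> H" using subgroup.m_closed[OF H subgroup.m_inv_closed[OF H that(2)] that(1)] .
    then show ?thesis using that HG by simp
  qed
  define k0 where "k0 = i * cmp b \<one>"
  have k0: "k0 \<in> I" "k0 \<noteq> 0"
    using i good_pairD(7)[OF good cmp_in[OF one_closed] i(1)] by (auto simp: k0_def)
  have k0S: "k0 \<in> S \<one>" using k0(1) good_pairD(3)[OF good] by blast
  obtain x t where t: "x \<in> H" "t \<in> S x" "k0 * t * k0 \<noteq> 0"
    using prime_like_degree_one[OF good k0 k0] by blast
  have xG: "x \<in> carrier G" using t HG by blast
  obtain u where u: "u \<in> S (inv x)" "k0 * t * k0 * u \<noteq> 0"
    using nonzero_right[OF t(3), of "inv x"] xG by auto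
  \<comment> \<open>The factor \<open>k0\<close> of \<open>v\<close> lies in \<open>I\<close>: with
    \<open>i\<close> on the left it annihilates all components of degree outside \<open>H\<close>,
    which puts the support of \<open>c0\<close> into the FC centre. The choice of \<open>t\<close>
    and \<open>u\<close> keeps the component of degree \<open>\<one>\<close> alive.\<close>
  define v where "v = t * k0 * u"
  have "v \<in> S (x \<otimes> \<one> \<otimes> inv x)" unfolding v_def using t k0S u xG by (intro S_mult) auto
  then have v: "v \<in> S \<one>" using xG by simp
  define c0 where "c0 = i * proj b D * v"
  have cmp_c0: "cmp c0 z = i * cmp (proj b D) z * v" if "z \<in> carrier G" for z
    unfolding c0_def using cmp_mult_right[OF v one_closed that] cmp_mult_left[OF iS one_closed that] that by simp
  have "cmp c0 \<one> = k0 * t * k0 * u"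
    using cmp_c0[OF one_closed] subgroup.one_closed[OF D] by (simp add: cmp_proj k0_def v_def mult.assoc)
  then have c0_ne: "c0 \<noteq> 0" using u(2) by auto
  have c0_supp: "supp c0 \<subseteq> fc_center H"
  proof
    fix z assume z: "z \<in> supp c0"
    then have zG: "z \<in> carrier G" using supp_carrier[of c0] by blast
    have nz: "i * cmp (proj b D) z * v \<noteq> 0" using z cmp_c0[OF zG] by (simp add: supp_def)
    then have zD: "z \<in> D" by (auto simp: cmp_proj split: if_splits)
    then have "i * (cmp b z * t) * k0 \<noteq> 0" using nz by (auto simp: cmp_proj v_def mult.assoc[symmetric])
    moreover have "cmp b z * t \<in> S (z \<otimes> x)" using S_mult[OF cmp_in t(2)] zG xG by simp
    ultimately have "z \<otimes> x \<in> H" using good_pair_zero[OF good _ _ i(1) _ k0(1)] zG xG by blast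
    then have "z \<otimes> x \<otimes> inv x \<in> H" using subgroup.m_closed[OF H _ subgroup.m_inv_closed[OF H t(1)]] by blast
    then show "z \<in> fc_center H" using zD zG xG by (simp add: fc_center_def D_def m_assoc)
  qed
  have "c0 \<in> right_annihilator A H I"
    unfolding right_annihilator_def D_def[symmetric]
  proof (intro CollectI conjI ballI c0_supp)
    show "c0 \<in> I \<star> UNIV" unfolding c0_def by (intro hull_right[OF good] iI)
    fix a h s assume a: "a \<in> A \<inter> (I \<star> UNIV)" and h: "h \<in> H" "s \<in> S h"
    have "s * i \<in> S h" using S_mult[OF h(2) iS] HG[OF h(1)] by simp
    then have "proj a D * (s * i) * proj b D = 0" using ann a h(1) by blast
    then show "proj a D * s * c0 = 0" by (simp add: c0_def mult.assoc[symmetric])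
  qed
  moreover have "covered (fc_torsion H) (card (supp c0)) c0"
    by (rule covered_self[OF subgroup.one_closed[OF fc_torsion_subgroup[OF H]]])
  ultimately have cov0: "\<exists>c\<in>right_annihilator A H I. c \<noteq> 0 \<and> covered (fc_torsion H) (card (supp c0)) c"
    using c0_ne by blast
  define M where "M n \<longleftrightarrow> (\<exists>c\<in>right_annihilator A H I. c \<noteq> 0 \<and> covered (fc_torsion H) n c)" for n
  have "M (card (supp c0))" unfolding M_def by (rule cov0)
  then obtain n where n: "M n" "\<And>n'. M n' \<Longrightarrow> n \<le> n'" by (metis LeastI Least_le)
  then obtain c where c: "c \<in> right_annihilator A H I" "c \<noteq> 0" "covered (fc_torsion H) n c"
    unfolding M_def by blast
  \<comment> \<open>Elements of \<open>I\<close> on both sides confine the support to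
    \<open>H\<close>. To avoid killing everything, \<open>i\<close> is first linked to a nonzero
    degree-one multiple of some component of an element of \<open>A\<close>, and then back to
    \<open>i\<close>, by applying \<open>prime_like_degree_one\<close> to the whole group.\<close>
  obtain a where a: "a \<in> A" "a \<in> I \<star> UNIV" "supp a \<subseteq> H" "cmp a \<one> \<noteq> 0"
  proof -
    have "(UNIV :: 'a set) \<noteq> {0}" using i0 by auto
    then have whole: "good_pair (carrier G) (S \<one>)" by (rule good_pair_whole)
    obtain a0 where a0: "a0 \<in> A" "a0 \<noteq> 0" using A by (auto simp: ideal_of_def add_subgroup_def)
    obtain y where y: "y \<in> carrier G" "cmp a0 y \<noteq> 0" using a0(2) nonzeroE by blast
    obtain v where v: "v \<in> S (inv y)" "cmp a0 y * v \<noteq> 0" using nonzero_right[OF y(2), of "inv y"] y(1) by auto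
    have "cmp a0 y * v \<in> S \<one>" using S_mult[OF cmp_in[OF y(1)] v(1)] y(1) by simp
    from prime_like_degree_one[OF whole iS i0 this v(2)]
    obtain x s where x: "x \<in> carrier G" "s \<in> S x" "i * s * (cmp a0 y * v) \<noteq> 0" by blast
    obtain u where u: "u \<in> S (inv x)" "i * s * (cmp a0 y * v) * u \<noteq> 0" using nonzero_right[OF x(3), of "inv x"] x(1) by auto
    have "i * s * (cmp a0 y * v) * u \<in> S (\<one> \<otimes> x \<otimes> (y \<otimes> inv y) \<otimes> inv x)"
      using iS x y v u by (intro S_mult cmp_in) auto
    then have "i * s * (cmp a0 y * v) * u \<in> S \<one>" using x(1) y(1) by simp
    from prime_like_degree_one[OF whole this u(2) iS i0]
    obtain z t where z: "z \<in> carrier G" "t \<in> S z" "i * s * (cmp a0 y * v) * u * t * i \<noteq> 0" by blast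
    \<comment> \<open>The degree of \<open>v * u * t\<close> is such that the component of
      \<open>m\<close> in degree \<open>z\<close> involves exactly the component of
      \<open>a0\<close> in degree \<open>y\<close>, reproducing the nonzero product above.\<close>
    define m where "m = s * a0 * (v * u * t)"
    define a1 where "a1 = i * m * i"
    have cmp_a1: "cmp a1 w = i * cmp m w * i" if "w \<in> carrier G" for w
      unfolding a1_def using cmp_mult_right[OF iS one_closed that] cmp_mult_left[OF iS one_closed that] that by simp
    have vut: "v * u * t \<in> S (inv y \<otimes> inv x \<otimes> z)" using v u z x y by (intro S_mult) auto
    have "cmp m z = cmp (s * a0) (z \<otimes> inv (inv y \<otimes> inv x \<otimes> z)) * (v * u * t)"
      unfolding m_def using x(1) y(1) z(1) by (intro cmp_mult_right[OF vut]) auto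
    also have "z \<otimes> inv (inv y \<otimes> inv x \<otimes> z) = x \<otimes> y" using x(1) y(1) z(1) by (simp add: group_simps)
    also have "cmp (s * a0) (x \<otimes> y) = s * cmp a0 y" using cmp_mult_left[OF x(2,1), of "x \<otimes> y" a0] x(1) y(1) by simp
    finally have "cmp a1 z \<noteq> 0" using z(3) cmp_a1[OF z(1)] by (simp add: mult.assoc)
    then obtain u' where u': "u' \<in> S (inv z)" "cmp a1 z * u' \<noteq> 0" using nonzero_right[of "cmp a1 z" "inv z"] z(1) by auto
    have sH: "w \<in> H" if "w \<in> supp a1" for w
    proof -
      have wG: "w \<in> carrier G" and "i * cmp m w * i \<noteq> 0"
        using that cmp_a1 supp_carrier[of a1] by (auto simp: supp_def)
      then show ?thesis using good_pair_zero[OF good _ _ i(1) cmp_in i(1)] by blast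
    qed
    have "cmp a1 z \<noteq> 0" using u'(2) by auto
    then have zH: "z \<in> H" using sH by (simp add: supp_def)
    have "supp (a1 * u') \<subseteq> H"
    proof
      fix w assume "w \<in> supp (a1 * u')"
      then obtain w' where "w' \<in> supp a1" "w = w' \<otimes> inv z" using supp_hom_right[OF u'(1)] z(1) by blast
      then show "w \<in> H" using subgroup.m_closed[OF H sH subgroup.m_inv_closed[OF H zH]] by simp
    qed
    moreover have "cmp (a1 * u') \<one> = cmp a1 z * u'" using cmp_mult_right[OF u'(1), of \<one> a1] z(1) by simp
    moreover have "a1 * u' \<in> A" unfolding a1_def m_def
      by (intro ideal_of_UNIV[OF A(1)] a0(1))
    moreover have "a1 * u' \<in> I \<star> UNIV" unfolding a1_def by (intro hull_right[OF good] iI)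
    ultimately show thesis using that u'(2) by auto
  qed
  define T where "T = torsion_coset H \<one>"
  have Ts: "T = fc_torsion H"
    using subgroup.mem_carrier[OF fc_torsion_subgroup[OF H]] by (auto simp: T_def torsion_coset_def)
  define e where "e = proj (proj a D) T"
  have e_zero: "e * s * c = 0" if "h \<in> H" "s \<in> S h" for h s
    unfolding e_def T_def
  proof (rule torsion_components_annihilate[OF good A(1) c(1,3) _ _ _ one_closed that])
    show "n \<le> n'" if "c' \<in> right_annihilator A H I" "c' \<noteq> 0" "covered (fc_torsion H) n' c'" for c' n'
      using n(2) that unfolding M_def by blast
    show "supp (proj a D) \<subseteq> fc_center H" using a(3) by (auto simp: supp_proj fc_center_def D_def)
    show "proj a D * s * c = 0" if "h \<in> H" "s \<in> S h" for h s
      using c(1) a(1,2) that by (auto simp: right_annihilator_def D_def)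
  qed
  have "cmp e \<one> = cmp a \<one>"
    using subgroup.one_closed[OF D] subgroup.one_closed[OF fc_torsion_subgroup[OF H]]
    by (simp add: e_def cmp_proj Ts)
  then have e0: "e \<noteq> 0" using a(4) by auto
  have eI: "e \<in> I \<star> UNIV" unfolding e_def by (intro hull_proj[OF good] a(2))
  have eT: "supp e \<subseteq> fc_torsion H" by (auto simp: e_def supp_proj Ts)
  obtain p where p: "p \<in> supp c" using c(2) nonzeroE by blast
  have cI: "c \<in> I \<star> UNIV" and cK: "supp c \<subseteq> fc_center H" using c(1) by (auto simp: right_annihilator_def)
  have pG: "p \<in> carrier G" using p supp_carrier[of c] by blast
  \<comment> \<open>A single torsion coset of \<open>c\<close>, which a factor of degree
    \<open>inv p\<close> later moves into the torsion subgroup.\<close>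
  define c1 where "c1 = proj c (torsion_coset H p)"
  have TT: "subgroup (fc_torsion H) G" by (rule fc_torsion_subgroup[OF H])
  have "cmp c1 p \<noteq> 0"
    using p pG subgroup.one_closed[OF TT] by (simp add: c1_def cmp_proj torsion_coset_def supp_def)
  then have c1: "c1 \<noteq> 0" by auto
  have c1_zero: "e * s * c1 = 0" if h: "h \<in> H" "s \<in> S h" for h s
  proof (rule zeroI)
    fix w assume w: "w \<in> carrier G"
    have hG: "h \<in> carrier G" using h(1) HG by blast
    \<comment> \<open>The support of \<open>e * s\<close> lies in one torsion coset of
      \<open>h\<close>, and \<open>H\<close> normalizes the torsion subgroup. The condition
      therefore depends on \<open>w\<close> alone: restricting \<open>c\<close> to the coset of
      \<open>p\<close> either keeps the whole component of \<open>e * s * c\<close> in degree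
      \<open>w\<close> or removes it.\<close>
    have cond: "inv x \<otimes> w \<in> torsion_coset H p \<longleftrightarrow> w \<otimes> inv p \<otimes> inv h \<in> fc_torsion H" if x: "x \<in> supp (e * s)" for x
    proof -
      obtain y where y: "y \<in> supp e" "x = y \<otimes> h" using supp_hom_right[OF h(2) hG] x by blast
      have yT: "y \<in> fc_torsion H" and yG: "y \<in> carrier G" using y eT subgroup.mem_carrier[OF TT] by auto
      define r where "r = inv x \<otimes> w \<otimes> inv p"
      have rG: "r \<in> carrier G" using y(2) yG hG w pG by (simp add: r_def)
      have r: "w \<otimes> inv p \<otimes> inv h = y \<otimes> conjg h r"
        using y(2) yG hG w pG by (simp add: r_def conjg_def group_simps)
      have "r \<in> fc_torsion H \<longleftrightarrow> w \<otimes> inv p \<otimes> inv h \<in> fc_torsion H"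
      proof
        assume "r \<in> fc_torsion H"
        then show "w \<otimes> inv p \<otimes> inv h \<in> fc_torsion H"
          unfolding r using fc_torsion_conjg[OF H h(1)] subgroup.m_closed[OF TT yT] by blast
      next
        assume "w \<otimes> inv p \<otimes> inv h \<in> fc_torsion H"
        then have "inv y \<otimes> (y \<otimes> conjg h r) \<in> fc_torsion H"
          unfolding r using subgroup.m_closed[OF TT subgroup.m_inv_closed[OF TT yT]] by blast
        then have "conjg h r \<in> fc_torsion H" using yG hG rG by simp
        then have "conjg (inv h) (conjg h r) \<in> fc_torsion H"
          by (rule fc_torsion_conjg[OF H subgroup.m_inv_closed[OF H h(1)]])
        then show "r \<in> fc_torsion H" using hG rG by simp
      qed
      moreover have "inv x \<otimes> w \<in> carrier G" using y(2) yG hG w by simp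
      ultimately show ?thesis by (simp add: torsion_coset_def r_def)
    qed
    have "cmp (e * s * c1) w = (\<Sum>x\<in>supp (e * s). cmp (e * s) x * cmp c1 (inv x \<otimes> w))"
      by (rule cmp_mult[OF w finite_supp subset_refl supp_carrier])
    also have "\<dots> = (\<Sum>x\<in>supp (e * s). cmp (e * s) x *
        (if w \<otimes> inv p \<otimes> inv h \<in> fc_torsion H then cmp c (inv x \<otimes> w) else 0))"
      using cond by (intro sum.cong) (auto simp: c1_def cmp_proj)
    also have "\<dots> = (if w \<otimes> inv p \<otimes> inv h \<in> fc_torsion H then cmp (e * s * c) w else 0)"
      using cmp_mult[OF w finite_supp subset_refl supp_carrier, of "e * s" c] by simp
    also have "\<dots> = 0" using e_zero[OF h] by simp
    finally show "cmp (e * s * c1) w = 0" .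
  qed
  obtain u' where u': "u' \<in> S (inv p)" "c1 * u' \<noteq> 0" using nonzero_right[OF c1, of "inv p"] pG by auto
  define c2 where "c2 = c1 * u'"
  have c2I: "c2 \<in> I \<star> UNIV" unfolding c2_def c1_def by (intro hull_right[OF good] hull_proj[OF good] cI)
  have c2T: "supp c2 \<subseteq> fc_torsion H"
  proof
    fix z assume "z \<in> supp c2"
    then obtain y where "y \<in> supp c1" "z = y \<otimes> inv p" using supp_hom_right[OF u'(1)] pG unfolding c2_def by blast
    then show "z \<in> fc_torsion H" by (auto simp: c1_def supp_proj torsion_coset_def)
  qed
  have "finite (supp e \<union> supp c2)" "supp e \<union> supp c2 \<subseteq> fc_torsion H" using eT c2T by auto
  from dietzmann[OF H this] obtain N where N: "finite N" "N \<lhd> G\<lparr>carrier := H\<rparr>" "supp e \<subseteq> N" "supp c2 \<subseteq> N" by auto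
  have "c2 \<noteq> 0" using u'(2) by (simp add: c2_def)
  from prime_like[OF good N(2,1) eI N(3) e0 c2I N(4) this] obtain h s where
    "h \<in> H" "s \<in> S h" "e * s * c2 \<noteq> 0" by blast
  then show False using c1_zero by (simp add: c2_def mult.assoc[symmetric])
qed

end

theorem corollary11p1:
  fixes G :: "('g, 'm) monoid_scheme"
    and S :: "'g \<Rightarrow> 'a::ring set"
  assumes "group G"
    and "strongly_graded G S"
    and "s_unital (UNIV :: 'a set)"
    and "(UNIV :: 'a set) \<noteq> {0}"
  shows "\<not> prime_ring (UNIV :: 'a set) \<longleftrightarrow>
    (\<exists>H N I A B. NP_datum G S H N I A B \<and> invariant G S H A \<and> invariant G S H B)"
proof
  interpret group G by (rule assms(1))
  interpret strong_graded_ring G S by unfold_locales (rule assms(2,3))+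
  assume not_prime: "\<not> prime_ring (UNIV :: 'a set)"
  show "\<exists>H N I A B. NP_datum G S H N I A B \<and> invariant G S H A \<and> invariant G S H B"
  proof (rule ccontr)
    assume "\<not> ?thesis"
    then interpret no_NP_datum G S by unfold_locales
    have "ideal_of {0} (UNIV :: 'a set)" by (simp add: ideal_of_def add_subgroup_def)
    then obtain A B :: "'a set" where "ideal_of A UNIV" "A \<noteq> {0}" "ideal_of B UNIV" "B \<noteq> {0}" "A \<star> B = {0}"
      using not_prime assms(4) unfolding prime_ring_def by blast
    then show False by (rule no_zero_product)
  qed
next
  interpret group G by (rule assms(1))
  interpret strong_graded_ring G S by unfold_locales (rule assms(2,3))+
  assume "\<exists>H N I A B. NP_datum G S H N I A B \<and> invariant G S H A \<and> invariant G S H B"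
  then show "\<not> prime_ring (UNIV :: 'a set)" using not_prime_if_datum by blast
qed

end
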